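(* Let $\nu : \mathbb{R} \to \mathbb{R}_{>0}$ be a positive, real-valued function such that $\lim_{x \to \infty} \nu(x) = 0$ and such that the function $f(x) := (\log x)^{\nu(x)}$, $x>1$, is increasing with $\lim_{x \to \infty} f(x) = \infty$. Then there exist constants $C>0$ and $Q_1 \geq 16$, depending only on $\nu$, such that for every $Q \geq Q_1$ for which $L(s,\chi)$ satisfies Hypothesis $H_f$ for all $\chi \in \mathcal{S}(Q^2)$, the number of exceptional primitive quadratic characters with modulus at most $Q$ is at most $C \log\log\log Q$.
   Context: For a primitive Dirichlet character $\chi$, $q_\chi$ denotes its conductor (modulus) and $L(s,\chi)$ its Dirichlet $L$-function (analytically continued). For $Q \geq 2$, $$\mathcal{S}(Q)=\{\chi \bmod q_{\chi} : \chi \text{ primitive and real},\ 1 \leq q_{\chi} \leq Q\}.$$ Hypothesis $H_f$: for a primitive real character $\chi \bmod q_\chi$ and a positive increasing function $f$ tending to infinity, we say that $L(s,\chi)$ satisfies Hypothesis $H_f$ provided all the zeros of $L(s,\chi)$ inside the disk $|s-1|<1/f(q_\chi)$, if any, are real. Since $f$ is only defined for $x>1$, this is understood as a condition on the characters with $q_\chi>1$. Exceptional characters: fix an absolute constant $c_0>0$ such that for every primitive Dirichlet character $\chi$ of conductor $q\ge 3$, $L(s,\chi)$ has at most a single zero in the region $\sigma \geq 1-\frac{c_0}{\log(q(|t|+2))}$ (where $s=\sigma+it$), and if that zero exists then it is real and $\chi$ is quadratic (such a $c_0$ exists by the classical zero-free region). A primitive quadratic character $\chi$ of conductor $q$ is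 called exceptional if $L(s,\chi)$ has a real zero $\beta$ in this region, i.e. $\beta \geq 1-\frac{c_0}{\log(2q)}$. *)

theory Defs
  imports "HOL-Complex_Analysis.Complex_Analysis" "HOL-Number_Theory.Cong"
begin

text \<open>This frees the symbol \<open>\<chi>\<close>.\<close>
unbundle no vec_syntax

section \<open>Dirichlet characters\<close>

definition dirichlet_character :: "nat \<Rightarrow> (nat \<Rightarrow> complex) \<Rightarrow> bool" where
  "dirichlet_character q \<chi> \<longleftrightarrow>
     q > 0 \<and>
     (\<forall>m n. \<chi> (m * n) = \<chi> m * \<chi> n) \<and>
     (\<forall>n. \<chi> (n + q) = \<chi> n) \<and>
     (\<forall>n. \<chi> n \<noteq> 0 \<longleftrightarrow> coprime n q)"

text \<open>
  No proper divisor \<open>d\<close> of \<open>q\<close> is an induced modulus. The conductor of a primitive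
  character modulo \<open>q\<close> is therefore \<open>q\<close> itself. The only character modulo 1, the
  constant 1, counts as primitive.
\<close>
definition primitive_character :: "nat \<Rightarrow> (nat \<Rightarrow> complex) \<Rightarrow> bool" where
  "primitive_character q \<chi> \<longleftrightarrow>
     dirichlet_character q \<chi> \<and>
     (\<forall>d. d dvd q \<and> d < q \<longrightarrow> (\<exists>n. coprime n q \<and> [n = 1] (mod d) \<and> \<chi> n \<noteq> 1))"

definition real_character :: "(nat \<Rightarrow> complex) \<Rightarrow> bool" where
  "real_character \<chi> \<longleftrightarrow> (\<forall>n. \<chi> n \<in> \<real>)"

text \<open>Quadratic means of order exactly two in the group of characters modulo \<open>q\<close>.\<close>
definition quadratic_character :: "nat \<Rightarrow> (nat \<Rightarrow> complex) \<Rightarrow> bool" where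
  "quadratic_character q \<chi> \<longleftrightarrow>
     (\<forall>n. coprime n q \<longrightarrow> \<chi> n ^ 2 = 1) \<and> (\<exists>n. coprime n q \<and> \<chi> n \<noteq> 1)"


section \<open>Dirichlet \<open>L\<close>-functions\<close>

definition is_dirichlet_L :: "(nat \<Rightarrow> complex) \<Rightarrow> (complex \<Rightarrow> complex) \<Rightarrow> bool" where
  "is_dirichlet_L \<chi> F \<longleftrightarrow>
     F nicely_meromorphic_on UNIV \<and>
     (\<forall>s. Re s > 1 \<longrightarrow> F s = (\<Sum>n. \<chi> (Suc n) / of_nat (Suc n) powr s))"

text \<open>
  The meromorphic continuation of the Dirichlet series to the whole plane. It is entire
  unless \<open>\<chi>\<close> is principal. For principal \<open>\<chi>\<close> the pole at 1 gets the junk value 0; below,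
  zeros are only ever considered for primitive characters of modulus greater than 1.
\<close>
definition dirichlet_L :: "(nat \<Rightarrow> complex) \<Rightarrow> complex \<Rightarrow> complex" where
  "dirichlet_L \<chi> = (THE F. is_dirichlet_L \<chi> F)"

lemma is_dirichlet_L_unique:
  assumes "is_dirichlet_L \<chi> F" "is_dirichlet_L \<chi> G"
  shows   "F = G"
proof
  fix z :: complex
  have F: "F nicely_meromorphic_on UNIV" and G: "G nicely_meromorphic_on UNIV"
    using assms by (auto simp: is_dirichlet_L_def)
  have eq: "F s = G s" if "Re s > 1" for s
    using assms that by (auto simp: is_dirichlet_L_def)
  have mF: "F meromorphic_on UNIV" and mG: "G meromorphic_on UNIV"
    using F G by (auto simp: nicely_meromorphic_on_def)
  have m: "(\<lambda>s. F s - G s) meromorphic_on UNIV"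
    using mF mG by (intro meromorphic_intros)
  have "eventually (\<lambda>s. s \<in> {s. Re s > 1}) (nhds (2::complex))"
    by (intro eventually_nhds_in_open open_halfspace_Re_gt) auto
  hence "eventually (\<lambda>s. F s - G s = 0) (at 2)"
    unfolding eventually_at_filter by eventually_elim (auto simp: eq)
  hence "frequently (\<lambda>s. F s - G s = 0) (at 2)"
    by (intro eventually_frequently) auto
  moreover have "(\<forall>\<^sub>\<approx>s\<in>UNIV. F s - G s = 0) \<or> (\<forall>\<^sub>\<approx>s\<in>UNIV. F s - G s \<noteq> 0)"
    by (rule meromorphic_imp_constant_or_avoid[OF m]) auto
  ultimately have "\<forall>\<^sub>\<approx>s\<in>UNIV. F s - G s = 0"
    by (auto simp: eventually_cosparse_open_eq frequently_def)
  hence ev: "eventually (\<lambda>s. F s = G s) (at z)"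
    by (auto simp: eventually_cosparse_open_eq)
  have lim: "(is_pole H z \<and> H z = 0) \<or> H \<midarrow>z\<rightarrow> H z"
    if "H nicely_meromorphic_on UNIV" for H
    using that by (auto simp: nicely_meromorphic_on_def)
  have pole: "is_pole F z \<longleftrightarrow> is_pole G z"
    by (rule is_pole_cong[OF ev refl])
  show "F z = G z"
  proof (cases "is_pole F z")
    case True
    hence "\<not> F \<midarrow>z\<rightarrow> F z" "\<not> G \<midarrow>z\<rightarrow> G z"
      using pole not_tendsto_and_filterlim_at_infinity[of "at z"] unfolding is_pole_def by auto
    thus ?thesis using lim[OF F] lim[OF G] by auto
  next
    case False
    hence "F \<midarrow>z\<rightarrow> F z" "G \<midarrow>z\<rightarrow> G z" using lim[OF F] lim[OF G] pole by auto
    moreover have "F \<midarrow>z\<rightarrow> G z"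
      using \<open>G \<midarrow>z\<rightarrow> G z\<close> tendsto_cong[OF ev] by blast
    ultimately show ?thesis using tendsto_unique[of "at z" F] by auto
  qed
qed

lemma dirichlet_L_eqI: "is_dirichlet_L \<chi> F \<Longrightarrow> dirichlet_L \<chi> = F"
  unfolding dirichlet_L_def by (rule the_equality) (auto intro: is_dirichlet_L_unique)


section \<open>Hypothesis \<open>H\<^sub>f\<close> and exceptional characters\<close>

text \<open>Each character is paired with its modulus.\<close>
definition real_primitive_characters :: "real \<Rightarrow> (nat \<times> (nat \<Rightarrow> complex)) set" where
  "real_primitive_characters Q =
     {(q, \<chi>). primitive_character q \<chi> \<and> real_character \<chi> \<and> 1 \<le> q \<and> real q \<le> Q}"

definition hypothesis_H :: "(real \<Rightarrow> real) \<Rightarrow> nat \<Rightarrow> (nat \<Rightarrow> complex) \<Rightarrow> bool" where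
  "hypothesis_H f q \<chi> \<longleftrightarrow>
     (q > 1 \<longrightarrow> (\<forall>s. norm (s - 1) < 1 / f (real q) \<and> dirichlet_L \<chi> s = 0 \<longrightarrow> s \<in> \<real>))"

definition zero_free_region :: "real \<Rightarrow> nat \<Rightarrow> complex set" where
  "zero_free_region c q = {s. Re s \<ge> 1 - c / ln (real q * (\<bar>Im s\<bar> + 2))}"

definition admissible_constant :: "real \<Rightarrow> bool" where
  "admissible_constant c \<longleftrightarrow>
     c > 0 \<and>
     (\<forall>q \<chi>. q \<ge> 3 \<and> primitive_character q \<chi> \<longrightarrow>
        (\<forall>s\<in>zero_free_region c q. \<forall>s'\<in>zero_free_region c q.
            dirichlet_L \<chi> s = 0 \<and> dirichlet_L \<chi> s' = 0 \<longrightarrow> s = s') \<and>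
        (\<forall>s\<in>zero_free_region c q.
            dirichlet_L \<chi> s = 0 \<longrightarrow> s \<in> \<real> \<and> quadratic_character q \<chi>))"

definition exceptional_character :: "real \<Rightarrow> nat \<Rightarrow> (nat \<Rightarrow> complex) \<Rightarrow> bool" where
  "exceptional_character c q \<chi> \<longleftrightarrow>
     primitive_character q \<chi> \<and> quadratic_character q \<chi> \<and>
     (\<exists>\<beta>::real. dirichlet_L \<chi> (of_real \<beta>) = 0 \<and> \<beta> \<ge> 1 - c / ln (2 * real q))"

end

theory Submission
  imports Defs "HOL-Real_Asymp.Real_Asymp"
begin

text \<open>
  Two exceptional characters repel each other so strongly that the iterated logarithm of
  the modulus at least doubles from one exceptional character to the next.

  Let \<open>\<chi>1\<close>, \<open>\<chi>2\<close> be distinct, with moduli \<open>q1 \<le> q2\<close> and real zeros \<open>\<beta>1\<close>, \<open>\<beta>2\<close> close to 1. Consider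
  \<open>G(s) = (s - 1) \<zeta>(s) L(s, \<chi>1) L(s, \<chi>2) L(s, \<chi>1 \<chi>2)\<close>, which is holomorphic for \<open>Re s > 0\<close>, and expand
  \<open>log G\<close> around \<open>s0 = 1 + \<eta>\<close> in two ways. By the Euler product, \<open>G(s) = (s - 1) exp (P(s))\<close>
  for \<open>Re s > 1\<close>, where
  \<open>P(s) = \<Sum>\<^sub>p \<Sum>\<^sub>m (1 + \<chi>1(p)^m) (1 + \<chi>2(p)^m) p^(-m s) / m\<close>
  has nonnegative coefficients. The derivatives of \<open>P\<close> of even order are therefore nonnegative at
  \<open>s0\<close> (\<open>even_derivs_nonneg_euler_logs\<close>). On the other hand, \<open>G\<close> is the product of the factors
  \<open>s - \<beta>\<close> over its zeros \<open>\<beta>\<close> in a disc of radius \<open>r\<close> and of a zero-free function whose logarithm has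
  a \<open>j\<close>-th Taylor coefficient of size at most about \<open>A (2/r)^j\<close>, where \<open>A\<close> is of size \<open>log (q2 / r)\<close>.
  When all zeros in that disc are real and \<open>j\<close> is even, each of them contributes with the same sign, so
  all but two may be dropped, and
  \<open>1 / (s0 - \<beta>1)^j + 1 / (s0 - \<beta>2)^j \<le> 1 / \<eta>^j + 2 j A (2/r)^j\<close>
  (\<open>real_zeros_even_power_bound\<close>). The pole of \<open>\<zeta>\<close> can pay for one zero, but not for two: with \<open>\<eta> = r / 16\<close>
  and \<open>j\<close> of size \<open>2 log A\<close> the last term is negligible against \<open>1 / \<eta>^j\<close>, and the left-hand side is
  close to \<open>2 / \<eta>^j\<close> unless \<open>1 - \<beta>1\<close> or \<open>1 - \<beta>2\<close> is at least of order \<open>r / j\<close>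
  (\<open>exceptional_repulsion\<close>).

  Hypothesis \<open>H\<^sub>f\<close> makes all zeros real in a disc of radius \<open>r = 1 / (2 f(q2\<^sup>2))\<close>. Since \<open>\<nu>\<close> tends to 0, both
  \<open>1 / r\<close> and \<open>j\<close> are smaller than any power of \<open>log q2\<close>, whereas \<open>1 - \<beta>1\<close> and \<open>1 - \<beta>2\<close> are at most
  \<open>c\<^sub>0 / log q1\<close>. Hence \<open>log q1 \<le> sqrt (log q2)\<close> for large \<open>q2\<close>, that is,
  \<open>2 log log q1 \<le> log log q2\<close>, and only \<open>O(log log log Q)\<close> such steps fit below \<open>log log Q\<close>.

  The character \<open>\<chi>1 \<chi>2\<close> need not be primitive. In \<open>Re s > 0\<close> its \<open>L\<close>-function has the same zeros as that of
  the primitive character inducing it, whose conductor is at most \<open>q1 q2 \<le> Q\<^sup>2\<close>; this is why the hypothesis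
  is imposed up to \<open>Q\<^sup>2\<close>.
\<close>

section \<open>Dirichlet series with periodic coefficients\<close>

lemma holomorphic_on_suminf:
  fixes f :: "nat \<Rightarrow> complex \<Rightarrow> complex"
  assumes "open S" and hol: "\<And>n. f n holomorphic_on S"
    and bd: "\<And>x. x \<in> S \<Longrightarrow> \<exists>d>0. \<exists>M. cball x d \<subseteq> S \<and> summable M \<and> (\<forall>n. \<forall>y\<in>cball x d. norm (f n y) \<le> M n)"
  shows "(\<lambda>s. \<Sum>n. f n s) holomorphic_on S"
proof (rule holomorphic_uniform_sequence[OF \<open>open S\<close>])
  show "(\<lambda>s. \<Sum>i<n. f i s) holomorphic_on S" for n
    using hol by (intro holomorphic_intros)
  fix x assume "x \<in> S"
  from bd[OF this] obtain d M where d: "d > 0" "cball x d \<subseteq> S" and M: "summable M"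
    and le: "\<forall>n. \<forall>y\<in>cball x d. norm (f n y) \<le> M n"
    by (elim exE conjE) (rule that, assumption+)
  have "uniform_limit (cball x d) (\<lambda>n s. \<Sum>i<n. f i s) (\<lambda>s. \<Sum>n. f n s) sequentially"
    by (rule Weierstrass_m_test[OF _ M]) (rule le[rule_format])
  with d show "\<exists>d>0. cball x d \<subseteq> S \<and> uniform_limit (cball x d) (\<lambda>n s. \<Sum>i<n. f i s) (\<lambda>s. \<Sum>n. f n s) sequentially"
    by blast
qed

text \<open>
  The \<open>k\<close>-th forward difference of \<open>w \<mapsto> w powr (-s)\<close>, with the sign \<open>(-1)^k\<close>. Each difference gains one power of \<open>w\<close> in decay,
  which is what moves the half-plane of convergence to the left.
\<close>
primrec powr_diff :: "nat \<Rightarrow> complex \<Rightarrow> complex \<Rightarrow> complex" where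
  "powr_diff 0 s w = w powr (-s)"
| "powr_diff (Suc k) s w = powr_diff k s w - powr_diff k s (w + 1)"

lemma powr_diff_holomorphic:
  assumes "Re w > 0"
  shows "(\<lambda>s. powr_diff k s w) holomorphic_on A"
  using assms
proof (induction k arbitrary: w)
  case 0
  then have "w \<noteq> 0" by auto
  then show ?case by (auto intro!: holomorphic_intros)
qed (auto intro!: holomorphic_intros)

lemma has_field_derivative_powr_diff:
  assumes "Re w > 0"
  shows "(powr_diff k s has_field_derivative (-s) * powr_diff k (s + 1) w) (at w within A)"
  using assms
proof (induction k arbitrary: w A)
  case 0
  then have "w \<notin> \<real>\<^sub>\<le>\<^sub>0" by (auto simp: complex_nonpos_Reals_iff)
  then have "((\<lambda>z. z powr (-s)) has_field_derivative (-s) * w powr (-s - 1)) (at w within A)"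
    by (auto intro!: derivative_eq_intros)
  moreover have "-s - 1 = -(s + 1)" by simp
  ultimately have "((\<lambda>z. z powr (-s)) has_field_derivative (-s) * w powr (-(s + 1))) (at w within A)"
    by metis
  then show ?case by simp
next
  case (Suc k)
  have "(powr_diff k s \<circ> (\<lambda>z. z + 1) has_field_derivative
      (-s) * powr_diff k (s + 1) (w + 1) * 1) (at w within A)"
    by (rule DERIV_chain Suc.IH derivative_eq_intros refl | use Suc.prems in simp)+
  then have "((\<lambda>z. powr_diff k s (z + 1)) has_field_derivative
      (-s) * powr_diff k (s + 1) (w + 1)) (at w within A)" by (simp add: o_def)
  from DERIV_diff[OF Suc.IH[OF Suc.prems] this] show ?case
    by (simp add: algebra_simps)
qed

text \<open>
  Differencing commutes with differentiation in \<open>w\<close>, and differentiation raises \<open>s\<close> by 1; so the mean value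
  inequality reduces the difference of order \<open>k + 1\<close> at \<open>s\<close> to the one of order \<open>k\<close> at \<open>s + 1\<close>.
\<close>
lemma norm_powr_diff_le:
  fixes x :: real
  assumes "x > 0" "Re s + k \<ge> 0"
  shows "norm (powr_diff k s (of_real x)) \<le> (\<Prod>i<k. norm (s + of_nat i)) * x powr (- Re s - k)"
  using assms
proof (induction k arbitrary: s x)
  case 0
  then show ?case by (simp add: norm_powr_real_powr)
next
  case (Suc k)
  define P where "P = (\<Prod>i<k. norm (s + 1 + of_nat i))"
  let ?S = "closed_segment (of_real x :: complex) (of_real (x + 1))"
  have *: "norm (powr_diff k s (of_real x) - powr_diff k s (of_real (x + 1))) \<le>
      (norm s * (P * x powr (- Re s - Suc k))) * norm (of_real x - of_real (x+1) :: complex)"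
  proof (rule field_differentiable_bound[where S = ?S and f' = "\<lambda>w. (-s) * powr_diff k (s+1) w"])
    fix z assume "z \<in> ?S"
    then obtain y where y: "z = of_real y" "x \<le> y" "y \<le> x + 1"
      unfolding closed_segment_of_real by (auto simp: closed_segment_eq_real_ivl)
    show "(powr_diff k s has_field_derivative (-s) * powr_diff k (s+1) z) (at z within ?S)"
      by (rule has_field_derivative_powr_diff) (use y Suc.prems in auto)
    have "norm (powr_diff k (s+1) (of_real y)) \<le> P * y powr (- Re (s+1) - k)"
      unfolding P_def using Suc.IH[of y "s+1"] Suc.prems y by simp
    also have "\<dots> \<le> P * x powr (- Re (s+1) - k)"
    proof -
      have "y powr (- Re (s+1) - k) \<le> x powr (- Re (s+1) - k)"
        by (rule powr_mono2') (use Suc.prems y in auto)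
      moreover have "P \<ge> 0" unfolding P_def by (intro prod_nonneg) auto
      ultimately show ?thesis by (intro mult_left_mono)
    qed
    also have "- Re (s+1) - real k = - Re s - real (Suc k)" by simp
    finally show "norm ((-s) * powr_diff k (s+1) z) \<le> norm s * (P * x powr (- Re s - Suc k))"
      unfolding y norm_mult norm_minus_cancel by (intro mult_left_mono) auto
  qed auto
  have "(\<Prod>i<Suc k. norm (s + of_nat i)) = norm s * P"
    unfolding P_def by (subst prod.lessThan_Suc_shift) (simp add: add_ac)
  with * show ?case by (simp add: norm_minus_commute)
qed

lemma summable_Suc_powr: "e < -1 \<Longrightarrow> summable (\<lambda>n. real (Suc n) powr e)"
  using summable_real_powr_iff[of e] summable_Suc_iff[of "\<lambda>n. real n powr e"] by simp

lemma powr_diff_series_bound: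
  fixes a :: "nat \<Rightarrow> complex" and x :: complex
  assumes a: "\<And>n. norm (a n) \<le> M" and x: "Re x + j > 1"
  shows "\<exists>d>0. \<exists>h. cball x d \<subseteq> {s. Re s > 1 - real j} \<and> summable h \<and>
     (\<forall>n. \<forall>y\<in>cball x d. norm (a n * powr_diff j y (of_nat (Suc n))) \<le> h n)"
proof -
  define d where "d = (Re x + j - 1) / 2"
  have d: "d > 0" using x by (simp add: d_def)
  have M: "M \<ge> 0" using a[of 0] norm_ge_zero order_trans by blast
  have Re: "\<bar>Re y - Re x\<bar> \<le> d" if "y \<in> cball x d" for y
    using that abs_Re_le_cmod[of "x - y"] by (auto simp: dist_norm)
  define P where "P = (\<Prod>i<j. (norm x + d + i))"
  have P: "P \<ge> 0" unfolding P_def using d by (intro prod_nonneg) auto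
  define h where "h n = M * (P * real (Suc n) powr (- (Re x - d) - j))" for n
  have "summable h" unfolding h_def
    by (intro summable_mult summable_Suc_powr) (use x in \<open>auto simp: d_def field_simps\<close>)
  moreover have "norm (a n * powr_diff j y (of_nat (Suc n))) \<le> h n" if y: "y \<in> cball x d" for n y
  proof -
    have "norm (powr_diff j y (of_real (real (Suc n)))) \<le>
        (\<Prod>i<j. norm (y + of_nat i)) * real (Suc n) powr (- Re y - j)"
      by (rule norm_powr_diff_le) (use Re[OF y] x in \<open>simp_all add: d_def abs_if field_simps split: if_splits\<close>)
    also have "\<dots> \<le> P * real (Suc n) powr (- (Re x - d) - j)"
    proof (rule mult_mono)
      show "(\<Prod>i<j. norm (y + of_nat i)) \<le> P" unfolding P_def
      proof (rule prod_mono)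
        fix i
        have "norm (y + of_nat i) \<le> norm x + norm (y - x) + norm (of_nat i :: complex)"
          by norm
        then show "0 \<le> norm (y + of_nat i) \<and> norm (y + of_nat i) \<le> norm x + d + i"
          using y by (auto simp: dist_norm norm_minus_commute)
      qed
      show "real (Suc n) powr (- Re y - j) \<le> real (Suc n) powr (- (Re x - d) - j)"
        by (rule powr_mono) (use Re[OF y] in auto)
    qed (use P in auto)
    finally show ?thesis unfolding h_def norm_mult using a[of n] P M
      by (intro mult_mono) auto
  qed
  moreover have "cball x d \<subseteq> {s. Re s > 1 - real j}"
  proof
    fix y assume "y \<in> cball x d"
    from Re[OF this] x show "y \<in> {s. Re s > 1 - real j}"
      by (simp add: d_def abs_if field_simps split: if_splits)
  qed
  ultimately show ?thesis using d by blast
qed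

lemma powr_diff_series_holomorphic:
  fixes a :: "nat \<Rightarrow> complex"
  assumes a: "\<And>n. norm (a n) \<le> M"
  shows "(\<lambda>s. \<Sum>n. a n * powr_diff j s (of_nat (Suc n))) holomorphic_on {s. Re s > 1 - real j}"
proof (rule holomorphic_on_suminf)
  show "open {s. Re s > 1 - real j}" by (rule open_halfspace_Re_gt)
  show "(\<lambda>s. a n * powr_diff j s (of_nat (Suc n))) holomorphic_on {s. Re s > 1 - real j}" for n
    by (intro holomorphic_intros powr_diff_holomorphic) simp
  fix x assume "x \<in> {s. Re s > 1 - real j}"
  then have "Re x + j > 1" by simp
  from powr_diff_series_bound[where a = a, OF a this]
  show "\<exists>d>0. \<exists>h. cball x d \<subseteq> {s. Re s > 1 - real j} \<and> summable h \<and>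
     (\<forall>n. \<forall>y\<in>cball x d. norm (a n * powr_diff j y (of_nat (Suc n))) \<le> h n)" .
qed

lemma powr_diff_series_summable:
  fixes a :: "nat \<Rightarrow> complex"
  assumes a: "\<And>n. norm (a n) \<le> M" and x: "Re s + j > 1"
  shows "summable (\<lambda>n. a n * powr_diff j s (of_nat (Suc n)))"
proof -
  from powr_diff_series_bound[where a = a, OF a x] obtain d h where
    d: "d > 0" and h: "summable h"
      and le: "\<forall>n. \<forall>y\<in>cball s d. norm (a n * powr_diff j y (of_nat (Suc n))) \<le> h n"
    by (elim exE conjE) (rule that, assumption+)
  have "s \<in> cball s d" using d by simp
  with le have "norm (a n * powr_diff j s (of_nat (Suc n))) \<le> h n" for n
    by blast
  then show ?thesis by (rule summable_comparison_test'[where g = h and N = 0, OF h])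
qed

lemma powr_diff_tendsto_0:
  assumes x: "Re s + j > 1"
  shows "(\<lambda>n. powr_diff j s (of_nat (Suc n))) \<longlonglongrightarrow> 0"
  using summable_LIMSEQ_zero[OF powr_diff_series_summable[of "\<lambda>_. 1" 1 s j]] x by simp

lemma summation_by_parts:
  fixes a u :: "nat \<Rightarrow> complex"
  defines "A \<equiv> (\<lambda>n. \<Sum>i<n. a i)"
  shows "(\<Sum>n<N. a n * u n) = A N * u N + (\<Sum>n<N. A (Suc n) * (u n - u (Suc n)))"
proof (induction N)
  case (Suc N)
  have "A (Suc N) = A N + a N" by (simp add: A_def)
  then show ?case using Suc by (simp add: algebra_simps)
qed (simp add: A_def)

lemma tendsto_bounded_mult_null:
  fixes A u :: "nat \<Rightarrow> complex"
  assumes "\<And>n. norm (A n) \<le> M" "u \<longlonglongrightarrow> 0"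
  shows "(\<lambda>n. A n * u n) \<longlonglongrightarrow> 0"
proof (rule Lim_null_comparison[where g = "\<lambda>n. M * norm (u n)"])
  show "\<forall>\<^sub>F n in sequentially. norm (A n * u n) \<le> M * norm (u n)"
    by (intro always_eventually allI) (simp add: norm_mult mult_right_mono assms(1))
  show "(\<lambda>n. M * norm (u n)) \<longlonglongrightarrow> 0"
    using assms(2) by (intro tendsto_mult_right_zero tendsto_norm_zero)
qed

lemma periodic_mod:
  fixes a :: "nat \<Rightarrow> 'a"
  assumes "\<And>n. a (n + q) = a n"
  shows "a (n mod q) = a n"
proof -
  have "a (r + k * q) = a r" for r k
  proof (induction k)
    case (Suc k)
    have "a (r + Suc k * q) = a ((r + k * q) + q)" by (simp add: algebra_simps)
    then show ?case using assms Suc by simp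
  qed simp
  from this[of "n mod q" "n div q"] show ?thesis by simp
qed

lemma periodic_sum_bounded:
  fixes a :: "nat \<Rightarrow> complex"
  assumes q: "q > 0" and per: "\<And>n. a (n + q) = a n" and zero: "(\<Sum>n<q. a n) = 0"
  defines "A \<equiv> (\<lambda>n. \<Sum>i<n. a i)"
  shows "A (n + q) = A n" "(\<And>n. norm (a n) \<le> 1) \<Longrightarrow> norm (A n) \<le> q"
proof -
  show *: "A (n + q) = A n" for n
    by (induction n) (auto simp: A_def zero per)
  assume a: "\<And>n. norm (a n) \<le> 1"
  have "norm (A n) = norm (A (n mod q))" using periodic_mod[where a = A and q = q, OF *] by simp
  also have "\<dots> \<le> (\<Sum>i<n mod q. 1)" unfolding A_def
    by (rule order_trans[OF norm_sum sum_mono]) (use a in auto)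
  also have "\<dots> \<le> q" using q by (simp add: less_imp_le)
  finally show "norm (A n) \<le> q" .
qed

lemma periodic_bounded:
  fixes a :: "nat \<Rightarrow> complex"
  assumes q: "q > 0" and per: "\<And>n. a (n + q) = a n"
  obtains M where "\<And>n. norm (a n) \<le> M"
proof
  fix n
  have "norm (a (n mod q)) \<le> (\<Sum>i<q. norm (a i))"
    by (rule member_le_sum) (use q in auto)
  then show "norm (a n) \<le> (\<Sum>i<q. norm (a i))"
    using periodic_mod[where a = a and q = q, OF per] by simp
qed

text \<open>
  Summation by parts replaces \<open>a\<close> by its partial sums and adds one difference. The partial sums are
  again periodic because \<open>a\<close> has mean value zero; subtracting their own mean value restores the hypothesis
  and splits off a telescoping series, so the step can be repeated.
\<close>
lemma powr_diff_series_continuation: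
  fixes a :: "nat \<Rightarrow> complex"
  assumes q: "q > 0" and per: "\<And>n. a (n + q) = a n" and zero: "(\<Sum>n<q. a n) = 0"
  shows "\<exists>F. F holomorphic_on {s. Re s > 1 - real j - real k} \<and>
     (\<forall>s. Re s > 1 \<longrightarrow> (\<lambda>n. a n * powr_diff j s (of_nat (Suc n))) sums F s)"
  using per zero
proof (induction k arbitrary: j a)
  case 0
  obtain M where M: "\<And>n. norm (a n) \<le> M" using periodic_bounded[of q a] q 0 by blast
  show ?case
    by (rule exI[of _ "\<lambda>s. \<Sum>n. a n * powr_diff j s (of_nat (Suc n))"])
       (use powr_diff_series_holomorphic[where a = a, OF M] powr_diff_series_summable[where a = a, OF M]
         in \<open>auto intro!: summable_sums\<close>)
next
  case (Suc k)
  define A where "A n = (\<Sum>i<n. a i)" for n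
  \<comment> \<open>The mean value of the partial sums over one period.\<close>
  define c where "c = (\<Sum>n<q. A (Suc n)) / q"
  define B where "B n = A (Suc n) - c" for n
  have perA: "A (n + q) = A n" for n
    using periodic_sum_bounded(1)[of q a n] q Suc.prems unfolding A_def by blast
  have B: "B (n + q) = B n" for n unfolding B_def using perA[of "Suc n"] by simp
  have B0: "(\<Sum>n<q. B n) = 0" unfolding B_def c_def using q by (simp add: sum_subtractf)
  from Suc.IH[of B "Suc j", OF B B0] obtain F where
    F: "F holomorphic_on {s. Re s > 1 - real (Suc j) - real k}"
      "\<And>s. Re s > 1 \<Longrightarrow> (\<lambda>n. B n * powr_diff (Suc j) s (of_nat (Suc n))) sums F s" by blast
  obtain MA where MA: "\<And>n. norm (A n) \<le> MA" using periodic_bounded[of q A] q perA by blast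
  let ?G = "\<lambda>s. c * powr_diff j s 1 + F s"
  have "?G holomorphic_on {s. Re s > 1 - real j - real (Suc k)}"
    using F(1) by (intro holomorphic_intros powr_diff_holomorphic) (auto simp: algebra_simps)
  moreover have "(\<lambda>n. a n * powr_diff j s (of_nat (Suc n))) sums ?G s" if s: "Re s > 1" for s
  proof -
    define u where "u n = powr_diff j s (of_nat (Suc n))" for n
    have u0: "u \<longlonglongrightarrow> 0" unfolding u_def by (rule powr_diff_tendsto_0) (use s in auto)
    have eq: "(\<Sum>n<N. a n * u n) = A N * u N + c * (u 0 - u N) + (\<Sum>n<N. B n * (u n - u (Suc n)))" for N
    proof -
      have "A (Suc n) * (u n - u (Suc n)) = B n * (u n - u (Suc n)) + c * (u n - u (Suc n))" for n
        by (simp add: B_def algebra_simps)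
      then have "(\<Sum>n<N. A (Suc n) * (u n - u (Suc n))) =
          (\<Sum>n<N. B n * (u n - u (Suc n))) + c * (\<Sum>n<N. u n - u (Suc n))"
        by (simp only: sum.distrib sum_distrib_left)
      also have "(\<Sum>n<N. u n - u (Suc n)) = u 0 - u N" by (rule sum_lessThan_telescope')
      finally show ?thesis using summation_by_parts[of a u N] by (simp add: A_def)
    qed
    have "(\<lambda>N. A N * u N) \<longlonglongrightarrow> 0"
      using MA u0 by (rule tendsto_bounded_mult_null)
    moreover have "(\<lambda>N. c * (u 0 - u N)) \<longlonglongrightarrow> c * (u 0 - 0)" by (intro tendsto_intros u0)
    moreover have "(\<lambda>N. \<Sum>n<N. B n * (u n - u (Suc n))) \<longlonglongrightarrow> F s"
      using F(2)[OF s] unfolding sums_def u_def by (simp add: add_ac)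
    ultimately have "(\<lambda>N. \<Sum>n<N. a n * u n) \<longlonglongrightarrow> 0 + c * (u 0 - 0) + F s"
      unfolding eq by (intro tendsto_add)
    then show ?thesis unfolding sums_def u_def by simp
  qed
  ultimately show ?case by blast
qed

lemma periodic_dirichlet_series_entire:
  fixes a :: "nat \<Rightarrow> complex"
  assumes q: "q > 0" and per: "\<And>n. a (n + q) = a n" and zero: "(\<Sum>n<q. a n) = 0"
  shows "\<exists>F. F holomorphic_on UNIV \<and>
     (\<forall>s. Re s > 1 \<longrightarrow> (\<lambda>n. a n / of_nat (Suc n) powr s) sums F s)"
proof -
  have "\<forall>k. \<exists>F. F holomorphic_on {s. Re s > 1 - real k} \<and>
     (\<forall>s. Re s > 1 \<longrightarrow> (\<lambda>n. a n * of_nat (Suc n) powr (-s)) sums F s)"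
    using powr_diff_series_continuation[where a = a and j = 0, OF q per zero] by simp
  then obtain G where G: "\<And>k. G k holomorphic_on {s. Re s > 1 - real k}"
     "\<And>k s. Re s > 1 \<Longrightarrow> (\<lambda>n. a n * of_nat (Suc n) powr (-s)) sums G k s" by metis
  have conn: "connected {s. Re s > c}" for c :: real
    by (intro convex_connected convex_halfspace_Re_gt)
  have eq: "G k s = G l s" if "k \<le> l" "Re s > 1 - real k" for k l s
  proof (rule analytic_continuation_open[of "{s. Re s > 1}" "{s. Re s > 1 - real k}" "G k" "G l"])
    show "{s. Re s > 1} \<noteq> {}" by (auto intro: exI[of _ 2])
    show "G l holomorphic_on {s. Re s > 1 - real k}"
      by (rule holomorphic_on_subset[OF G(1)]) (use that in auto)
    show "G k z = G l z" if "z \<in> {s. Re s > 1}" for z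
      using G(2)[of z k] G(2)[of z l] that sums_unique2 by blast
  qed (use that G conn in \<open>auto simp: open_halfspace_Re_gt\<close>)
  define F where "F s = G (nat \<lceil>norm s\<rceil> + 2) s" for s
  have F: "F s = G k s" if "Re s > 1 - real k" for s k
  proof -
    have "Re s \<ge> - norm s" using abs_Re_le_cmod[of s] by linarith
    then have *: "Re s > 1 - real (nat \<lceil>norm s\<rceil> + 2)" by linarith
    show ?thesis unfolding F_def
      by (cases "k \<le> nat \<lceil>norm s\<rceil> + 2") (use eq[OF _ *] eq[OF _ that] in auto)
  qed
  have "F holomorphic_on {s. Re s > 1 - real k}" for k
    using G(1)[of k] by (rule holomorphic_transform) (use F in auto)
  then have "F holomorphic_on (\<Union>k::nat. {s. Re s > 1 - real k})"
    by (intro holomorphic_on_UN_open) (auto simp: open_halfspace_Re_gt)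
  also have "(\<Union>k::nat. {s. Re s > 1 - real k}) = UNIV"
  proof -
    have "\<exists>k::nat. Re s > 1 - real k" for s
      using reals_Archimedean2[of "1 - Re s"] by (auto simp: algebra_simps)
    then show ?thesis by auto
  qed
  finally have "F holomorphic_on UNIV" .
  moreover have "(\<lambda>n. a n / of_nat (Suc n) powr s) sums F s" if "Re s > 1" for s
    using G(2)[OF that, of 0] F[of 0 s] that by (simp add: powr_minus_divide)
  ultimately show ?thesis by blast
qed

text \<open>
  One summation by parts suffices to the right of \<open>1/2\<close>, because the partial sums of \<open>a\<close> are at most \<open>q\<close>.
\<close>
lemma periodic_dirichlet_series_bound:
  fixes a :: "nat \<Rightarrow> complex"
  assumes q: "q > 0" and per: "\<And>n. a (n + q) = a n" and zero: "(\<Sum>n<q. a n) = 0"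
    and a: "\<And>n. norm (a n) \<le> 1"
    and F: "F holomorphic_on UNIV" "\<And>s. Re s > 1 \<Longrightarrow> (\<lambda>n. a n / of_nat (Suc n) powr s) sums F s"
    and s: "Re s \<ge> 1/2"
  shows "norm (F s) \<le> q * norm s * (\<Sum>n. real (Suc n) powr (-3/2))"
proof -
  define A where "A n = (\<Sum>i<n. a i)" for n
  have A: "norm (A n) \<le> q" for n
    using periodic_sum_bounded(2)[of q a n] q per zero a unfolding A_def by blast
  define G where "G s = (\<Sum>n. A (Suc n) * powr_diff 1 s (of_nat (Suc n)))" for s
  have G: "G holomorphic_on {s. Re s > 0}"
    using powr_diff_series_holomorphic[where j = 1 and a = "\<lambda>n. A (Suc n)", OF A] 
    by (simp add: G_def[abs_def])
  have "F s = G s"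
  proof (rule analytic_continuation_open[of "{s. Re s > 1}" "{s. Re s > 0}" F G])
    show "{s. Re s > 1} \<noteq> {}" by (auto intro: exI[of _ 2])
    show "F holomorphic_on {s. Re s > 0}" by (rule holomorphic_on_subset[OF F(1)]) auto
    show "F s = G s" if "s \<in> {s. Re s > 1}" for s
    proof -
      define u where "u n = powr_diff 0 s (of_nat (Suc n))" for n
      have u0: "u \<longlonglongrightarrow> 0" unfolding u_def by (rule powr_diff_tendsto_0) (use that in auto)
      have "(\<lambda>N. A N * u N) \<longlonglongrightarrow> 0"
        using A u0 by (rule tendsto_bounded_mult_null)
      moreover have "(\<lambda>n. A (Suc n) * (u n - u (Suc n))) sums G s"
        unfolding G_def u_def using powr_diff_series_summable[where j = 1 and a = "\<lambda>n. A (Suc n)", OF A, of s] that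
        by (auto intro!: summable_sums simp: add_ac dest: summable_sums)
      ultimately have "(\<lambda>N. A N * u N + (\<Sum>n<N. A (Suc n) * (u n - u (Suc n)))) \<longlonglongrightarrow> 0 + G s"
        unfolding sums_def by (rule tendsto_add)
      then have "(\<lambda>n. a n * u n) sums G s"
        unfolding sums_def summation_by_parts[of a] A_def by simp
      moreover have "(\<lambda>n. a n * u n) sums F s"
        using F(2)[of s] that by (simp add: u_def powr_minus_divide)
      ultimately show ?thesis using sums_unique2 by blast
    qed
  qed (use s G in \<open>auto simp: open_halfspace_Re_gt intro: convex_connected convex_halfspace_Re_gt\<close>)
  also have "norm (G s) \<le> (\<Sum>n. q * norm s * real (Suc n) powr (-3/2))"
    unfolding G_def
  proof (rule norm_suminf_le)
    fix n
    have "norm (powr_diff 1 s (of_real (real (Suc n)))) \<le> norm s * real (Suc n) powr (- Re s - 1)"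
      using norm_powr_diff_le[of "real (Suc n)" s 1] s by simp
    also have "\<dots> \<le> norm s * real (Suc n) powr (-3/2)"
      by (intro mult_left_mono powr_mono) (use s in auto)
    finally show "norm (A (Suc n) * powr_diff 1 s (of_nat (Suc n))) \<le> q * norm s * real (Suc n) powr (-3/2)"
      unfolding norm_mult using A[of "Suc n"] by (auto intro: mult_mono simp: mult.assoc)
  qed (intro summable_mult summable_Suc_powr; simp)
  also have "\<dots> = q * norm s * (\<Sum>n. real (Suc n) powr (-3/2))"
    by (intro suminf_mult summable_Suc_powr) simp
  finally show ?thesis .
qed

section \<open>The zeta function near 1\<close>

lemma powr_diff_0_le:
  fixes x \<theta> :: real
  assumes "x > 0" "0 \<le> \<theta>" "\<theta> \<le> 1" "Re s \<ge> -1"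
  shows "norm (of_real x powr (-s) - of_real (x + \<theta>) powr (-s)) \<le> norm s * x powr (- Re s - 1)"
proof -
  let ?S = "closed_segment (of_real x :: complex) (of_real (x + \<theta>))"
  have "norm (powr_diff 0 s (of_real x) - powr_diff 0 s (of_real (x + \<theta>))) \<le>
      (norm s * x powr (- Re s - 1)) * norm (of_real x - of_real (x+\<theta>) :: complex)"
  proof (rule field_differentiable_bound[where S = ?S and f' = "\<lambda>w. (-s) * powr_diff 0 (s+1) w"])
    fix z assume "z \<in> ?S"
    then obtain y where y: "z = of_real y" "x \<le> y" "y \<le> x + \<theta>"
      unfolding closed_segment_of_real using assms by (auto simp: closed_segment_eq_real_ivl)
    show "(powr_diff 0 s has_field_derivative (-s) * powr_diff 0 (s+1) z) (at z within ?S)"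
      by (rule has_field_derivative_powr_diff) (use y assms in auto)
    have "norm (powr_diff 0 (s+1) (of_real y)) \<le> y powr (- Re s - 1)"
      using norm_powr_diff_le[of y "s+1" 0] assms y by simp
    also have "\<dots> \<le> x powr (- Re s - 1)"
      by (rule powr_mono2') (use assms y in auto)
    finally show "norm ((-s) * powr_diff 0 (s+1) z) \<le> norm s * x powr (- Re s - 1)"
      unfolding y norm_mult norm_minus_cancel by (intro mult_left_mono) auto
  qed auto
  also have "norm (of_real x - of_real (x+\<theta>) :: complex) = \<theta>"
    using assms by (simp flip: of_real_diff)
  also have "(norm s * x powr (- Re s - 1)) * \<theta> \<le> norm s * x powr (- Re s - 1)"
    using assms by (intro mult_right_le_one_le) auto
  finally show ?thesis by simp
qed

text \<open>
  The left-hand side is \<open>s - 1\<close> times the error in approximating the integral of \<open>u powr (-s)\<close> over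
  \<open>[x, x + 1]\<close> by its value at the left end point.
\<close>
lemma powr_Taylor_bound:
  fixes x :: real
  assumes "x > 0" "Re s \<ge> -1"
  shows "norm ((s - 1) * of_real x powr (-s) - of_real x powr (1 - s) + of_real (x + 1) powr (1 - s))
     \<le> norm (s - 1) * norm s * x powr (- Re s - 1)"
proof -
  define c where "c = (of_real x :: complex) powr (-s)"
  define g where "g w = powr_diff 0 (s - 1) w + (s - 1) * c * w" for w
  let ?S = "closed_segment (of_real x :: complex) (of_real (x + 1))"
  have "norm (g (of_real (x + 1)) - g (of_real x)) \<le>
      (norm (s - 1) * norm s * x powr (- Re s - 1)) * norm (of_real (x+1) - of_real x :: complex)"
  proof (rule field_differentiable_bound[where S = ?S and f' = "\<lambda>w. (s - 1) * (c - powr_diff 0 s w)"])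
    fix z assume "z \<in> ?S"
    then obtain y where y: "z = of_real y" "x \<le> y" "y \<le> x + 1"
      unfolding closed_segment_of_real by (auto simp: closed_segment_eq_real_ivl)
    have "(powr_diff 0 (s-1) has_field_derivative (-(s-1)) * powr_diff 0 (s-1+1) z) (at z within ?S)"
      by (rule has_field_derivative_powr_diff) (use y assms in auto)
    then have "(g has_field_derivative (-(s-1)) * powr_diff 0 (s-1+1) z + (s - 1) * c * 1) (at z within ?S)"
      unfolding g_def by (intro DERIV_add DERIV_cmult DERIV_ident)
    then show "(g has_field_derivative (s - 1) * (c - powr_diff 0 s z)) (at z within ?S)"
      by (simp add: algebra_simps del: powr_diff.simps)
    have "norm (c - powr_diff 0 s z) \<le> norm s * x powr (- Re s - 1)"
      using powr_diff_0_le[of x "y - x" s] y assms by (simp add: c_def)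
    then show "norm ((s - 1) * (c - powr_diff 0 s z)) \<le> norm (s - 1) * norm s * x powr (- Re s - 1)"
      unfolding norm_mult mult.assoc by (intro mult_left_mono) auto
  qed auto
  moreover have "g (of_real (x + 1)) - g (of_real x) =
      (s - 1) * of_real x powr (-s) - of_real x powr (1 - s) + of_real (x + 1) powr (1 - s)"
    by (simp add: g_def c_def algebra_simps)
  ultimately show ?thesis by simp
qed

text \<open>
  The integrals of \<open>u powr (-s)\<close> over \<open>[n, n + 1]\<close> telescope to \<open>1 / (s - 1)\<close>; subtracting them from the
  terms of the series leaves one that converges for \<open>Re s > 0\<close>. \<open>Z\<close> is \<open>(s - 1) \<zeta>(s)\<close>.
\<close>
lemma zeta_continuation:
  obtains Z where "Z holomorphic_on {s. Re s > 0}" "Z 1 = 1"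
    "\<And>s. Re s > 1 \<Longrightarrow> (\<lambda>n. 1 / of_nat (Suc n) powr s) sums (Z s / (s - 1))"
proof
  define t where "t n s = (s - 1) * of_nat (Suc n) powr (-s) - of_nat (Suc n) powr (1 - s)
      + of_nat (Suc (Suc n)) powr (1 - s)" for n :: nat and s :: complex
  define Z where "Z s = 1 + (\<Sum>n. t n s)" for s
  have t: "norm (t n s) \<le> norm (s - 1) * norm s * real (Suc n) powr (- Re s - 1)" if "Re s > 0" for n s
    using powr_Taylor_bound[of "real (Suc n)" s] that unfolding t_def by (simp add: add_ac)
  have "(\<lambda>s. \<Sum>n. t n s) holomorphic_on {s. Re s > 0}"
  proof (rule holomorphic_on_suminf)
    show "open {s. Re s > 0}" by (rule open_halfspace_Re_gt)
    show "t n holomorphic_on {s. Re s > 0}" for n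
      unfolding t_def by (intro holomorphic_intros)
    fix x assume x: "x \<in> {s. Re s > 0}"
    define d where "d = Re x / 2"
    define h where "h n = (norm x + d + 1) * (norm x + d) * real (Suc n) powr (- (Re x - d) - 1)" for n
    have d: "d > 0" using x by (simp add: d_def)
    have Re: "Re y \<ge> Re x - d" if "y \<in> cball x d" for y
      using that abs_Re_le_cmod[of "x - y"] by (auto simp: dist_norm)
    have "summable h" unfolding h_def
      by (intro summable_mult summable_Suc_powr) (use x in \<open>auto simp: d_def field_simps\<close>)
    moreover have "cball x d \<subseteq> {s. Re s > 0}"
    proof
      fix y assume "y \<in> cball x d"
      from Re[OF this] x show "y \<in> {s. Re s > 0}" by (simp add: d_def)
    qed
    moreover have "norm (t n y) \<le> h n" if y: "y \<in> cball x d" for n y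
    proof -
      have "norm (y - x) \<le> d" using y by (simp add: dist_norm norm_minus_commute)
      then have n: "norm y \<le> norm x + d" "norm (y - 1) \<le> norm x + d + 1"
        using norm_triangle_sub[of y x] norm_triangle_ineq4[of y 1] by auto
      have "norm (t n y) \<le> norm (y - 1) * norm y * real (Suc n) powr (- Re y - 1)"
        by (rule t) (use Re[OF y] x in \<open>auto simp: d_def\<close>)
      also have "\<dots> \<le> h n" unfolding h_def
        by (intro mult_mono powr_mono n) (use Re[OF y] d in auto)
      finally show ?thesis .
    qed
    ultimately show "\<exists>d>0. \<exists>M. cball x d \<subseteq> {s. Re s > 0} \<and> summable M \<and> (\<forall>n. \<forall>y\<in>cball x d. norm (t n y) \<le> M n)"
      using d by (intro exI[of _ d] exI[of _ h]) blast
  qed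
  then show "Z holomorphic_on {s. Re s > 0}" unfolding Z_def by (intro holomorphic_intros)
  have "t n 1 = 0" for n unfolding t_def by (simp del: of_nat_Suc)
  then show "Z 1 = 1" by (simp add: Z_def)
  fix s assume s: "Re s > 1"
  define v where "v n = (of_nat (Suc n) :: complex) powr (1 - s)" for n
  have "v \<longlonglongrightarrow> 0"
  proof (rule tendsto_norm_zero_cancel)
    have "norm (v n) = real (Suc n) powr (1 - Re s)" for n
      unfolding v_def by (subst norm_powr_real_powr) auto
    moreover have "(\<lambda>n. real (Suc n) powr (1 - Re s)) \<longlonglongrightarrow> 0"
      by (rule tendsto_neg_powr[OF _ filterlim_compose[OF filterlim_real_sequentially filterlim_Suc]])
         (use s in auto)
    ultimately show "(\<lambda>n. norm (v n)) \<longlonglongrightarrow> 0" by simp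
  qed
  then have "(\<lambda>n. v n - v (Suc n)) sums (v 0 - 0)" by (rule telescope_sums')
  moreover have "(\<lambda>n. t n s) sums (\<Sum>n. t n s)"
  proof (rule summable_sums, rule summable_comparison_test')
    show "summable (\<lambda>n. norm (s - 1) * norm s * real (Suc n) powr (- Re s - 1))"
      by (intro summable_mult summable_Suc_powr) (use s in simp)
    show "norm (t n s) \<le> norm (s - 1) * norm s * real (Suc n) powr (- Re s - 1)" for n
      by (rule t) (use s in simp)
  qed
  ultimately have "(\<lambda>n. (t n s + (v n - v (Suc n))) / (s - 1)) sums (((\<Sum>n. t n s) + (v 0 - 0)) / (s - 1))"
    by (intro sums_divide sums_add)
  moreover have "(t n s + (v n - v (Suc n))) / (s - 1) = 1 / of_nat (Suc n) powr s" for n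
    using s by (auto simp: t_def v_def powr_minus_divide)
  ultimately show "(\<lambda>n. 1 / of_nat (Suc n) powr s) sums (Z s / (s - 1))"
    by (simp add: Z_def v_def add_ac)
qed

section \<open>Euler products\<close>

definition completely_multiplicative :: "(nat \<Rightarrow> complex) \<Rightarrow> bool" where
  "completely_multiplicative a \<longleftrightarrow>
     a 1 = 1 \<and> (\<forall>m n. a (m * n) = a m * a n) \<and> (\<forall>n. norm (a n) \<le> 1)"

text \<open>
  The multiples of \<open>p\<close> among the surviving numbers are \<open>p\<close> times the surviving numbers, so deleting them
  multiplies the sum by \<open>1 - f p\<close>.
\<close>
lemma sieve_has_sum:
  fixes f :: "nat \<Rightarrow> complex"
  assumes mult: "\<And>m n. m > 0 \<Longrightarrow> n > 0 \<Longrightarrow> f (m * n) = f m * f n"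
    and L: "(f has_sum L) {0<..}" and S: "finite S" "\<And>p. p \<in> S \<Longrightarrow> prime p"
  shows "(f has_sum (\<Prod>p\<in>S. 1 - f p) * L) {n. n > 0 \<and> (\<forall>p\<in>S. \<not> p dvd n)}"
  using S
proof (induction S)
  case empty
  then show ?case using L by (simp add: greaterThan_def)
next
  case (insert p S)
  define U where "U = {n. n > 0 \<and> (\<forall>p\<in>S. \<not> p dvd n)}"
  define v where "v = (\<Prod>p\<in>S. 1 - f p) * L"
  have v: "(f has_sum v) U" using insert by (simp add: U_def v_def)
  have p: "prime p" using insert by auto
  have inj: "inj_on ((*) p) U" using p by (auto simp: inj_on_def prime_gt_0_nat)
  have "((\<lambda>n. f p * f n) has_sum (f p * v)) U" by (intro has_sum_cmult_right v)
  also have "?this \<longleftrightarrow> ((f \<circ> (*) p) has_sum (f p * v)) U"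
    by (rule has_sum_cong) (use p mult in \<open>auto simp: U_def prime_gt_0_nat\<close>)
  also have "\<dots> \<longleftrightarrow> (f has_sum (f p * v)) ((*) p ` U)"
    by (rule has_sum_reindex[OF inj, symmetric])
  finally have pv: "(f has_sum (f p * v)) ((*) p ` U)" .
  have sub: "(*) p ` U \<subseteq> U"
  proof
    fix m assume "m \<in> (*) p ` U"
    then obtain n where n: "m = p * n" "n \<in> U" by auto
    have "\<not> r dvd p * n" if "r \<in> S" for r
    proof
      assume "r dvd p * n"
      moreover have r: "prime r" using insert that by auto
      ultimately have "r dvd p \<or> r dvd n" using prime_dvd_multD by blast
      moreover have "\<not> r dvd n" using n that by (auto simp: U_def)
      ultimately have "r = p" using primes_dvd_imp_eq[OF r p] by blast
      then show False using insert that by simp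
    qed
    then show "m \<in> U" using n p by (auto simp: U_def prime_gt_0_nat)
  qed
  have "{n. n > 0 \<and> (\<forall>r\<in>insert p S. \<not> r dvd n)} = U - (*) p ` U"
  proof (intro equalityI subsetI)
    fix n assume n: "n \<in> U - (*) p ` U"
    have "\<not> p dvd n"
    proof
      assume "p dvd n"
      then obtain m where m: "n = p * m" by auto
      then have "m \<in> U" using n by (auto simp: U_def)
      then show False using n m by auto
    qed
    then show "n \<in> {n. n > 0 \<and> (\<forall>r\<in>insert p S. \<not> r dvd n)}" using n by (auto simp: U_def)
  qed (auto simp: U_def)
  moreover have "(f has_sum (v - f p * v)) (U - (*) p ` U)"
    by (rule has_sum_Diff[OF v pv sub])
  moreover have "v - f p * v = (\<Prod>p\<in>insert p S. 1 - f p) * L"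
    using insert by (simp add: v_def algebra_simps)
  ultimately show ?case by simp
qed

text \<open>
  After sieving by all primes below \<open>N\<close>, only 1 and numbers \<open>n \<ge> N\<close> are left.
\<close>
lemma euler_product_tendsto:
  fixes f :: "nat \<Rightarrow> complex"
  assumes mult: "\<And>m n. m > 0 \<Longrightarrow> n > 0 \<Longrightarrow> f (m * n) = f m * f n" and f1: "f 1 = 1"
    and abs: "(\<lambda>n. norm (f n)) summable_on {0<..}"
  shows "(\<lambda>N. (\<Prod>p | p < N \<and> prime p. 1 - f p) * infsum f {0<..}) \<longlonglongrightarrow> 1"
proof -
  define L where "L = infsum f {0<..}"
  have L: "(f has_sum L) {0<..}" unfolding L_def
    using abs_summable_summable[OF abs] by (rule has_sum_infsum)
  define g where "g n = norm (f n)" for n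
  define G where "G = infsum g {0<..}"
  have g: "(g has_sum G) {0<..}" unfolding G_def g_def using abs by (rule has_sum_infsum)
  have le: "norm ((\<Prod>p | p < N \<and> prime p. 1 - f p) * L - 1) \<le> G - (\<Sum>n\<in>{0<..<N}. g n)"
    if N: "N \<ge> 2" for N :: nat
  proof -
    define S where "S = {p. p < N \<and> prime p}"
    define U where "U = {n. n > 0 \<and> (\<forall>p\<in>S. \<not> p dvd n)}"
    have U: "(f has_sum ((\<Prod>p\<in>S. 1 - f p) * L)) U" unfolding U_def
      by (rule sieve_has_sum[OF mult L]) (auto simp: S_def)
    have "1 \<in> U" unfolding U_def S_def by auto
    then have U1: "(f has_sum ((\<Prod>p\<in>S. 1 - f p) * L - 1)) (U - {1})"
      using has_sum_Diff[OF U, of "{1}" 1] has_sum_finite[of "{1::nat}" f] f1 by simp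
    have sub: "U - {1} \<subseteq> {0<..} - {0<..<N}"
    proof
      fix n assume n: "n \<in> U - {1}"
      then have "n > 1" by (auto simp: U_def)
      then obtain p where p: "prime p" "p dvd n" using prime_factor_nat[of n] by auto
      have "p \<le> n" using p \<open>n > 1\<close> by (intro dvd_imp_le) auto
      moreover have "\<not> p < N" using n p by (auto simp: U_def S_def)
      ultimately show "n \<in> {0<..} - {0<..<N}" using \<open>n > 1\<close> by auto
    qed
    have gN: "(g has_sum (G - (\<Sum>n\<in>{0<..<N}. g n))) ({0<..} - {0<..<N})"
      by (rule has_sum_Diff[OF g has_sum_finite]) auto
    have "norm ((\<Prod>p\<in>S. 1 - f p) * L - 1) \<le> infsum g (U - {1})"
      using norm_infsum_bound[of f "U - {1}"] infsumI[OF U1]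
        summable_on_subset_banach[OF has_sum_imp_summable[OF gN] sub] by (simp add: g_def[abs_def])
    also have "\<dots> \<le> infsum g ({0<..} - {0<..<N})"
      by (rule infsum_mono2[OF summable_on_subset_banach[OF has_sum_imp_summable[OF gN] sub]
          has_sum_imp_summable[OF gN] sub]) (auto simp: g_def)
    finally show ?thesis using infsumI[OF gN] by (simp add: S_def)
  qed
  have "(\<lambda>N. \<Sum>n\<in>{0<..<N}. g n) \<longlonglongrightarrow> G"
  proof -
    have "((\<lambda>n. if n = 0 then 0 else g n) has_sum G) UNIV"
      using g by (subst has_sum_cong_neutral[where g = g and T = "{0<..}"]) auto
    then have "(\<lambda>n. if n = 0 then 0 else g n) sums G" by (rule has_sum_imp_sums)
    moreover have "(\<Sum>n<N. if n = 0 then 0 else g n) = (\<Sum>n\<in>{0<..<N}. g n)" for N :: nat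
      by (rule sum.mono_neutral_cong_right) auto
    ultimately show ?thesis by (simp add: sums_def)
  qed
  then have "(\<lambda>N. G - (\<Sum>n\<in>{0<..<N}. g n)) \<longlonglongrightarrow> G - G" by (intro tendsto_intros)
  then have lim: "(\<lambda>N. G - (\<Sum>n\<in>{0<..<N}. g n)) \<longlonglongrightarrow> 0" by simp
  have "(\<lambda>N. (\<Prod>p | p < N \<and> prime p. 1 - f p) * L - 1) \<longlonglongrightarrow> 0"
    by (rule Lim_null_comparison[OF _ lim], rule eventually_sequentiallyI[of 2], rule le)
  then show ?thesis unfolding L_def using LIM_zero_iff by blast
qed

lemma completely_multiplicativeD:
  assumes "completely_multiplicative a"
  shows "a 1 = 1" "a (Suc 0) = 1" "a (m * n) = a m * a n" "norm (a n) \<le> 1"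
proof -
  show *: "a 1 = 1" "a (m * n) = a m * a n" "norm (a n) \<le> 1" for m n
    using assms by (auto simp: completely_multiplicative_def)
  then show "a (Suc 0) = 1" by simp
qed

lemma norm_euler_term:
  assumes "norm c \<le> 1" "n \<ge> 2" "Re s > 1"
  shows "norm (c * of_nat n powr (-s)) \<le> real n powr (- Re s)" "norm (c * of_nat n powr (-s)) < 1 / 2"
proof -
  have "norm (c * of_nat n powr (-s)) = norm c * real n powr (- Re s)"
    by (simp add: norm_mult norm_powr_real_powr)
  also have "\<dots> \<le> 1 * real n powr (- Re s)" by (intro mult_right_mono assms) auto
  finally show *: "norm (c * of_nat n powr (-s)) \<le> real n powr (- Re s)" by simp
  also have "\<dots> < real n powr (-1)" by (rule powr_less_mono) (use assms in auto)
  also have "\<dots> \<le> 1 / 2" using assms by (simp add: powr_minus divide_simps)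
  finally show "norm (c * of_nat n powr (-s)) < 1 / 2" .
qed

definition euler_log_term :: "complex \<Rightarrow> nat \<Rightarrow> complex \<Rightarrow> complex" where
  "euler_log_term c n s = - Ln (1 - c * of_nat n powr (-s))"

lemma norm_euler_log_term:
  assumes "norm c \<le> 1" "n \<ge> 2" "Re s > 1"
  shows "norm (euler_log_term c n s) \<le> 2 * real n powr (- Re s)"
  using norm_Ln_le[of "- (c * of_nat n powr (-s))"] norm_euler_term[OF assms]
  by (simp add: euler_log_term_def)

lemma exp_euler_log_term:
  assumes "norm c \<le> 1" "n \<ge> 2" "Re s > 1"
  shows "exp (euler_log_term c n s) * (1 - c * of_nat n powr (-s)) = 1"
proof -
  have "c * of_nat n powr (-s) \<noteq> 1" using norm_euler_term(2)[OF assms] by auto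
  then show ?thesis by (simp add: euler_log_term_def exp_minus)
qed

definition euler_log :: "(nat \<Rightarrow> complex) \<Rightarrow> complex \<Rightarrow> complex" where
  "euler_log a s = (\<Sum>n. if prime n then euler_log_term (a n) n s else 0)"

lemma local_bound_halfplane:
  assumes "Re x > 1"
  shows "\<exists>d>0. \<exists>c>1. cball x d \<subseteq> {s. Re s > 1} \<and> (\<forall>y\<in>cball x d. Re y \<ge> c)"
proof (intro exI conjI ballI)
  show "(Re x - 1) / 2 > 0" "(Re x + 1) / 2 > 1" using assms by auto
  show *: "Re y \<ge> (Re x + 1) / 2" if "y \<in> cball x ((Re x - 1) / 2)" for y
    using that abs_Re_le_cmod[of "x - y"] by (auto simp: dist_norm field_simps)
  show "cball x ((Re x - 1) / 2) \<subseteq> {s. Re s > 1}"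
  proof
    fix y assume "y \<in> cball x ((Re x - 1) / 2)"
    from *[OF this] assms show "y \<in> {s. Re s > 1}" by auto
  qed
qed

text \<open>
  The form of local majorant that \<open>holomorphic_on_suminf\<close> and \<open>even_derivs_nonneg_suminf\<close> ask for.
\<close>
lemma prime_series_bound:
  fixes F :: "nat \<Rightarrow> complex \<Rightarrow> complex"
  assumes F: "\<And>n s. n \<ge> 2 \<Longrightarrow> Re s > 1 \<Longrightarrow> norm (F n s) \<le> K * real n powr (- Re s)" and K: "K \<ge> 0"
    and x: "x \<in> {s. Re s > 1}"
  shows "\<exists>d>0. \<exists>M. cball x d \<subseteq> {s. Re s > 1} \<and> summable M \<and>
    (\<forall>n. \<forall>y\<in>cball x d. norm (if prime n then F n y else 0) \<le> M n)"
proof -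
  obtain d c where d: "d > 0" "c > 1" "cball x d \<subseteq> {s. Re s > 1}" "\<forall>y\<in>cball x d. Re y \<ge> c"
    using local_bound_halfplane[of x] x by auto
  have "norm (if prime n then F n y else 0) \<le> K * real n powr (-c)" if y: "y \<in> cball x d" for n y
  proof (cases "prime n")
    case True
    then have n: "n \<ge> 2" by (rule prime_ge_2_nat)
    have "norm (F n y) \<le> K * real n powr (- Re y)" by (rule F) (use y d n in auto)
    also have "\<dots> \<le> K * real n powr (-c)"
      by (intro mult_left_mono powr_mono K) (use y d n in auto)
    finally show ?thesis using True by simp
  qed (use K in auto)
  moreover have "summable (\<lambda>n. K * real n powr (-c))"
    by (intro summable_mult) (use d summable_real_powr_iff[of "-c"] in simp)
  ultimately show ?thesis using d by blast
qed

lemma euler_log_bound: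
  assumes "\<And>n. norm (a n) \<le> 1" "x \<in> {s. Re s > 1}"
  shows "\<exists>d>0. \<exists>M. cball x d \<subseteq> {s. Re s > 1} \<and> summable M \<and>
    (\<forall>n. \<forall>y\<in>cball x d. norm (if prime n then euler_log_term (a n) n y else 0) \<le> M n)"
  by (rule prime_series_bound[where K = 2]) (use assms norm_euler_log_term in auto)

lemma euler_log_sums:
  assumes "\<And>n. norm (a n) \<le> 1" "Re s > 1"
  shows "(\<lambda>n. if prime n then euler_log_term (a n) n s else 0) sums euler_log a s"
proof -
  have "s \<in> {s. Re s > 1}" using assms by simp
  from euler_log_bound[of a, OF assms(1) this]
  obtain d M where d: "d > 0" and M: "summable M"
    and le: "\<forall>n. \<forall>y\<in>cball s d. norm (if prime n then euler_log_term (a n) n y else 0) \<le> M n"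
    by (elim exE conjE) (rule that, assumption+)
  have "s \<in> cball s d" using d by simp
  with le have "norm (if prime n then euler_log_term (a n) n s else 0) \<le> M n" for n by blast
  then have "summable (\<lambda>n. if prime n then euler_log_term (a n) n s else 0)"
    by (rule summable_comparison_test'[where g = M and N = 0, OF M])
  then show ?thesis unfolding euler_log_def by (rule summable_sums)
qed

lemma dirichlet_series_eq_exp:
  assumes a: "completely_multiplicative a" and s: "Re s > 1"
  shows "(\<lambda>n. a (Suc n) / of_nat (Suc n) powr s) sums exp (euler_log a s)"
proof -
  note a' = completely_multiplicativeD[OF a]
  define f where "f n = a n * of_nat n powr (-s)" for n
  have f0: "f 0 = 0" "f 1 = 1" using a' by (simp_all add: f_def)
  have mult: "f (m * n) = f m * f n" for m n
    unfolding f_def by (simp add: a' powr_times_real)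
  have nf: "norm (f n) \<le> real n powr (- Re s)" for n
    using mult_right_mono[OF a'(4)[of n], of "real n powr (- Re s)"]
    by (simp add: f_def norm_mult norm_powr_real_powr)
  have sm: "summable (\<lambda>n. norm (f n))"
  proof (rule summable_comparison_test')
    show "summable (\<lambda>n. real n powr (- Re s))" using summable_real_powr_iff[of "- Re s"] s by simp
    show "norm (norm (f n)) \<le> real n powr (- Re s)" for n using nf by simp
  qed
  then have abs: "(\<lambda>n. norm (f n)) summable_on {0<..}"
    using norm_summable_imp_summable_on[of "\<lambda>n. norm (f n)"] summable_on_subset_banach[of _ UNIV "{0<..}"] by simp
  define L where "L = infsum f {0<..}"
  have "(f has_sum L) {0<..}" unfolding L_def using abs_summable_summable[OF abs] by (rule has_sum_infsum)
  then have "(f has_sum L) UNIV"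
    by (subst has_sum_cong_neutral[where g = f and T = "{0<..}"]) (auto simp: f0)
  then have "f sums L" by (rule has_sum_imp_sums)
  then have L: "(\<lambda>n. f (Suc n)) sums L" using f0 by (simp add: sums_Suc_iff)
  have lim1: "(\<lambda>N. (\<Prod>p | p < N \<and> prime p. 1 - f p) * L) \<longlonglongrightarrow> 1"
    unfolding L_def by (rule euler_product_tendsto[OF mult f0(2) abs])
  define E where "E N = (\<Sum>n<N. if prime n then euler_log_term (a n) n s else 0)" for N
  have "(\<lambda>N. exp (E N)) \<longlonglongrightarrow> exp (euler_log a s)"
    unfolding E_def using euler_log_sums[of a s, OF a'(4) s]
    by (intro tendsto_exp) (simp add: sums_def)
  from tendsto_mult[OF this lim1]
  have "(\<lambda>N. exp (E N) * ((\<Prod>p | p < N \<and> prime p. 1 - f p) * L)) \<longlonglongrightarrow> exp (euler_log a s)"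
    by simp
  moreover have "exp (E N) * ((\<Prod>p | p < N \<and> prime p. 1 - f p) * L) = L" for N
  proof -
    have "E N = (\<Sum>p | p < N \<and> prime p. euler_log_term (a p) p s)"
      unfolding E_def by (rule sum.mono_neutral_cong_right) auto
    then have "exp (E N) * (\<Prod>p | p < N \<and> prime p. 1 - f p) =
      (\<Prod>p | p < N \<and> prime p. exp (euler_log_term (a p) p s) * (1 - f p))"
      by (simp add: exp_sum prod.distrib)
    also have "\<dots> = 1"
      by (intro prod.neutral) (use exp_euler_log_term[OF a'(4) prime_ge_2_nat s] in \<open>auto simp: f_def\<close>)
    finally show ?thesis by (simp add: mult.assoc[symmetric])
  qed
  ultimately have "L = exp (euler_log a s)" using LIMSEQ_unique[OF tendsto_const] by simp
  with L show ?thesis by (simp add: f_def powr_minus_divide)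
qed

text \<open>
  This compares an imprimitive character \<open>b\<close> with the primitive character \<open>a\<close> that induces it.
\<close>
lemma euler_log_remove_primes:
  assumes a: "\<And>n. norm (a n) \<le> 1" and s: "Re s > 1" and S: "finite S" "\<And>p. p \<in> S \<Longrightarrow> prime p"
    and b: "\<And>p. prime p \<Longrightarrow> b p = (if p \<in> S then 0 else a p)" and b1: "\<And>n. norm (b n) \<le> 1"
  shows "exp (euler_log b s) = exp (euler_log a s) * (\<Prod>p\<in>S. 1 - a p * of_nat p powr (-s))"
proof -
  have "(\<lambda>n. (if prime n then euler_log_term (a n) n s else 0) - (if prime n then euler_log_term (b n) n s else 0))
      sums (euler_log a s - euler_log b s)"
    by (intro sums_diff euler_log_sums a b1 s)
  moreover have "(\<lambda>n. if n \<in> S then euler_log_term (a n) n s else 0) sums (\<Sum>n\<in>S. euler_log_term (a n) n s)"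
    by (rule sums_If_finite_set[OF S(1)])
  moreover have "(\<lambda>n. (if prime n then euler_log_term (a n) n s else 0) - (if prime n then euler_log_term (b n) n s else 0))
      = (\<lambda>n. if n \<in> S then euler_log_term (a n) n s else 0)"
    using S b by (auto simp: fun_eq_iff euler_log_term_def)
  ultimately have eq: "euler_log a s = euler_log b s + (\<Sum>n\<in>S. euler_log_term (a n) n s)"
    using sums_unique2 by (fastforce simp: algebra_simps)
  have "exp (\<Sum>n\<in>S. euler_log_term (a n) n s) * (\<Prod>p\<in>S. 1 - a p * of_nat p powr (-s)) =
     (\<Prod>p\<in>S. exp (euler_log_term (a p) p s) * (1 - a p * of_nat p powr (-s)))"
    using S by (simp add: exp_sum prod.distrib)
  also have "\<dots> = 1"
    by (intro prod.neutral) (use exp_euler_log_term[OF a prime_ge_2_nat s] S in auto)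
  finally show ?thesis unfolding eq exp_add by (simp add: mult.assoc)
qed

section \<open>Nonnegativity of the even derivatives\<close>

definition even_derivs_nonneg :: "(complex \<Rightarrow> complex) \<Rightarrow> bool" where
  "even_derivs_nonneg f \<longleftrightarrow> f holomorphic_on {s. Re s > 1} \<and>
     (\<forall>x>1. \<forall>j. even j \<longrightarrow> (deriv ^^ j) f (of_real x) \<in> \<real>\<^sub>\<ge>\<^sub>0)"

lemma even_derivs_nonneg_cong:
  assumes "even_derivs_nonneg f" "\<And>s. Re s > 1 \<Longrightarrow> g s = f s"
  shows "even_derivs_nonneg g"
proof -
  have f: "f holomorphic_on {s. Re s > 1}" using assms by (simp add: even_derivs_nonneg_def)
  have g: "g holomorphic_on {s. Re s > 1}" by (rule holomorphic_transform[OF f]) (use assms in auto)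
  have "(deriv ^^ j) g (of_real x) = (deriv ^^ j) f (of_real x)" if "x > 1" for x j
    by (rule higher_deriv_transform_within_open[OF g f]) (use that assms in \<open>auto simp: open_halfspace_Re_gt\<close>)
  then show ?thesis using assms g by (simp add: even_derivs_nonneg_def)
qed

lemma even_derivs_nonneg_add:
  assumes "even_derivs_nonneg f" "even_derivs_nonneg g"
  shows "even_derivs_nonneg (\<lambda>s. f s + g s)"
proof -
  have hol: "f holomorphic_on {s. Re s > 1}" "g holomorphic_on {s. Re s > 1}"
    using assms by (auto simp: even_derivs_nonneg_def)
  have "(deriv ^^ j) (\<lambda>s. f s + g s) (of_real x) = (deriv ^^ j) f (of_real x) + (deriv ^^ j) g (of_real x)"
    if "x > 1" for x j
    by (rule higher_deriv_add[OF hol]) (use that in \<open>auto simp: open_halfspace_Re_gt\<close>)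
  then show ?thesis using assms by (auto simp: even_derivs_nonneg_def intro!: holomorphic_intros nonneg_Reals_add_I)
qed

lemma even_derivs_nonneg_zero: "even_derivs_nonneg (\<lambda>_. 0)"
  unfolding even_derivs_nonneg_def by (auto simp: higher_deriv_const)

text \<open>
  Locally uniform convergence passes to derivatives of every order, and the nonnegative reals are closed.
\<close>
lemma even_derivs_nonneg_suminf:
  assumes f: "\<And>n. even_derivs_nonneg (f n)"
    and bd: "\<And>x. x \<in> {s. Re s > 1} \<Longrightarrow> \<exists>d>0. \<exists>M. cball x d \<subseteq> {s. Re s > 1} \<and> summable M \<and> (\<forall>n. \<forall>y\<in>cball x d. norm (f n y) \<le> M n)"
  shows "even_derivs_nonneg (\<lambda>s. \<Sum>n. f n s)"
  unfolding even_derivs_nonneg_def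
proof (intro conjI allI impI)
  have hol: "f n holomorphic_on {s. Re s > 1}" for n using f by (auto simp: even_derivs_nonneg_def)
  show "(\<lambda>s. \<Sum>n. f n s) holomorphic_on {s. Re s > 1}"
    by (rule holomorphic_on_suminf[OF open_halfspace_Re_gt hol bd])
  fix x :: real and j :: nat assume x: "x > 1" and j: "even j"
  have x': "of_real x \<in> {s. Re s > 1}" using x by simp
  from bd[OF x'] obtain d M where d: "d > 0" "cball (of_real x) d \<subseteq> {s. Re s > 1}" and M: "summable M"
    and le: "\<forall>n. \<forall>y\<in>cball (of_real x) d. norm (f n y) \<le> M n"
    by (elim exE conjE) (rule that, assumption+)
  have "uniform_limit (cball (of_real x) d) (\<lambda>n s. \<Sum>i<n. f i s) (\<lambda>s. \<Sum>n. f n s) sequentially"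
    by (rule Weierstrass_m_test[OF _ M]) (rule le[rule_format])
  then have ul: "uniform_limit (ball (of_real x) d) (\<lambda>n s. \<Sum>i<n. f i s) (\<lambda>s. \<Sum>n. f n s) sequentially"
    by (rule uniform_limit_on_subset) auto
  have "(\<lambda>n. (deriv ^^ j) (\<lambda>s. \<Sum>i<n. f i s) (of_real x)) \<longlonglongrightarrow> (deriv ^^ j) (\<lambda>s. \<Sum>n. f n s) (of_real x)"
  proof (rule higher_deriv_complex_uniform_limit[OF ul])
    show "\<forall>\<^sub>F n in sequentially. (\<lambda>s. \<Sum>i<n. f i s) holomorphic_on ball (of_real x) d"
      by (intro always_eventually allI holomorphic_intros holomorphic_on_subset[OF hol])
         (use d ball_subset_cball in blast)
  qed (use d in auto)
  moreover have part: "even_derivs_nonneg (\<lambda>s. \<Sum>i<n. f i s)" for n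
    by (induction n) (simp_all add: even_derivs_nonneg_zero even_derivs_nonneg_add f)
  have "(deriv ^^ j) (\<lambda>s. \<Sum>i<n. f i s) (of_real x) \<in> \<real>\<^sub>\<ge>\<^sub>0" for n
    using part[of n] x j by (simp add: even_derivs_nonneg_def)
  ultimately show "(deriv ^^ j) (\<lambda>s. \<Sum>n. f n s) (of_real x) \<in> \<real>\<^sub>\<ge>\<^sub>0"
    by (rule Lim_in_closed_set[OF closed_nonneg_Reals_complex always_eventually[OF allI] sequentially_bot, rotated])
qed

lemma even_derivs_nonneg_powr:
  assumes c: "c \<ge> 0" and n: "n > 0"
  shows "even_derivs_nonneg (\<lambda>s. of_real c * of_nat n powr (-s))"
proof -
  define l where "l = ln (real n)"
  have eq: "of_real c * of_nat n powr (-s) = of_real c * exp (- of_real l * s)" for s :: complex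
    using n by (simp add: powr_def l_def Ln_of_nat mult.commute)
  have d: "(deriv ^^ j) (\<lambda>s :: complex. of_real c * exp (- of_real l * s)) = (\<lambda>s. of_real (c * (-l) ^ j) * exp (- of_real l * s))" for j
  proof (induction j)
    case (Suc j)
    have "(deriv ^^ Suc j) (\<lambda>s :: complex. of_real c * exp (- of_real l * s)) = deriv (\<lambda>s. of_real (c * (-l) ^ j) * exp (- of_real l * s))"
      using Suc by simp
    also have "\<dots> = (\<lambda>s. of_real (c * (-l) ^ Suc j) * exp (- of_real l * s))"
      by (rule ext, rule DERIV_imp_deriv) (auto intro!: derivative_eq_intros)
    finally show ?case .
  qed simp
  have "(deriv ^^ j) (\<lambda>s :: complex. of_real c * exp (- of_real l * s)) (of_real x) \<in> \<real>\<^sub>\<ge>\<^sub>0" if "even j" for j x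
  proof -
    have "of_real (c * (-l) ^ j) * exp (- of_real l * of_real x) = (of_real (c * l ^ j * exp (- l * x)) :: complex)"
      using that by (simp add: exp_of_real[symmetric])
    also have "\<dots> \<in> \<real>\<^sub>\<ge>\<^sub>0" unfolding nonneg_Reals_of_real_iff
      using c that by (intro mult_nonneg_nonneg zero_le_even_power) auto
    finally show ?thesis unfolding d .
  qed
  then show ?thesis unfolding eq even_derivs_nonneg_def by (auto intro!: holomorphic_intros)
qed

lemma euler_log_term_series:
  assumes "norm c \<le> 1" "n \<ge> 2" "Re s > 1"
  shows "(\<lambda>m. c ^ m / of_nat m * of_nat (n ^ m) powr (-s)) sums euler_log_term c n s"
proof -
  let ?z = "c * of_nat n powr (-s)"
  have "(\<lambda>m. - ((- (- ?z)) ^ m) / of_nat m) sums Ln (1 + (- ?z))"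
    by (rule Ln_series') (use norm_euler_term(2)[OF assms] in simp)
  from sums_minus[OF this] have "(\<lambda>m. ?z ^ m / of_nat m) sums euler_log_term c n s"
    by (simp add: euler_log_term_def)
  moreover have "?z ^ m = c ^ m * of_nat (n ^ m) powr (-s)" for m
  proof -
    have "(of_nat n powr (-s)) ^ m = of_nat (n ^ m) powr (-s)"
      by (induction m) (simp_all add: powr_times_real)
    then show ?thesis by (simp add: power_mult_distrib)
  qed
  ultimately show ?thesis by simp
qed

text \<open>
  The four logarithms add up to the Dirichlet series with the coefficient
  \<open>1 + x^m + y^m + (x y)^m = (1 + x^m) (1 + y^m) \<ge> 0\<close> at \<open>n^m\<close>, up to the factor \<open>1 / m\<close>.
\<close>
lemma even_derivs_nonneg_four_euler_logs:
  fixes x y :: real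
  assumes x: "\<bar>x\<bar> \<le> 1" and y: "\<bar>y\<bar> \<le> 1" and n: "n \<ge> 2"
  shows "even_derivs_nonneg (\<lambda>s. euler_log_term 1 n s + euler_log_term (of_real x) n s +
     euler_log_term (of_real y) n s + euler_log_term (of_real x * of_real y) n s)"
proof -
  define c where "c m = (1 + x ^ m) * (1 + y ^ m) / real m" for m
  have pm: "1 + z ^ m \<ge> 0" "\<bar>z ^ m\<bar> \<le> 1" if "\<bar>z\<bar> \<le> 1" for z :: real and m
  proof -
    show "\<bar>z ^ m\<bar> \<le> 1" using power_le_one[of "\<bar>z\<bar>" m] that by (simp add: power_abs)
    then show "1 + z ^ m \<ge> 0" by (simp add: abs_le_iff)
  qed
  have c: "c m \<ge> 0" for m unfolding c_def using pm x y by simp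
  have c4: "c m \<le> 4" for m
  proof (cases "m = 0")
    case False
    have "(1 + x ^ m) * (1 + y ^ m) \<le> 2 * 2"
      using pm[OF x, of m] pm[OF y, of m] by (intro mult_mono) (auto simp: abs_le_iff)
    also have "\<dots> \<le> 4 * real m" using False by simp
    finally show ?thesis using False by (simp add: c_def divide_simps)
  qed (simp add: c_def)
  have "even_derivs_nonneg (\<lambda>s. \<Sum>m. of_real (c m) * of_nat (n ^ m) powr (-s))"
  proof (rule even_derivs_nonneg_suminf)
    show "even_derivs_nonneg (\<lambda>s. of_real (c m) * of_nat (n ^ m) powr (-s))" for m
      by (rule even_derivs_nonneg_powr[OF c]) (use n in auto)
    fix z assume z: "z \<in> {s. Re s > 1}"
    then obtain d e where d: "d > 0" "e > 1" "cball z d \<subseteq> {s. Re s > 1}" "\<forall>y\<in>cball z d. Re y \<ge> e"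
      using local_bound_halfplane[of z] by auto
    have "norm (of_real (c m) * of_nat (n ^ m) powr (-w) :: complex) \<le> 4 * (1/2) ^ m" if "w \<in> cball z d" for m w
    proof -
      have w: "Re w > 1" using that d by auto
      have "norm (of_nat (n ^ m) powr (-w) :: complex) = real (n ^ m) powr (- Re w)"
        by (subst norm_powr_real_powr) auto
      also have "\<dots> \<le> real (n ^ m) powr (-1)" by (rule powr_mono) (use w n in auto)
      also have "\<dots> = (1 / real n) ^ m" using n by (simp add: powr_minus divide_simps)
      also have "\<dots> \<le> (1 / 2) ^ m" by (rule power_mono) (use n in \<open>auto simp: divide_simps\<close>)
      finally show ?thesis unfolding norm_mult using c[of m] c4[of m]
        by (intro mult_mono) auto
    qed
    moreover have "summable (\<lambda>m. 4 * (1/2 :: real) ^ m)" by (intro summable_mult summable_geometric) simp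
    ultimately show "\<exists>d>0. \<exists>M. cball z d \<subseteq> {s. Re s > 1} \<and> summable M \<and>
        (\<forall>m. \<forall>y\<in>cball z d. norm (of_real (c m) * of_nat (n ^ m) powr (-y) :: complex) \<le> M m)"
      using d by blast
  qed
  moreover have "euler_log_term 1 n s + euler_log_term (of_real x) n s +
     euler_log_term (of_real y) n s + euler_log_term (of_real x * of_real y) n s =
     (\<Sum>m. of_real (c m) * of_nat (n ^ m) powr (-s))" if s: "Re s > 1" for s
  proof (rule sums_unique)
    let ?w = "\<lambda>m. of_nat (n ^ m) powr (-s) :: complex"
    have xy: "norm (of_real x * of_real y :: complex) \<le> 1"
      unfolding norm_mult using mult_le_one[of "\<bar>x\<bar>" "\<bar>y\<bar>"] x y by simp
    have "(\<lambda>m. 1 ^ m / of_nat m * ?w m + of_real x ^ m / of_nat m * ?w m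
      + of_real y ^ m / of_nat m * ?w m + (of_real x * of_real y) ^ m / of_nat m * ?w m)
      sums (euler_log_term 1 n s + euler_log_term (of_real x) n s +
     euler_log_term (of_real y) n s + euler_log_term (of_real x * of_real y) n s)"
      by (intro sums_add euler_log_term_series) (use x y n s xy in auto)
    moreover have "1 ^ m / of_nat m * ?w m + of_real x ^ m / of_nat m * ?w m
      + of_real y ^ m / of_nat m * ?w m + (of_real x * of_real y) ^ m / of_nat m * ?w m
      = of_real (c m) * ?w m" for m
      by (cases "m = 0") (simp_all add: c_def field_simps power_mult_distrib)
    ultimately show "(\<lambda>m. of_real (c m) * ?w m) sums (euler_log_term 1 n s + euler_log_term (of_real x) n s +
     euler_log_term (of_real y) n s + euler_log_term (of_real x * of_real y) n s)" by simp
  qed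
  ultimately show ?thesis by (rule even_derivs_nonneg_cong)
qed

lemma even_derivs_nonneg_euler_logs:
  fixes a b :: "nat \<Rightarrow> real"
  assumes a: "\<And>n. \<bar>a n\<bar> \<le> 1" and b: "\<And>n. \<bar>b n\<bar> \<le> 1"
  shows "even_derivs_nonneg (\<lambda>s. euler_log (\<lambda>_. 1) s + euler_log (\<lambda>n. of_real (a n)) s +
     euler_log (\<lambda>n. of_real (b n)) s + euler_log (\<lambda>n. of_real (a n) * of_real (b n)) s)"
proof -
  define T where "T n s = euler_log_term 1 n s + euler_log_term (of_real (a n)) n s +
     euler_log_term (of_real (b n)) n s + euler_log_term (of_real (a n) * of_real (b n)) n s" for n s
  have ab: "norm (of_real (a n) * of_real (b n) :: complex) \<le> 1" for n
    unfolding norm_mult using mult_le_one[of "\<bar>a n\<bar>" "\<bar>b n\<bar>"] a[of n] b[of n] by simp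
  have nT: "norm (T n s) \<le> 8 * real n powr (- Re s)" if "n \<ge> 2" "Re s > 1" for n s
  proof -
    have "norm (T n s) \<le> norm (euler_log_term 1 n s) + norm (euler_log_term (of_real (a n)) n s) +
      norm (euler_log_term (of_real (b n)) n s) + norm (euler_log_term (of_real (a n) * of_real (b n)) n s)"
      unfolding T_def by norm
    also have "\<dots> \<le> 2 * real n powr (- Re s) + 2 * real n powr (- Re s) + 2 * real n powr (- Re s) + 2 * real n powr (- Re s)"
      by (intro add_mono norm_euler_log_term that) (use a b ab in auto)
    finally show ?thesis by simp
  qed
  have "even_derivs_nonneg (\<lambda>s. \<Sum>n. if prime n then T n s else 0)"
  proof (rule even_derivs_nonneg_suminf)
    show "even_derivs_nonneg (\<lambda>s. if prime n then T n s else 0)" for n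
    proof (cases "prime n")
      case True
      have "even_derivs_nonneg (T n)" unfolding T_def[abs_def]
        by (rule even_derivs_nonneg_four_euler_logs[OF a b prime_ge_2_nat[OF True]])
      then show ?thesis using True by simp
    qed (simp add: even_derivs_nonneg_zero)
    fix x assume "x \<in> {s. Re s > 1}"
    with nT show "\<exists>d>0. \<exists>M. cball x d \<subseteq> {s. Re s > 1} \<and> summable M \<and>
      (\<forall>n. \<forall>y\<in>cball x d. norm (if prime n then T n y else 0) \<le> M n)"
      by (intro prime_series_bound[where K = 8]) auto
  qed
  moreover have "euler_log (\<lambda>_. 1) s + euler_log (\<lambda>n. of_real (a n)) s +
     euler_log (\<lambda>n. of_real (b n)) s + euler_log (\<lambda>n. of_real (a n) * of_real (b n)) s =
     (\<Sum>n. if prime n then T n s else 0)" if s: "Re s > 1" for s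
  proof (rule sums_unique)
    let ?t = "\<lambda>f n. if prime n then euler_log_term (f n) n s else 0"
    have "(\<lambda>n. ?t (\<lambda>_. 1) n + ?t (\<lambda>n. of_real (a n)) n + ?t (\<lambda>n. of_real (b n)) n + ?t (\<lambda>n. of_real (a n) * of_real (b n)) n)
      sums (euler_log (\<lambda>_. 1) s + euler_log (\<lambda>n. of_real (a n)) s +
     euler_log (\<lambda>n. of_real (b n)) s + euler_log (\<lambda>n. of_real (a n) * of_real (b n)) s)"
      by (intro sums_add euler_log_sums s) (use a b ab in auto)
    moreover have "(\<lambda>n. ?t (\<lambda>_. 1) n + ?t (\<lambda>n. of_real (a n)) n + ?t (\<lambda>n. of_real (b n)) n + ?t (\<lambda>n. of_real (a n) * of_real (b n)) n)
      = (\<lambda>n. if prime n then T n s else 0)" by (auto simp: T_def)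
    ultimately show "(\<lambda>n. if prime n then T n s else 0) sums (euler_log (\<lambda>_. 1) s + euler_log (\<lambda>n. of_real (a n)) s +
     euler_log (\<lambda>n. of_real (b n)) s + euler_log (\<lambda>n. of_real (a n) * of_real (b n)) s)" by simp
  qed
  ultimately show ?thesis by (rule even_derivs_nonneg_cong)
qed

section \<open>Quadratic characters\<close>

lemma dirichlet_characterD:
  assumes "dirichlet_character q \<chi>"
  shows "q > 0" "\<chi> (m * n) = \<chi> m * \<chi> n" "\<chi> (n + q) = \<chi> n" "\<chi> n \<noteq> 0 \<longleftrightarrow> coprime n q"
    "\<not> coprime n q \<Longrightarrow> \<chi> n = 0" "\<chi> 1 = 1"
proof -
  show *: "q > 0" "\<chi> (m * n) = \<chi> m * \<chi> n" "\<chi> (n + q) = \<chi> n" "\<chi> n \<noteq> 0 \<longleftrightarrow> coprime n q" for m n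
    using assms unfolding dirichlet_character_def by blast+
  show "\<not> coprime n q \<Longrightarrow> \<chi> n = 0" using *(4)[of n] by blast
  have "\<chi> 1 \<noteq> 0" using *(4)[of 1] by simp
  moreover have "\<chi> 1 * \<chi> 1 = \<chi> 1" using *(2)[of 1 1] by simp
  ultimately show "\<chi> 1 = 1" by simp
qed

lemma dirichlet_character_cong:
  assumes "dirichlet_character q \<chi>" "[m = n] (mod q)"
  shows "\<chi> m = \<chi> n"
  using periodic_mod[where a = \<chi> and q = q, OF dirichlet_characterD(3)[OF assms(1)]] assms(2)
  unfolding cong_def by metis

definition quadratic_dirichlet :: "nat \<Rightarrow> (nat \<Rightarrow> complex) \<Rightarrow> bool" where
  "quadratic_dirichlet q \<chi> \<longleftrightarrow> dirichlet_character q \<chi> \<and> quadratic_character q \<chi>"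

lemma quadratic_dirichlet_values:
  assumes "quadratic_dirichlet q \<chi>"
  shows "\<chi> n \<in> {-1, 0, 1}"
proof (cases "coprime n q")
  case True
  then have "\<chi> n ^ 2 = 1" using assms by (auto simp: quadratic_dirichlet_def quadratic_character_def)
  then show ?thesis by (auto simp: power2_eq_1_iff)
next
  case False
  then show ?thesis using assms dirichlet_characterD(5) by (auto simp: quadratic_dirichlet_def)
qed

lemma quadratic_dirichlet_real:
  assumes "quadratic_dirichlet q \<chi>"
  shows "\<chi> n = of_real (Re (\<chi> n))" "\<bar>Re (\<chi> n)\<bar> \<le> 1" "norm (\<chi> n) \<le> 1" "real_character \<chi>"
proof -
  note v = quadratic_dirichlet_values[OF assms]
  show "\<chi> n = of_real (Re (\<chi> n))" "\<bar>Re (\<chi> n)\<bar> \<le> 1" "norm (\<chi> n) \<le> 1" using v[of n] by auto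
  have "\<chi> n \<in> \<real>" for n using v[of n] by auto
  then show "real_character \<chi>" by (simp add: real_character_def)
qed

lemma quadratic_dirichlet_mult:
  assumes "quadratic_dirichlet q \<chi>"
  shows "completely_multiplicative \<chi>"
  using dirichlet_characterD(2,6) quadratic_dirichlet_real(3)[OF assms] assms
  unfolding completely_multiplicative_def quadratic_dirichlet_def by blast

text \<open>
  Multiplication by a unit \<open>m\<close> permutes the residues, so the sum is \<open>\<chi> m\<close> times itself; choose \<open>m\<close>
  with \<open>\<chi> m \<noteq> 1\<close>.
\<close>
lemma quadratic_dirichlet_sum_zero:
  assumes "quadratic_dirichlet q \<chi>"
  shows "(\<Sum>n<q. \<chi> (Suc n)) = 0"
proof -
  have D: "dirichlet_character q \<chi>" using assms by (simp add: quadratic_dirichlet_def)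
  note D' = dirichlet_characterD[OF D]
  obtain m where m: "coprime m q" "\<chi> m \<noteq> 1"
    using assms by (auto simp: quadratic_dirichlet_def quadratic_character_def)
  have inj: "inj_on (\<lambda>n. m * n mod q) {..<q}"
  proof (rule inj_onI)
    fix a b assume ab: "a \<in> {..<q}" "b \<in> {..<q}" and "m * a mod q = m * b mod q"
    then have "[m * a = m * b] (mod q)" by (simp add: cong_def)
    then have "[a = b] (mod q)" using m(1) cong_mult_lcancel_nat by blast
    then show "a = b" using ab by (simp add: cong_def)
  qed
  have "(\<lambda>n. m * n mod q) ` {..<q} = {..<q}"
    by (rule endo_inj_surj[OF _ _ inj]) (use D'(1) in auto)
  then have bij: "bij_betw (\<lambda>n. m * n mod q) {..<q} {..<q}" using inj by (simp add: bij_betw_def)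
  have "(\<Sum>n<q. \<chi> n) = (\<Sum>n<q. \<chi> (m * n mod q))"
    by (rule sum.reindex_bij_betw[OF bij, symmetric])
  also have "\<dots> = (\<Sum>n<q. \<chi> m * \<chi> n)"
  proof (rule sum.cong[OF refl])
    fix n
    have "\<chi> (m * n mod q) = \<chi> (m * n)" by (rule dirichlet_character_cong[OF D]) (simp add: cong_def)
    then show "\<chi> (m * n mod q) = \<chi> m * \<chi> n" using D'(2) by simp
  qed
  also have "\<dots> = \<chi> m * (\<Sum>n<q. \<chi> n)" by (rule sum_distrib_left[symmetric])
  finally have "(\<Sum>n<q. \<chi> n) = \<chi> m * (\<Sum>n<q. \<chi> n)" .
  then have "(\<Sum>n<q. \<chi> n) = 0" using m(2) by simp
  moreover have "(\<Sum>n<q. \<chi> (Suc n)) + \<chi> 0 = (\<Sum>n<q. \<chi> n) + \<chi> q"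
    using sum.lessThan_Suc_shift[of \<chi> q] by (simp add: add.commute)
  ultimately show ?thesis using D'(3)[of 0] by simp
qed

lemma dirichlet_L_quadratic:
  assumes "quadratic_dirichlet q \<chi>"
  shows "dirichlet_L \<chi> holomorphic_on UNIV"
    "Re s > 1 \<Longrightarrow> dirichlet_L \<chi> s = exp (euler_log \<chi> s)"
    "Re s \<ge> 1 / 2 \<Longrightarrow> norm (dirichlet_L \<chi> s) \<le> q * norm s * (\<Sum>n. real (Suc n) powr (-3/2))"
proof -
  have D: "dirichlet_character q \<chi>" using assms by (simp add: quadratic_dirichlet_def)
  note D' = dirichlet_characterD[OF D]
  have per: "\<chi> (Suc (n + q)) = \<chi> (Suc n)" for n using D'(3)[of "Suc n"] by simp
  note zero = quadratic_dirichlet_sum_zero[OF assms]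
  obtain F where F: "F holomorphic_on UNIV"
     "\<And>s. Re s > 1 \<Longrightarrow> (\<lambda>n. \<chi> (Suc n) / of_nat (Suc n) powr s) sums F s"
    using periodic_dirichlet_series_entire[where a = "\<lambda>n. \<chi> (Suc n)", OF D'(1) per zero] by blast
  have "is_dirichlet_L \<chi> F" unfolding is_dirichlet_L_def
    using F by (auto simp: sums_iff analytic_on_open intro!: analytic_on_imp_nicely_meromorphic_on)
  then have eq: "dirichlet_L \<chi> = F" by (rule dirichlet_L_eqI)
  show "dirichlet_L \<chi> holomorphic_on UNIV" using F eq by simp
  show "dirichlet_L \<chi> s = exp (euler_log \<chi> s)" if "Re s > 1"
    using F(2)[OF that] dirichlet_series_eq_exp[OF quadratic_dirichlet_mult[OF assms] that] sums_unique2
    unfolding eq by blast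
  show "norm (dirichlet_L \<chi> s) \<le> q * norm s * (\<Sum>n. real (Suc n) powr (-3/2))" if "Re s \<ge> 1 / 2"
    unfolding eq
    by (rule periodic_dirichlet_series_bound[where a = "\<lambda>n. \<chi> (Suc n)", OF D'(1) per zero _ F that])
       (use quadratic_dirichlet_real(3)[OF assms] in auto)
qed

text \<open>
  Add to \<open>n\<close> the product of \<open>d\<close> and the primes of \<open>q\<close> not dividing \<open>n\<close>. A prime of \<open>q\<close> then divides exactly one
  of the two summands.
\<close>
lemma coprime_lift:
  fixes n d q :: nat
  assumes "q > 0" "coprime n d"
  shows "\<exists>m. [m = n] (mod d) \<and> coprime m q"
proof -
  define t where "t = \<Prod>{p. prime p \<and> p dvd q \<and> \<not> p dvd n}"
  have fin: "finite {p. prime p \<and> p dvd q \<and> \<not> p dvd n}"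
    by (rule finite_subset[OF _ finite_divisors_nat[OF assms(1)]]) auto
  have "\<not> p dvd n + d * t" if p: "prime p" "p dvd q" for p
  proof (cases "p dvd n")
    case True
    have "\<not> p dvd d" using True assms(2) p(1) coprime_common_divisor_nat[of n d p] by auto
    moreover have "\<not> p dvd t"
    proof
      assume "p dvd t"
      then obtain r where r: "prime r" "\<not> r dvd n" "p dvd r"
        unfolding t_def using fin p(1) by (auto simp: prime_dvd_prod_iff)
      then have "p = r" using primes_dvd_imp_eq p(1) by blast
      then show False using r True by simp
    qed
    ultimately have "\<not> p dvd d * t" using p(1) prime_dvd_multD by blast
    then show ?thesis using True by (simp add: dvd_add_right_iff)
  next
    case False
    then have "p dvd t" unfolding t_def using fin p by (intro dvd_prodI) auto
    then have "p dvd d * t" by simp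
    then show ?thesis using False by (simp add: dvd_add_left_iff)
  qed
  note no_prime = this
  have "coprime (n + d * t) q"
  proof (rule ccontr)
    assume "\<not> coprime (n + d * t) q"
    then have "gcd (n + d * t) q \<noteq> 1" unfolding coprime_iff_gcd_eq_1 .
    then obtain p where p: "prime p" "p dvd gcd (n + d * t) q" using prime_factor_nat by blast
    from p(2) have "p dvd n + d * t" "p dvd q" by (meson dvd_trans gcd_dvd1, meson dvd_trans gcd_dvd2)
    then show False using no_prime[of p] p(1) by blast
  qed
  moreover have "[n + d * t = n] (mod d)" by (simp add: cong_def)
  ultimately show ?thesis by blast
qed

text \<open>
  Take for \<open>d\<close> the least induced modulus of \<open>\<chi>\<close>. Then \<open>\<chi> n\<close> depends only on \<open>n\<close> modulo \<open>d\<close> as long as \<open>n\<close> is coprime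
  to \<open>q\<close>, and every class of units modulo \<open>d\<close> contains such an \<open>n\<close>.
\<close>
lemma primitive_inducing_character:
  assumes \<chi>: "quadratic_dirichlet q \<chi>"
  obtains d \<psi> where "d dvd q" "primitive_character d \<psi>" "quadratic_dirichlet d \<psi>"
    "\<And>n. \<chi> n = (if coprime n q then \<psi> n else 0)"
proof -
  have D: "dirichlet_character q \<chi>" and Q: "quadratic_character q \<chi>"
    using assms by (simp_all add: quadratic_dirichlet_def)
  note D' = dirichlet_characterD[OF D]
  define I where "I d \<longleftrightarrow> d dvd q \<and> (\<forall>n. coprime n q \<and> [n = 1] (mod d) \<longrightarrow> \<chi> n = 1)" for d
  have "\<chi> n = 1" if "[n = 1] (mod q)" for n
    using dirichlet_character_cong[OF D that] D'(6) by simp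
  then have "I q" by (simp add: I_def)
  define d where "d = (LEAST d. I d)"
  have Id: "I d" unfolding d_def by (rule LeastI[of I, OF \<open>I q\<close>])
  have least: "d \<le> e" if "I e" for e unfolding d_def by (rule Least_le[of I, OF that])
  have dq: "d dvd q" using Id by (simp add: I_def)
  have d0: "d > 0" using dq D'(1) by (auto intro: Nat.gr0I)
  have cop: "coprime n d" if "coprime n q" for n using that dq coprime_divisors[of n n d q] by auto
  have wd: "\<chi> m = \<chi> m'" if m: "coprime m q" "coprime m' q" "[m = m'] (mod d)" for m m'
  proof -
    obtain k where k: "[m' * k = 1] (mod q)" using cong_solve_coprime_nat[OF m(2)] by auto
    then have kq: "coprime k q"
      using coprime_iff_invertible_nat[of k q] by (auto simp: mult.commute)
    have "[m' * k = 1] (mod d)" using k dq cong_dvd_modulus_nat by blast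
    moreover have "[m * k = m' * k] (mod d)" using m(3) by (rule cong_scalar_right)
    ultimately have "[m * k = 1] (mod d)" using cong_trans by blast
    then have "\<chi> (m * k) = 1" using Id m(1) kq by (simp add: I_def)
    moreover have "\<chi> (m' * k) = 1" using dirichlet_character_cong[OF D k] D'(6) by simp
    moreover have "\<chi> k \<noteq> 0" using kq D'(4) by blast
    ultimately show ?thesis using D'(2) by (metis mult_cancel_right)
  qed
  define lift where "lift n = (SOME m. [m = n] (mod d) \<and> coprime m q)" for n
  have lift: "[lift n = n] (mod d)" "coprime (lift n) q" if "coprime n d" for n
    using someI_ex[OF coprime_lift[OF D'(1) that]] by (simp_all add: lift_def)
  define \<psi> where "\<psi> n = (if coprime n d then \<chi> (lift n) else 0)" for n
  have \<psi>: "\<psi> n = \<chi> m" if "[m = n] (mod d)" "coprime m q" for n m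
  proof -
    have n: "coprime n d" using cong_imp_coprime[OF that(1)] cop[OF that(2)] by simp
    have "[lift n = m] (mod d)" using lift(1)[OF n] that(1) by (metis cong_sym cong_trans)
    then show ?thesis using wd[OF lift(2)[OF n] that(2)] n by (simp add: \<psi>_def)
  qed
  have \<psi>0: "\<psi> n = 0" if "\<not> coprime n d" for n using that by (simp add: \<psi>_def)
  have D\<psi>: "dirichlet_character d \<psi>" unfolding dirichlet_character_def
  proof (intro conjI allI)
    show "d > 0" by (rule d0)
    show "\<psi> (m * n) = \<psi> m * \<psi> n" for m n
    proof (cases "coprime m d \<and> coprime n d")
      case True
      have "\<psi> (m * n) = \<chi> (lift m * lift n)"
        by (rule \<psi>) (use True lift in \<open>auto intro: cong_mult\<close>)
      then show ?thesis using True by (simp add: \<psi>_def D'(2))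
    qed (auto simp: \<psi>0)
    show "\<psi> (n + d) = \<psi> n" for n
    proof (cases "coprime n d")
      case True
      show ?thesis
        using \<psi>[of "lift n" "n + d"] \<psi>[of "lift n" n] lift[OF True] by (simp add: cong_def)
    next
      case False
      then have "\<not> coprime (n + d) d" using coprime_cong_cong_left[of "n + d" n d] by (simp add: cong_def)
      with False show ?thesis by (simp add: \<psi>0)
    qed
    show "\<psi> n \<noteq> 0 \<longleftrightarrow> coprime n d" for n
      using D'(4)[of "lift n"] lift(2)[of n] by (auto simp: \<psi>_def)
  qed
  have \<psi>\<chi>: "\<psi> n = \<chi> n" if "coprime n q" for n by (rule \<psi>) (use that in auto)
  have "primitive_character d \<psi>" unfolding primitive_character_def
  proof (intro conjI allI impI D\<psi>)
    fix e assume e: "e dvd d \<and> e < d"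
    show "\<exists>n. coprime n d \<and> [n = 1] (mod e) \<and> \<psi> n \<noteq> 1"
    proof (rule ccontr)
      assume "\<not> ?thesis"
      then have *: "\<psi> n = 1" if "coprime n d" "[n = 1] (mod e)" for n using that by blast
      have "I e" unfolding I_def
      proof (intro conjI allI impI)
        show "e dvd q" using e dq dvd_trans by blast
        show "\<chi> n = 1" if "coprime n q \<and> [n = 1] (mod e)" for n
          using *[of n] cop[of n] \<psi>\<chi>[of n] that by simp
      qed
      then show False using least[of e] e by simp
    qed
  qed
  moreover have "quadratic_dirichlet d \<psi>" unfolding quadratic_dirichlet_def quadratic_character_def
  proof (intro conjI D\<psi> allI impI)
    show "\<psi> n ^ 2 = 1" if "coprime n d" for n
      using that lift(2)[OF that] Q by (simp add: \<psi>_def quadratic_character_def)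
    show "\<exists>n. coprime n d \<and> \<psi> n \<noteq> 1"
      using Q cop \<psi>\<chi> unfolding quadratic_character_def by metis
  qed
  moreover have "\<chi> n = (if coprime n q then \<psi> n else 0)" for n using \<psi>\<chi> D'(5) by simp
  ultimately show ?thesis using that dq by blast
qed

text \<open>
  If \<open>n\<close> is 1 modulo the gcd of the moduli, some \<open>m\<close> is congruent to \<open>n\<close> modulo \<open>q\<close> and to 1 modulo \<open>q'\<close>, and
  then \<open>\<chi> n = \<chi> m = \<chi>' m = 1\<close>. So the gcd is an induced modulus of \<open>\<chi>\<close>, and primitivity forces it to be \<open>q\<close>.
\<close>
lemma primitive_dvd_of_agree:
  assumes \<chi>: "primitive_character q \<chi>" and \<chi>': "dirichlet_character q' \<chi>'"
    and eq: "\<And>n. coprime n (q * q') \<Longrightarrow> \<chi> n = \<chi>' n"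
  shows "q dvd q'"
proof (rule ccontr)
  assume ndvd: "\<not> q dvd q'"
  have D: "dirichlet_character q \<chi>" using \<chi> by (simp add: primitive_character_def)
  note D1 = dirichlet_characterD[OF D] and D2 = dirichlet_characterD[OF \<chi>']
  define g where "g = gcd q q'"
  have "g dvd q" by (simp add: g_def)
  moreover have "g \<noteq> q" using ndvd unfolding g_def by (metis gcd_dvd2)
  ultimately have "g dvd q \<and> g < q" using D1(1) by (auto intro: dvd_imp_le le_neq_trans)
  then obtain n where n: "coprime n q" "[n = 1] (mod g)" "\<chi> n \<noteq> 1"
    using \<chi> unfolding primitive_character_def by blast
  \<comment> \<open>A natural number representing \<open>1 - n\<close> modulo \<open>q'\<close>.\<close>
  define e where "e = 1 + n * (q' - 1)"
  have "[e = 1 + 1 * (q' - 1)] (mod g)" unfolding e_def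
    by (intro cong_add cong_mult n(2) cong_refl)
  then have "[e = q'] (mod g)" using D2(1) by simp
  then have "g dvd e" using cong_dvd_iff[of e q' g] by (simp add: g_def)
  then obtain x where x: "[q * x = e] (mod q')"
    using cong_solve_dvd_nat[of q q' e] D1(1) by (auto simp: g_def)
  define m where "m = n + q * x"
  have m1: "[m = n] (mod q)" by (simp add: m_def cong_def)
  have "[m = n + e] (mod q')" unfolding m_def by (intro cong_add x cong_refl)
  moreover have "n + e = 1 + n * q'" using D2(1) unfolding e_def by (cases q') auto
  moreover have "[1 + n * q' = 1] (mod q')" using cong_add_rcancel_0_nat[of "n * q'" 1 q'] by (simp add: cong_def add.commute)
  ultimately have m2: "[m = 1] (mod q')" using cong_trans by metis
  have "coprime m q" "coprime m q'"
    using cong_imp_coprime[OF cong_sym[OF m1]] cong_imp_coprime[OF cong_sym[OF m2]] n(1) by auto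
  then have "\<chi> m = \<chi>' m" by (intro eq) simp
  then show False
    using dirichlet_character_cong[OF D m1] dirichlet_character_cong[OF \<chi>' m2] D2(6) n(3) by simp
qed

text \<open>
  The point is that the product is not principal: quadratic characters with product 1 agree where both
  are nonzero, and then primitivity makes the moduli divide each other.
\<close>
lemma quadratic_dirichlet_product:
  assumes p1: "primitive_character q1 \<chi>1" and p2: "primitive_character q2 \<chi>2"
    and 1: "quadratic_dirichlet q1 \<chi>1" and 2: "quadratic_dirichlet q2 \<chi>2"
    and neq: "(q1, \<chi>1) \<noteq> (q2, \<chi>2)"
  shows "quadratic_dirichlet (q1 * q2) (\<lambda>n. \<chi>1 n * \<chi>2 n)"
proof -
  have D: "dirichlet_character q1 \<chi>1" "dirichlet_character q2 \<chi>2"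
    using 1 2 by (auto simp: quadratic_dirichlet_def)
  note D1 = dirichlet_characterD[OF D(1)] and D2 = dirichlet_characterD[OF D(2)]
  have sq: "\<chi>1 n ^ 2 = 1" "\<chi>2 n ^ 2 = 1" if "coprime n (q1 * q2)" for n
    using 1 2 that by (auto simp: quadratic_dirichlet_def quadratic_character_def)
  have "dirichlet_character (q1 * q2) (\<lambda>n. \<chi>1 n * \<chi>2 n)" unfolding dirichlet_character_def
  proof (intro conjI allI)
    show "q1 * q2 > 0" using D1(1) D2(1) by simp
    show "\<chi>1 (m * n) * \<chi>2 (m * n) = \<chi>1 m * \<chi>2 m * (\<chi>1 n * \<chi>2 n)" for m n
      by (simp add: D1(2) D2(2))
    show "\<chi>1 (n + q1 * q2) * \<chi>2 (n + q1 * q2) = \<chi>1 n * \<chi>2 n" for n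
      using dirichlet_character_cong[OF D(1), of "n + q1 * q2" n] dirichlet_character_cong[OF D(2), of "n + q1 * q2" n]
      by (simp add: cong_def)
    show "\<chi>1 n * \<chi>2 n \<noteq> 0 \<longleftrightarrow> coprime n (q1 * q2)" for n
      using D1(4) D2(4) by simp
  qed
  moreover have "\<exists>n. coprime n (q1 * q2) \<and> \<chi>1 n * \<chi>2 n \<noteq> 1"
  proof (rule ccontr)
    assume "\<not> ?thesis"
    then have prod1: "\<chi>1 n * \<chi>2 n = 1" if "coprime n (q1 * q2)" for n using that by blast
    have eq: "\<chi>1 n = \<chi>2 n" if "coprime n (q1 * q2)" for n
      using prod1[OF that] sq[OF that] by (auto simp: power2_eq_1_iff)
    have "q1 dvd q2" by (rule primitive_dvd_of_agree[OF p1 D(2) eq])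
    moreover have "q2 dvd q1" 
      by (rule primitive_dvd_of_agree[OF p2 D(1)]) (use eq in \<open>auto simp: mult.commute\<close>)
    ultimately have q: "q1 = q2" by (rule dvd_antisym)
    have "\<chi>1 n = \<chi>2 n" for n
      using eq[of n] D1(5)[of n] D2(5)[of n] q by (cases "coprime n q1") auto
    then show False using neq q by auto
  qed
  ultimately show ?thesis unfolding quadratic_dirichlet_def quadratic_character_def
    using sq by (auto simp: power_mult_distrib)
qed

text \<open>
  The two functions differ by finitely many Euler factors \<open>1 - \<psi>(p) p^(-s)\<close>, none of which vanishes for
  \<open>Re s > 0\<close>.
\<close>
lemma dirichlet_L_induced_zero:
  assumes \<chi>: "quadratic_dirichlet q \<chi>" and \<psi>: "quadratic_dirichlet d \<psi>"
    and ind: "\<And>n. \<chi> n = (if coprime n q then \<psi> n else 0)"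
    and s: "Re s > 0" "dirichlet_L \<chi> s = 0"
  shows "dirichlet_L \<psi> s = 0"
proof -
  define S where "S = {p. prime p \<and> p dvd q}"
  have q: "q > 0" using \<chi> dirichlet_characterD(1) by (auto simp: quadratic_dirichlet_def)
  have fin: "finite S" unfolding S_def by (rule finite_subset[OF _ finite_divisors_nat[OF q]]) auto
  define E where "E s = (\<Prod>p\<in>S. 1 - \<psi> p * of_nat p powr (-s))" for s
  have "dirichlet_L \<chi> s = dirichlet_L \<psi> s * E s"
  proof (rule analytic_continuation_open[of "{s. Re s > 1}" UNIV "dirichlet_L \<chi>" "\<lambda>s. dirichlet_L \<psi> s * E s"])
    show "{s. Re s > 1} \<noteq> {}" by (auto intro: exI[of _ 2])
    show "(\<lambda>s. dirichlet_L \<psi> s * E s) holomorphic_on UNIV"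
      unfolding E_def by (intro holomorphic_intros dirichlet_L_quadratic[OF \<psi>])
    fix z assume "z \<in> {s. Re s > 1}"
    then have z: "Re z > 1" by simp
    have "\<chi> p = (if p \<in> S then 0 else \<psi> p)" if "prime p" for p
      using ind[of p] that prime_imp_coprime[of p q] by (auto simp: S_def)
    then have "exp (euler_log \<chi> z) = exp (euler_log \<psi> z) * E z" unfolding E_def
      by (intro euler_log_remove_primes fin z quadratic_dirichlet_real(3)[OF \<chi>] quadratic_dirichlet_real(3)[OF \<psi>])
         (auto simp: S_def)
    then show "dirichlet_L \<chi> z = dirichlet_L \<psi> z * E z"
      using dirichlet_L_quadratic(2)[OF \<chi> z] dirichlet_L_quadratic(2)[OF \<psi> z] by simp
  qed (use dirichlet_L_quadratic(1)[OF \<chi>] in \<open>auto simp: open_halfspace_Re_gt\<close>)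
  moreover have "E s \<noteq> 0"
  proof -
    have "1 - \<psi> p * of_nat p powr (-s) \<noteq> 0" if "p \<in> S" for p
    proof
      assume "1 - \<psi> p * of_nat p powr (-s) = 0"
      then have "norm (\<psi> p * of_nat p powr (-s)) = 1" by simp
      moreover have "norm (\<psi> p * of_nat p powr (-s)) \<le> 1 * real p powr (- Re s)"
        unfolding norm_mult using quadratic_dirichlet_real(3)[OF \<psi>, of p]
        by (intro mult_mono) (simp_all add: norm_powr_real_powr)
      moreover have "real p powr (- Re s) < real p powr 0"
        by (rule powr_less_mono) (use s that prime_gt_1_nat in \<open>auto simp: S_def\<close>)
      ultimately show False using that by (auto simp: S_def prime_gt_0_nat)
    qed
    then show ?thesis unfolding E_def using fin by simp
  qed
  ultimately show ?thesis using s by simp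
qed

section \<open>Real zeros and higher logarithmic derivatives\<close>

text \<open>
  The map \<open>\<phi> / (2 A - \<phi>)\<close> takes the disc into the unit disc and the centre to 0, so the Schwarz
  lemma bounds \<open>\<phi>\<close> by \<open>2 A\<close> on half the disc. Cauchy's estimate on that smaller disc loses a factor \<open>2 ^ j\<close>, which
  is harmless for a later choice of the radius.
\<close>
lemma Borel_Caratheodory_higher_deriv:
  fixes \<phi> :: "complex \<Rightarrow> complex"
  assumes hol: "\<phi> holomorphic_on ball z r" and \<phi>0: "\<phi> z = 0" and r: "r > 0"
    and Re: "\<And>w. w \<in> ball z r \<Longrightarrow> Re (\<phi> w) < A" and j: "j > 0"
  shows "norm ((deriv ^^ j) \<phi> z) \<le> fact j * (2 * A) * (2 / r) ^ j"
proof -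
  have A: "A > 0" using Re[of z] r \<phi>0 by simp
  define g where "g w = \<phi> (z + of_real r * w) / (2 * of_real A - \<phi> (z + of_real r * w))" for w
  have in_ball: "z + of_real r * w \<in> ball z r" if "norm w < 1" for w
    using that r by (simp add: dist_norm norm_mult)
  have nz: "2 * of_real A - \<phi> w \<noteq> 0" if "w \<in> ball z r" for w
  proof
    assume "2 * of_real A - \<phi> w = 0"
    then have "Re (\<phi> w) = 2 * A" by (simp add: complex_eq_iff)
    then show False using Re[OF that] A by simp
  qed
  have holg: "g holomorphic_on ball 0 1"
  proof -
    have "(\<phi> \<circ> (\<lambda>w. z + of_real r * w)) holomorphic_on ball 0 1"
      by (rule holomorphic_on_compose_gen[OF _ hol]) (use in_ball in \<open>auto intro!: holomorphic_intros\<close>)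
    then show ?thesis unfolding g_def o_def
      by (intro holomorphic_intros) (use nz in_ball in auto)
  qed
  have gle: "norm (g w) < 1" if "norm w < 1" for w
  proof -
    let ?x = "\<phi> (z + of_real r * w)"
    have "Re ?x < A" by (rule Re[OF in_ball[OF that]])
    then have "Re ?x * A < A * A" using A by simp
    then have "(norm ?x)\<^sup>2 < (norm (2 * of_real A - ?x))\<^sup>2"
      unfolding cmod_power2 using A by (simp add: power2_eq_square algebra_simps)
    then have "norm ?x < norm (2 * of_real A - ?x)" by (simp add: power2_less_imp_less)
    then show ?thesis unfolding g_def norm_divide by (simp add: divide_simps)
  qed
  have g0: "g 0 = 0" by (simp add: g_def \<phi>0)
  have bound: "norm (\<phi> w) < 2 * A" if w: "w \<in> ball z (r / 2)" for w
  proof -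
    define u where "u = (w - z) / of_real r"
    have u: "z + of_real r * u = w" using r by (simp add: u_def)
    have nu: "norm u < 1 / 2" using w r by (simp add: u_def norm_divide dist_norm norm_minus_commute divide_simps)
    have gu: "norm (g u) < 1 / 2"
      using Schwarz_Lemma(1)[OF holg g0 gle, of u] nu by simp
    have "w \<in> ball z r" using w r by auto
    then have "\<phi> w = g u * (2 * of_real A - \<phi> w)" unfolding g_def u using nz by simp
    then have "norm (\<phi> w) = norm (g u) * norm (2 * of_real A - \<phi> w)" by (metis norm_mult)
    also have "\<dots> \<le> norm (g u) * (2 * A + norm (\<phi> w))"
      using norm_triangle_ineq4[of "2 * of_real A" "\<phi> w"] A by (intro mult_left_mono) auto
    finally have 1: "norm (\<phi> w) \<le> norm (g u) * (2 * A + norm (\<phi> w))" .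
    have "norm (g u) * (2 * A + norm (\<phi> w)) < 1 / 2 * (2 * A + norm (\<phi> w))"
      using gu A by (intro mult_strict_right_mono) (auto simp: add_pos_nonneg)
    with 1 show ?thesis by simp
  qed
  have "norm ((deriv ^^ j) \<phi> z) \<le> fact j * (2 * A) / (r / 2) ^ j"
  proof (rule Cauchy_higher_deriv_bound[where y = 0])
    show "\<phi> holomorphic_on ball z (r / 2)" by (rule holomorphic_on_subset[OF hol]) (use r in auto)
    show "continuous_on (cball z (r / 2)) \<phi>"
      by (rule continuous_on_subset[OF holomorphic_on_imp_continuous_on[OF hol]]) (use r in auto)
  qed (use bound r j in auto)
  also have "\<dots> = fact j * (2 * A) * (2 / r) ^ j" by (simp add: power_divide)
  finally show ?thesis .
qed

lemma holomorphic_split_off_zero: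
  assumes f: "f holomorphic_on S" and S: "open S" "connected S" and z: "z \<in> S"
    and z0: "z0 \<in> S" "f z0 \<noteq> 0"
  obtains g n where "g holomorphic_on S" "\<And>s. s \<in> S \<Longrightarrow> f s = (s - z) ^ n * g s" "g z \<noteq> 0"
proof (cases "f z = 0")
  case False
  then show ?thesis using that[of f 0] f by simp
next
  case True
  then have "\<not> f constant_on S" using z z0 by (metis constant_on_def)
  from holomorphic_factor_zero_nonconstant[OF f S z True this]
  obtain h r n where r: "0 < r" "ball z r \<subseteq> S" and h: "h holomorphic_on ball z r"
    and fh: "\<And>w. w \<in> ball z r \<Longrightarrow> f w = (w - z) ^ n * h w" and hnz: "\<And>w. w \<in> ball z r \<Longrightarrow> h w \<noteq> 0"
    by metis
  \<comment> \<open>The local cofactor \<open>h\<close>, continued by division away from \<open>z\<close>.\<close>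
  define g where "g s = (if s \<in> ball z r then h s else f s / (s - z) ^ n)" for s
  have eq: "g s = f s / (s - z) ^ n" if "s \<noteq> z" for s
    using that fh[of s] by (auto simp: g_def)
  have "g holomorphic_on ball z r" by (rule holomorphic_transform[OF h]) (auto simp: g_def)
  moreover have "g holomorphic_on (S - {z})"
  proof (rule holomorphic_transform)
    show "(\<lambda>s. f s / (s - z) ^ n) holomorphic_on (S - {z})"
      by (intro holomorphic_intros holomorphic_on_subset[OF f]) auto
  qed (simp add: eq)
  ultimately have "g holomorphic_on (ball z r \<union> (S - {z}))"
    using S by (intro holomorphic_on_Un) auto
  moreover have "ball z r \<union> (S - {z}) = S" using r z by auto
  ultimately have "g holomorphic_on S" by simp
  moreover have "f s = (s - z) ^ n * g s" if "s \<in> S" for s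
    using fh[of s] r(1) by (cases "s = z") (simp_all add: g_def)
  moreover have "g z \<noteq> 0" using hnz[of z] r by (simp add: g_def)
  ultimately show ?thesis using that by blast
qed

lemma holomorphic_split_off_zeros:
  assumes f: "f holomorphic_on S" and S: "open S" "connected S"
    and z0: "z0 \<in> S" "f z0 \<noteq> 0" and Z: "finite Z" "Z \<subseteq> S"
  shows "\<exists>h zs. h holomorphic_on S \<and> set zs \<subseteq> Z \<and> (\<forall>s\<in>S. f s = h s * (\<Prod>w\<leftarrow>zs. s - w)) \<and> (\<forall>z\<in>Z. h z \<noteq> 0)"
  using Z
proof (induction Z)
  case empty
  show ?case by (rule exI[of _ f], rule exI[of _ "[]"]) (use f in auto)
next
  case (insert z Z)
  then obtain h zs where h: "h holomorphic_on S" "set zs \<subseteq> Z"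
    "\<And>s. s \<in> S \<Longrightarrow> f s = h s * (\<Prod>w\<leftarrow>zs. s - w)" "\<And>z. z \<in> Z \<Longrightarrow> h z \<noteq> 0" by auto
  have "h z0 \<noteq> 0" using h(3)[OF z0(1)] z0(2) by auto
  then obtain g n where g: "g holomorphic_on S" "\<And>s. s \<in> S \<Longrightarrow> h s = (s - z) ^ n * g s" "g z \<noteq> 0"
    using holomorphic_split_off_zero[OF h(1) S _ z0(1), of z] insert.prems by auto
  have "g w \<noteq> 0" if "w \<in> insert z Z" for w
  proof (cases "w = z")
    case False
    then have "w \<in> Z" "w \<in> S" using that insert.prems by auto
    then show ?thesis using h(4)[of w] g(2)[of w] by auto
  qed (use g in simp)
  moreover have "f s = g s * (\<Prod>w\<leftarrow>zs @ replicate n z. s - w)" if "s \<in> S" for s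
    using h(3)[OF that] g(2)[OF that] by (simp add: prod_list_replicate)
  moreover have "set (zs @ replicate n z) \<subseteq> insert z Z" using h(2) by auto
  ultimately show ?case using g(1) by blast
qed

lemma holomorphic_factor_zeros_compact:
  assumes f: "f holomorphic_on S" and S: "open S" "connected S"
    and z0: "z0 \<in> S" "f z0 \<noteq> 0" and C: "compact C" "C \<subseteq> S"
  obtains h zs where "h holomorphic_on S" "set zs \<subseteq> {z\<in>C. f z = 0}"
    "\<And>s. s \<in> S \<Longrightarrow> f s = h s * (\<Prod>w\<leftarrow>zs. s - w)" "\<And>z. z \<in> C \<Longrightarrow> h z \<noteq> 0"
proof -
  have fin: "finite {z\<in>C. f z = 0}"
  proof (cases "f constant_on S")
    case True
    then obtain c where c: "\<And>z. z \<in> S \<Longrightarrow> f z = c" unfolding constant_on_def by blast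
    then have "{z\<in>C. f z = 0} = {}" using c[OF z0(1)] z0(2) C by fastforce
    then show ?thesis by (simp only: finite.emptyI)
  next
    case False
    then show ?thesis using holomorphic_compact_finite_zeros[OF f S C] by simp
  qed
  then obtain h zs where h: "h holomorphic_on S" "set zs \<subseteq> {z\<in>C. f z = 0}"
    "\<And>s. s \<in> S \<Longrightarrow> f s = h s * (\<Prod>w\<leftarrow>zs. s - w)" "\<And>z. z \<in> {z\<in>C. f z = 0} \<Longrightarrow> h z \<noteq> 0"
    using holomorphic_split_off_zeros[OF f S z0 fin] C by blast
  have "h z \<noteq> 0" if "z \<in> C" for z
  proof (cases "f z = 0")
    case False
    moreover have "z \<in> S" using that C by auto
    ultimately show ?thesis using h(3)[of z] by auto
  qed (use h(4)[of z] that in simp)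
  with h show ?thesis using that by blast
qed

lemma higher_deriv_simple_fraction:
  assumes "z \<noteq> a"
  shows "(deriv ^^ k) (\<lambda>s. 1 / (s - a)) z = (-1) ^ k * fact k / (z - a :: complex) ^ Suc k"
  using assms
proof (induction k arbitrary: z)
  case (Suc k)
  have "\<forall>\<^sub>F w in nhds z. w \<in> - {a}" by (rule eventually_nhds_in_open) (use Suc.prems in auto)
  then have "\<forall>\<^sub>F w in nhds z. (deriv ^^ k) (\<lambda>s. 1 / (s - a)) w = (-1) ^ k * fact k / (w - a) ^ Suc k"
    by eventually_elim (rule Suc.IH, simp)
  then have "(deriv ^^ Suc k) (\<lambda>s. 1 / (s - a)) z = deriv (\<lambda>w. (-1) ^ k * fact k / (w - a) ^ Suc k) z"
    by (simp add: deriv_cong_ev del: power_Suc)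
  also have "\<dots> = (-1) ^ Suc k * fact (Suc k) / (z - a) ^ Suc (Suc k)"
  proof (rule DERIV_imp_deriv)
    have za: "z - a \<noteq> 0" using Suc.prems by simp
    have 1: "((\<lambda>w. (w - a) ^ Suc k) has_field_derivative of_nat (Suc k) * (z - a) ^ k) (at z)"
      by (auto intro!: derivative_eq_intros simp del: power_Suc)
    have 2: "(0 * (z - a) ^ Suc k - c * (of_nat (Suc k) * (z - a) ^ k)) / ((z - a) ^ Suc k * (z - a) ^ Suc k)
        = - c * of_nat (Suc k) / (z - a) ^ Suc (Suc k)" for c
      using za by (simp add: divide_simps)
    from DERIV_divide[OF DERIV_const 1, of "(-1) ^ k * fact k"] za
    have "((\<lambda>w. (-1) ^ k * fact k / (w - a) ^ Suc k) has_field_derivative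
        - ((-1) ^ k * fact k) * of_nat (Suc k) / (z - a) ^ Suc (Suc k)) (at z)"
      unfolding 2 by simp
    then show "((\<lambda>w. (-1) ^ k * fact k / (w - a) ^ Suc k) has_field_derivative
        (-1) ^ Suc k * fact (Suc k) / (z - a) ^ Suc (Suc k)) (at z)"
      by (simp add: mult_ac del: power_Suc of_nat_Suc add: power_Suc[of "-1"])
  qed
  finally show ?case .
qed simp

lemma higher_deriv_sum_list_fractions:
  assumes "z \<notin> set ws"
  shows "(deriv ^^ k) (\<lambda>s. \<Sum>w\<leftarrow>ws. 1 / (s - w)) z = (-1) ^ k * fact k * (\<Sum>w\<leftarrow>ws. 1 / (z - w :: complex) ^ Suc k)"
  using assms
proof (induction ws)
  case Nil
  then show ?case by (simp add: higher_deriv_const)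
next
  case (Cons w ws)
  let ?S = "- set (w # ws)"
  have op: "open ?S" by (intro open_Compl finite_imp_closed) auto
  have "(\<lambda>s. \<Sum>w\<leftarrow>ws. 1 / (s - w)) holomorphic_on ?S"
    by (induction ws) (auto intro!: holomorphic_intros)
  then have "(deriv ^^ k) (\<lambda>s. 1 / (s - w) + (\<Sum>w\<leftarrow>ws. 1 / (s - w))) z =
     (deriv ^^ k) (\<lambda>s. 1 / (s - w)) z + (deriv ^^ k) (\<lambda>s. \<Sum>w\<leftarrow>ws. 1 / (s - w)) z"
    by (intro higher_deriv_add[OF _ _ op] holomorphic_intros) (use Cons.prems in auto)
  then show ?case using Cons higher_deriv_simple_fraction[of z w k]
    by (simp add: algebra_simps del: power_Suc)
qed

lemma has_field_derivative_prod_list: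
  assumes "z \<notin> set ws"
  shows "((\<lambda>s. \<Prod>w\<leftarrow>ws. s - w) has_field_derivative (\<Prod>w\<leftarrow>ws. z - w) * (\<Sum>w\<leftarrow>ws. 1 / (z - w :: complex))) (at z)"
  using assms
proof (induction ws)
  case (Cons w ws)
  then have "((\<lambda>s. (s - w) * (\<Prod>w\<leftarrow>ws. s - w)) has_field_derivative
     (z - w) * ((\<Prod>w\<leftarrow>ws. z - w) * (\<Sum>w\<leftarrow>ws. 1 / (z - w))) + (1 - 0) * (\<Prod>w\<leftarrow>ws. z - w)) (at z)"
    by (intro DERIV_mult' DERIV_diff DERIV_ident DERIV_const) auto
  moreover have "(z - w) * (p * q) + (1 - 0) * p = (z - w) * p * (1 / (z - w) + q)" for p q
    using Cons.prems by (simp add: field_simps)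
  ultimately show ?case by simp
qed simp

lemma norm_prod_list: "norm (\<Prod>w\<leftarrow>ws. s - w :: complex) = (\<Prod>w\<leftarrow>ws. norm (s - w))"
  by (induction ws) (simp_all add: norm_mult)

lemma prod_list_mono_nonneg:
  fixes f g :: "'a \<Rightarrow> real"
  assumes "\<And>w. w \<in> set ws \<Longrightarrow> 0 \<le> f w \<and> f w \<le> g w"
  shows "0 \<le> (\<Prod>w\<leftarrow>ws. f w) \<and> (\<Prod>w\<leftarrow>ws. f w) \<le> (\<Prod>w\<leftarrow>ws. g w)"
  using assms
proof (induction ws)
  case (Cons w ws)
  then have "0 \<le> (\<Prod>w\<leftarrow>ws. f w)" "(\<Prod>w\<leftarrow>ws. f w) \<le> (\<Prod>w\<leftarrow>ws. g w)" "0 \<le> f w" "f w \<le> g w" by auto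
  then show ?case by (auto intro!: mult_mono mult_nonneg_nonneg)
qed simp

text \<open>
  Both sides are the logarithmic derivative of the same function, written in its two forms.
\<close>
lemma log_derivative_identity:
  assumes U: "open U" and P: "P holomorphic_on U" and H: "H holomorphic_on U"
    and nz: "\<And>s. s \<in> U \<Longrightarrow> s \<noteq> 1 \<and> s \<notin> set ws"
    and eq: "\<And>s. s \<in> U \<Longrightarrow> (s - 1) * exp (P s) = exp (H s) * (\<Prod>w\<leftarrow>ws. s - w)" and z: "z \<in> U"
  shows "1 / (z - 1) + deriv P z = deriv H z + (\<Sum>w\<leftarrow>ws. 1 / (z - w))"
proof -
  define G where "G s = exp (H s) * (\<Prod>w\<leftarrow>ws. s - w)" for s
  have dP: "(P has_field_derivative deriv P z) (at z)" and dH: "(H has_field_derivative deriv H z) (at z)"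
    using holomorphic_derivI[OF P U z] holomorphic_derivI[OF H U z] by auto
  have "z \<notin> set ws" using nz[OF z] by simp
  from DERIV_mult'[OF DERIV_chain2[OF DERIV_exp dH] has_field_derivative_prod_list[OF this]]
  have 1: "(G has_field_derivative G z * (deriv H z + (\<Sum>w\<leftarrow>ws. 1 / (z - w)))) (at z)"
    unfolding G_def by (simp add: algebra_simps)
  have "((\<lambda>s. (s - 1) * exp (P s)) has_field_derivative ((z - 1) * (exp (P z) * deriv P z) + (1 - 0) * exp (P z))) (at z)"
    by (intro DERIV_mult' DERIV_diff DERIV_ident DERIV_const DERIV_chain2[OF DERIV_exp dP])
  moreover have "(z - 1) * (exp (P z) * deriv P z) + (1 - 0) * exp (P z) = G z * (1 / (z - 1) + deriv P z)"
    using eq[OF z] nz[OF z] unfolding G_def by (simp add: field_simps flip: eq[OF z])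
  ultimately have "((\<lambda>s. (s - 1) * exp (P s)) has_field_derivative G z * (1 / (z - 1) + deriv P z)) (at z)" by simp
  then have 2: "(G has_field_derivative G z * (1 / (z - 1) + deriv P z)) (at z)"
    by (rule has_field_derivative_transform_within_open[OF _ U z]) (simp add: eq G_def)
  have "G z \<noteq> 0" using eq[OF z] nz[OF z] unfolding G_def by (metis exp_not_eq_zero mult_eq_0_iff right_minus_eq)
  then show ?thesis using DERIV_unique[OF 1 2] by simp
qed

text \<open>
  Split off from \<open>G\<close> all zeros in the disc of radius \<open>r\<close>, with the two distinguished ones listed explicitly so
  that a double zero is counted twice. On the circle of radius \<open>R \<ge> 2 r\<close> each factor \<open>s - w\<close> is at least as large
  as at the centre; hence the cofactor \<open>h\<close> inherits the growth bound \<open>M\<close> of \<open>G\<close> by the maximum principle, and the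
  Borel-Caratheodory bound applies to \<open>log h\<close>. Comparing derivatives of order \<open>j - 1\<close> of the two logarithmic
  derivatives of \<open>G\<close> gives the sum of \<open>1 / (s0 - w)^j\<close> over all zeros exactly; for even \<open>j\<close> its terms are
  nonnegative, and so is the contribution of \<open>P\<close>.
\<close>
lemma real_zeros_even_power_bound:
  fixes G K P :: "complex \<Rightarrow> complex" and \<beta>1 \<beta>2 \<eta> r R R' M :: real
  defines "s0 \<equiv> of_real (1 + \<eta>)"
  assumes K: "K holomorphic_on ball s0 R'"
    and G: "\<And>s. s \<in> ball s0 R' \<Longrightarrow> G s = (s - of_real \<beta>1) * (s - of_real \<beta>2) * K s"
    and \<beta>: "\<bar>1 + \<eta> - \<beta>1\<bar> \<le> r" "\<bar>1 + \<eta> - \<beta>2\<bar> \<le> r"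
    and R: "0 < \<eta>" "\<eta> \<le> r" "2 * r \<le> R" "R < R'"
    and real: "\<And>s. s \<in> cball s0 r \<Longrightarrow> K s = 0 \<Longrightarrow> s \<in> \<real>"
    and M: "\<And>s. s \<in> cball s0 R \<Longrightarrow> norm (G s) \<le> M * norm (G s0)" "M \<ge> 1"
    and P: "P holomorphic_on {s. Re s > 1}" "\<And>s. Re s > 1 \<Longrightarrow> s \<in> ball s0 R' \<Longrightarrow> G s = (s - 1) * exp (P s)"
    and Pj: "(deriv ^^ j) P s0 \<in> \<real>\<^sub>\<ge>\<^sub>0" and j: "even j" "j > 0"
  shows "1 / (1 + \<eta> - \<beta>1) ^ j + 1 / (1 + \<eta> - \<beta>2) ^ j \<le> 1 / \<eta> ^ j + 2 * real j * (ln M + 1) * (2 / r) ^ j"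
proof -
  have r: "r > 0" using R by linarith
  have Re0: "Re s0 > 1" using R by (simp add: s0_def)
  have s0: "s0 \<in> ball s0 R'" using R r by simp
  have G0: "G s0 \<noteq> 0" using P(2)[OF Re0 s0] R by (simp add: s0_def)
  then have K0: "K s0 \<noteq> 0" using G[OF s0] by auto
  have sub: "cball s0 r \<subseteq> ball s0 R'" using R r by auto
  obtain h zs where h: "h holomorphic_on ball s0 R'" and zs: "set zs \<subseteq> {z\<in>cball s0 r. K z = 0}"
    and Kh: "\<And>s. s \<in> ball s0 R' \<Longrightarrow> K s = h s * (\<Prod>w\<leftarrow>zs. s - w)" and hnz: "\<And>z. z \<in> cball s0 r \<Longrightarrow> h z \<noteq> 0"
    by (rule holomorphic_factor_zeros_compact[OF K open_ball connected_ball s0 K0 compact_cball sub]) (rule that, assumption+)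
  define ws where "ws = of_real \<beta>1 # of_real \<beta>2 # zs"
  have ws_real: "w \<in> \<real>" if "w \<in> set ws" for w using that zs real by (auto simp: ws_def)
  have ws_dist: "norm (s0 - w) \<le> r" if "w \<in> set ws" for w
  proof -
    have "norm (s0 - of_real b) = \<bar>1 + \<eta> - b\<bar>" for b
      unfolding s0_def by (metis norm_of_real of_real_diff)
    then show ?thesis using that zs \<beta> by (auto simp: ws_def dist_norm)
  qed
  have Gh: "G s = h s * (\<Prod>w\<leftarrow>ws. s - w)" if "s \<in> ball s0 R'" for s
    using G[OF that] Kh[OF that] by (simp add: ws_def)
  have subR: "cball s0 R \<subseteq> ball s0 R'" using R r by auto
  have hM: "norm (h s) \<le> M * norm (h s0)" if s: "s \<in> cball s0 R" for s
  proof (rule maximum_modulus_frontier[where S = "cball s0 R" and f = h])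
    show "h holomorphic_on interior (cball s0 R)"
      by (rule holomorphic_on_subset[OF h]) (use subR in auto)
    show "continuous_on (closure (cball s0 R)) h"
      by (rule holomorphic_on_imp_continuous_on, rule holomorphic_on_subset[OF h]) (use subR in auto)
    fix z assume "z \<in> frontier (cball s0 R)"
    then have z: "dist s0 z = R" "z \<in> cball s0 R" using R r by auto
    have "0 \<le> (\<Prod>w\<leftarrow>ws. norm (s0 - w)) \<and> (\<Prod>w\<leftarrow>ws. norm (s0 - w)) \<le> (\<Prod>w\<leftarrow>ws. norm (z - w))"
    proof (rule prod_list_mono_nonneg)
      fix w assume "w \<in> set ws"
      from ws_dist[OF this] show "0 \<le> norm (s0 - w) \<and> norm (s0 - w) \<le> norm (z - w)"
        using z R dist_triangle[of s0 z w] by (auto simp: dist_norm norm_minus_commute)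
    qed
    then have le: "norm (\<Prod>w\<leftarrow>ws. s0 - w) \<le> norm (\<Prod>w\<leftarrow>ws. z - w)" by (simp add: norm_prod_list)
    have pos: "norm (\<Prod>w\<leftarrow>ws. s0 - w) > 0" using Gh[OF s0] G0 by auto
    have "norm (h z) * norm (\<Prod>w\<leftarrow>ws. s0 - w) \<le> norm (h z) * norm (\<Prod>w\<leftarrow>ws. z - w)"
      by (intro mult_left_mono le) auto
    also have "\<dots> = norm (G z)" using Gh[of z] z subR by (auto simp: norm_mult)
    also have "\<dots> \<le> M * norm (G s0)" using M(1) z by blast
    also have "\<dots> = M * norm (h s0) * norm (\<Prod>w\<leftarrow>ws. s0 - w)" using Gh[OF s0] by (simp add: norm_mult)
    finally show "norm (h z) \<le> M * norm (h s0)" using pos by (simp add: mult_le_cancel_right)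
  qed (use s in auto)
  have h': "h holomorphic_on ball s0 r" by (rule holomorphic_on_subset[OF h]) (use sub in auto)
  obtain H where H: "H holomorphic_on ball s0 r" "\<And>s. s \<in> ball s0 r \<Longrightarrow> h s = exp (H s)"
  proof (rule contractible_imp_holomorphic_log[OF h' convex_imp_contractible[OF convex_ball]])
    show "h z \<noteq> 0" if "z \<in> ball s0 r" for z using hnz[of z] that by simp
  qed (rule that, assumption+)
  have s0r: "s0 \<in> ball s0 r" using r by simp
  have dH: "norm ((deriv ^^ j) (\<lambda>s. H s - H s0) s0) \<le> fact j * (2 * (ln M + 1)) * (2 / r) ^ j"
  proof (rule Borel_Caratheodory_higher_deriv[OF _ _ r _ j(2)])
    fix w assume w: "w \<in> ball s0 r"
    then have "w \<in> cball s0 R" using R r by auto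
    from hM[OF this] have "exp (Re (H w)) \<le> M * exp (Re (H s0))"
      unfolding H(2)[OF w] H(2)[OF s0r] norm_exp_eq_Re .
    also have "\<dots> = exp (ln M + Re (H s0))" using M(2) by (simp add: exp_add)
    finally show "Re (H w - H s0) < ln M + 1" by simp
  qed (use H in \<open>auto intro!: holomorphic_intros\<close>)
  have dH_eq: "(deriv ^^ j) (\<lambda>s. H s - H s0) s0 = (deriv ^^ j) H s0"
    using higher_deriv_diff[OF H(1) holomorphic_on_const open_ball s0r, of j "H s0"] j by simp
  \<comment> \<open>Both expressions for \<open>G\<close> are available on \<open>U\<close>, and \<open>G\<close> has no zero there because of the form \<open>(s - 1) * exp (P s)\<close>.\<close>
  define U where "U = ball s0 r \<inter> {s. Re s > 1}"
  have U: "open U" "s0 \<in> U" "U \<subseteq> ball s0 r" "U \<subseteq> {s. Re s > 1}" "U \<subseteq> ball s0 R'"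
    using s0r Re0 sub by (auto simp: U_def open_halfspace_Re_gt)
  have nz: "s \<noteq> 1 \<and> s \<notin> set ws" if "s \<in> U" for s
  proof
    have s: "Re s > 1" "s \<in> ball s0 R'" using that U by auto
    show ne: "s \<noteq> 1" using s by auto
    have "G s \<noteq> 0" using P(2)[OF s] ne by simp
    then show "s \<notin> set ws" using Gh[OF s(2)] by (auto simp: prod_list_zero_iff)
  qed
  have HU: "H holomorphic_on U" and PU: "P holomorphic_on U"
    using H(1) P(1) U holomorphic_on_subset by blast+
  have eqU: "(s - 1) * exp (P s) = exp (H s) * (\<Prod>w\<leftarrow>ws. s - w)" if "s \<in> U" for s
  proof -
    have s: "Re s > 1" "s \<in> ball s0 R'" "s \<in> ball s0 r" using that U by auto
    then show ?thesis using P(2)[OF s(1,2)] Gh[OF s(2)] H(2)[OF s(3)] by metis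
  qed
  obtain k where k: "j = Suc k" using j by (cases j) auto
  have odd: "odd k" using j k by simp
  have "(deriv ^^ k) (\<lambda>s. 1 / (s - 1) + deriv P s) s0 = (deriv ^^ k) (\<lambda>s. deriv H s + (\<Sum>w\<leftarrow>ws. 1 / (s - w))) s0"
  proof (rule higher_deriv_cong_ev[OF _ refl])
    show "\<forall>\<^sub>F s in nhds s0. 1 / (s - 1) + deriv P s = deriv H s + (\<Sum>w\<leftarrow>ws. 1 / (s - w))"
      using eventually_nhds_in_open[OF U(1,2)]
      by eventually_elim (rule log_derivative_identity[OF U(1) PU HU nz eqU])
  qed
  moreover have fr: "(\<lambda>s. 1 / (s - 1)) holomorphic_on U" "(\<lambda>s. \<Sum>w\<leftarrow>ws. 1 / (s - w)) holomorphic_on U"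
  proof -
    show "(\<lambda>s. 1 / (s - 1)) holomorphic_on U" using nz by (intro holomorphic_intros) auto
    have "(\<lambda>s. \<Sum>w\<leftarrow>ws'. 1 / (s - w)) holomorphic_on U" if "set ws' \<subseteq> set ws" for ws'
      using that by (induction ws') (use nz in \<open>auto intro!: holomorphic_intros\<close>)
    then show "(\<lambda>s. \<Sum>w\<leftarrow>ws. 1 / (s - w)) holomorphic_on U" by simp
  qed
  moreover have "(deriv ^^ k) (\<lambda>s. 1 / (s - 1) + deriv P s) s0 = (deriv ^^ k) (\<lambda>s. 1 / (s - 1)) s0 + (deriv ^^ k) (deriv P) s0"
    by (rule higher_deriv_add[OF fr(1) _ U(1,2)]) (intro holomorphic_deriv PU U)
  moreover have "(deriv ^^ k) (\<lambda>s. deriv H s + (\<Sum>w\<leftarrow>ws. 1 / (s - w))) s0 = (deriv ^^ k) (deriv H) s0 + (deriv ^^ k) (\<lambda>s. \<Sum>w\<leftarrow>ws. 1 / (s - w)) s0"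
    by (rule higher_deriv_add[OF _ fr(2) U(1,2)]) (intro holomorphic_deriv HU U)
  moreover have "(deriv ^^ k) (deriv Q) = (deriv ^^ j) Q" for Q :: "complex \<Rightarrow> complex"
    unfolding k by (simp add: funpow_swap1)
  ultimately have id: "- (fact k / (s0 - 1) ^ j) + (deriv ^^ j) P s0 =
      (deriv ^^ j) H s0 - fact k * (\<Sum>w\<leftarrow>ws. 1 / (s0 - w) ^ j)"
    using higher_deriv_simple_fraction[of s0 1 k] higher_deriv_sum_list_fractions[of s0 ws k] nz[OF U(2)] odd
    unfolding k by (simp del: power_Suc)
  define S where "S = (\<Sum>w\<leftarrow>ws. 1 / (1 + \<eta> - Re w) ^ j)"
  have "(\<Sum>w\<leftarrow>ws'. 1 / (s0 - w) ^ j) = of_real (\<Sum>w\<leftarrow>ws'. 1 / (1 + \<eta> - Re w) ^ j)" if "set ws' \<subseteq> set ws" for ws'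
    using that
  proof (induction ws')
    case (Cons w ws')
    then have "w = of_real (Re w)" using ws_real[of w] by (simp add: complex_is_Real_iff complex_eq_iff)
    then have "1 / (s0 - w) ^ j = of_real (1 / (1 + \<eta> - Re w) ^ j)" unfolding s0_def
      by (metis of_real_1 of_real_diff of_real_divide of_real_power)
    then show ?case using Cons by simp
  qed simp
  then have S: "(\<Sum>w\<leftarrow>ws. 1 / (s0 - w) ^ j) = of_real S" by (simp add: S_def)
  have "s0 - 1 = of_real \<eta>" by (simp add: s0_def)
  then have "fact k * (of_real S :: complex) = of_real (fact k / \<eta> ^ j) + (deriv ^^ j) H s0 - (deriv ^^ j) P s0"
    using id unfolding S by (simp add: algebra_simps)
  from arg_cong[OF this, of Re]
  have "fact k * S = fact k / \<eta> ^ j + Re ((deriv ^^ j) H s0) - Re ((deriv ^^ j) P s0)"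
    by simp
  also have "\<dots> \<le> fact k / \<eta> ^ j + fact j * (2 * (ln M + 1)) * (2 / r) ^ j"
    using dH dH_eq complex_Re_le_cmod[of "(deriv ^^ j) H s0"] Pj by (auto simp: complex_nonneg_Reals_iff)
  also have "\<dots> = fact k * (1 / \<eta> ^ j + 2 * real j * (ln M + 1) * (2 / r) ^ j)"
    unfolding k by (simp add: algebra_simps)
  finally have "S \<le> 1 / \<eta> ^ j + 2 * real j * (ln M + 1) * (2 / r) ^ j"
    by (simp add: mult_le_cancel_left)
  moreover have "0 \<le> (\<Sum>w\<leftarrow>zs. 1 / (1 + \<eta> - Re w) ^ j)"
    by (rule sum_list_nonneg) (use j in \<open>auto intro!: divide_nonneg_nonneg zero_le_even_power\<close>)
  ultimately show ?thesis by (simp add: S_def ws_def)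
qed

section \<open>Repulsion of exceptional characters\<close>

lemma quadratic_dirichlet_gt_1:
  assumes "quadratic_dirichlet q \<chi>"
  shows "q > 1"
proof (rule ccontr)
  assume "\<not> q > 1"
  have D: "dirichlet_character q \<chi>" using assms by (simp add: quadratic_dirichlet_def)
  with \<open>\<not> q > 1\<close> have "q = 1" using dirichlet_characterD(1)[OF D] by simp
  then have "\<chi> n = 1" for n
    using dirichlet_character_cong[OF D, of n 1] dirichlet_characterD(6)[OF D] by (simp add: cong_def)
  then show False using assms by (auto simp: quadratic_dirichlet_def quadratic_character_def)
qed

lemma dirichlet_L_zero_le_1:
  assumes "quadratic_dirichlet q \<chi>" "dirichlet_L \<chi> (of_real \<beta>) = 0"
  shows "\<beta> \<le> 1"
  using dirichlet_L_quadratic(2)[OF assms(1), of "of_real \<beta>"] assms(2) by (cases "\<beta> \<le> 1") auto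

lemma entire_factor_zero:
  assumes f: "f holomorphic_on UNIV" and z: "f z = 0" and z0: "f z0 \<noteq> 0"
  obtains g where "g holomorphic_on UNIV" "\<And>s. f s = (s - z) * g s"
proof -
  obtain g n where g: "g holomorphic_on UNIV" "\<And>s. f s = (s - z) ^ n * g s" "g z \<noteq> 0"
    using holomorphic_split_off_zero[OF f open_UNIV connected_UNIV UNIV_I UNIV_I z0, of z] by (metis UNIV_I)
  have "n \<noteq> 0" using g(2)[of z] g(3) z by (auto intro: ccontr)
  then obtain m where "n = Suc m" by (cases n) auto
  with g show ?thesis by (intro that[of "\<lambda>s. (s - z) ^ m * g s"]) (auto intro!: holomorphic_intros)
qed

lemma induced_zeros_real:
  assumes \<chi>: "quadratic_dirichlet q \<chi>"
    and H: "\<And>d \<psi>. primitive_character d \<psi> \<Longrightarrow> real_character \<psi> \<Longrightarrow> 1 < d \<Longrightarrow> d \<le> q \<Longrightarrow> dirichlet_L \<psi> s = 0 \<Longrightarrow> s \<in> \<real>"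
    and s: "Re s > 0" "dirichlet_L \<chi> s = 0"
  shows "s \<in> \<real>"
proof -
  obtain d \<psi> where d: "d dvd q" "primitive_character d \<psi>" "quadratic_dirichlet d \<psi>"
    "\<And>n. \<chi> n = (if coprime n q then \<psi> n else 0)"
    by (rule primitive_inducing_character[OF \<chi>]) (rule that, assumption+)
  have "d \<le> q" using d(1) quadratic_dirichlet_gt_1[OF \<chi>] by (intro dvd_imp_le) auto
  moreover have "dirichlet_L \<psi> s = 0" by (rule dirichlet_L_induced_zero[OF \<chi> d(3,4) s])
  ultimately show ?thesis
    using H[OF d(2)] quadratic_dirichlet_real(4)[OF d(3)] quadratic_dirichlet_gt_1[OF d(3)] by blast
qed

text \<open>
  In the negation of the conclusion the right-hand side of \<open>real_zeros_even_power_bound\<close>, multiplied by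
  \<open>\<eta>^j\<close>, is below \<open>3/2\<close>. The condition on \<open>\<delta>\<close> keeps each of the two terms on the left at least \<open>3/4\<close>.
  The radius \<open>\<rho>\<close> accounts for the zeros of \<open>\<zeta>\<close>, which stay away from 1.
\<close>
lemma exceptional_repulsion:
  obtains \<rho> K :: real where "0 < \<rho>" "K \<ge> 1"
   "\<And>q1 \<chi>1 q2 \<chi>2 (r :: real) (\<delta> :: real) (\<beta>1 :: real) (\<beta>2 :: real) (j :: nat).
      primitive_character q1 \<chi>1 \<Longrightarrow> primitive_character q2 \<chi>2 \<Longrightarrow>
      quadratic_dirichlet q1 \<chi>1 \<Longrightarrow> quadratic_dirichlet q2 \<chi>2 \<Longrightarrow>
      (q1, \<chi>1) \<noteq> (q2, \<chi>2) \<Longrightarrow> q1 \<le> q2 \<Longrightarrow> 0 < r \<Longrightarrow> r \<le> \<rho> \<Longrightarrow>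
      \<forall>d \<psi> s. primitive_character d \<psi> \<and> real_character \<psi> \<and> 1 < d \<and> d \<le> q1 * q2 \<and>
          norm (s - 1) < 2 * r \<and> dirichlet_L \<psi> s = 0 \<longrightarrow> s \<in> \<real> \<Longrightarrow>
      dirichlet_L \<chi>1 (of_real \<beta>1) = 0 \<Longrightarrow> dirichlet_L \<chi>2 (of_real \<beta>2) = 0 \<Longrightarrow>
      \<beta>1 \<ge> 1 - \<delta> \<Longrightarrow> \<beta>2 \<ge> 1 - \<delta> \<Longrightarrow> even j \<Longrightarrow> j > 0 \<Longrightarrow> 64 * real j * \<delta> \<le> r \<Longrightarrow>
      8 ^ j \<le> 4 * real j * (ln (K * real q2 ^ 4 / r) + 1)"
proof -
  obtain Z where Z: "Z holomorphic_on {s. Re s > 0}" "Z 1 = 1"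
    "\<And>s. Re s > 1 \<Longrightarrow> (\<lambda>n. 1 / of_nat (Suc n) powr s) sums (Z s / (s - 1))"
    by (rule zeta_continuation) (rule that, assumption+)
  have Zexp: "Z s = (s - 1) * exp (euler_log (\<lambda>_. 1) s)" if "Re s > 1" for s
  proof -
    have "completely_multiplicative (\<lambda>_. 1)" by (simp add: completely_multiplicative_def)
    from sums_unique2[OF Z(3)[OF that] dirichlet_series_eq_exp[OF this that]] that
    show ?thesis by (auto simp: divide_simps split: if_splits)
  qed
  have Zcont: "continuous_on {s. Re s > 0} Z" by (rule holomorphic_on_imp_continuous_on[OF Z(1)])
  have "\<exists>e>0. \<forall>y. dist 1 y < e \<longrightarrow> Z y \<noteq> 0"
    by (rule continuous_at_avoid) (use Zcont Z(2) in \<open>auto simp: continuous_on_eq_continuous_at open_halfspace_Re_gt\<close>)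
  then obtain e where e: "e > 0" "\<And>y. dist 1 y < e \<Longrightarrow> Z y \<noteq> 0" by blast
  define \<rho> where "\<rho> = min (e / 2) (1 / 16)"
  have subZ: "cball 1 (1/2) \<subseteq> {s. Re s > 0}"
  proof
    fix s :: complex assume "s \<in> cball 1 (1/2)"
    then show "s \<in> {s. Re s > 0}" using abs_Re_le_cmod[of "1 - s"] by (auto simp: dist_norm)
  qed
  have "compact (Z ` cball 1 (1/2))"
    by (intro compact_continuous_image continuous_on_subset[OF Zcont] subZ compact_cball)
  then obtain B where B: "\<And>s. s \<in> cball 1 (1/2) \<Longrightarrow> norm (Z s) \<le> B"
    by (meson bounded_iff compact_imp_bounded imageI)
  define \<kappa> where "\<kappa> = 2 * (\<Sum>n. real (Suc n) powr (-3/2))"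
  have \<kappa>: "\<kappa> \<ge> 0" unfolding \<kappa>_def by (intro mult_nonneg_nonneg suminf_nonneg summable_Suc_powr) auto
  have B0: "B \<ge> 0" using order_trans[OF norm_ge_zero B[of 1]] by simp
  define K where "K = max 1 (16 * B * \<kappa> ^ 3)"
  have K: "K \<ge> 1" "16 * B * \<kappa> ^ 3 \<le> K" by (auto simp: K_def)
  have \<rho>: "0 < \<rho>" "\<rho> \<le> 1" "\<rho> \<le> 1 / 16" "2 * \<rho> \<le> e" using e(1) by (auto simp: \<rho>_def)
  have main: "8 ^ j \<le> 4 * real j * (ln (K * real q2 ^ 4 / r) + 1)"
    if p: "primitive_character q1 \<chi>1" "primitive_character q2 \<chi>2"
      and c1: "quadratic_dirichlet q1 \<chi>1" and c2: "quadratic_dirichlet q2 \<chi>2"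
      and ne: "(q1, \<chi>1) \<noteq> (q2, \<chi>2)" and q: "q1 \<le> q2" and r: "0 < r" "r \<le> \<rho>"
      and H: "\<forall>d \<psi> s. primitive_character d \<psi> \<and> real_character \<psi> \<and> 1 < d \<and> d \<le> q1 * q2 \<and>
          norm (s - 1) < 2 * r \<and> dirichlet_L \<psi> s = 0 \<longrightarrow> s \<in> \<real>"
      and \<beta>: "dirichlet_L \<chi>1 (of_real \<beta>1) = 0" "dirichlet_L \<chi>2 (of_real \<beta>2) = 0"
      and \<delta>: "\<beta>1 \<ge> 1 - \<delta>" "\<beta>2 \<ge> 1 - \<delta>" and j: "even j" "j > 0" "64 * real j * \<delta> \<le> r"
    for q1 \<chi>1 q2 \<chi>2 and r \<delta> \<beta>1 \<beta>2 :: real and j :: nat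
  proof -
    define \<eta> where "\<eta> = r / 16"
    have \<eta>: "0 < \<eta>" "\<eta> \<le> 1 / 256" "\<eta> \<le> r" "r = 16 * \<eta>" using r \<rho> by (auto simp: \<eta>_def)
    define s0 :: complex where "s0 = of_real (1 + \<eta>)"
    define \<chi> where "\<chi> n = \<chi>1 n * \<chi>2 n" for n
    have c: "quadratic_dirichlet (q1 * q2) \<chi>"
      unfolding \<chi>_def[abs_def] by (rule quadratic_dirichlet_product[OF p c1 c2 ne])
    note q1 = quadratic_dirichlet_gt_1[OF c1] and q2 = quadratic_dirichlet_gt_1[OF c2]
    define P where "P s = euler_log (\<lambda>_. 1) s + euler_log \<chi>1 s + euler_log \<chi>2 s + euler_log \<chi> s" for s
    have "even_derivs_nonneg P"
      using even_derivs_nonneg_euler_logs[OF quadratic_dirichlet_real(2)[OF c1] quadratic_dirichlet_real(2)[OF c2]]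
      unfolding quadratic_dirichlet_real(1)[OF c1, symmetric] quadratic_dirichlet_real(1)[OF c2, symmetric]
        P_def[abs_def] \<chi>_def[abs_def] .
    then have P: "P holomorphic_on {s. Re s > 1}" "\<And>j. even j \<Longrightarrow> (deriv ^^ j) P s0 \<in> \<real>\<^sub>\<ge>\<^sub>0"
      using \<eta>(1) unfolding even_derivs_nonneg_def s0_def by (simp_all del: of_real_add)
    define G where "G s = Z s * dirichlet_L \<chi>1 s * dirichlet_L \<chi>2 s * dirichlet_L \<chi> s" for s
    have GP: "G s = (s - 1) * exp (P s)" if "Re s > 1" for s
      unfolding G_def P_def dirichlet_L_quadratic(2)[OF c1 that] dirichlet_L_quadratic(2)[OF c2 that]
        dirichlet_L_quadratic(2)[OF c that] Zexp[OF that] by (simp add: exp_add)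
    have nz2: "dirichlet_L \<chi>1 2 \<noteq> 0" "dirichlet_L \<chi>2 2 \<noteq> 0"
      using dirichlet_L_quadratic(2)[OF c1, of 2] dirichlet_L_quadratic(2)[OF c2, of 2] by auto
    obtain g1 where g1: "g1 holomorphic_on UNIV" "\<And>s. dirichlet_L \<chi>1 s = (s - of_real \<beta>1) * g1 s"
      by (rule entire_factor_zero[OF dirichlet_L_quadratic(1)[OF c1] \<beta>(1) nz2(1)]) (rule that, assumption+)
    obtain g2 where g2: "g2 holomorphic_on UNIV" "\<And>s. dirichlet_L \<chi>2 s = (s - of_real \<beta>2) * g2 s"
      by (rule entire_factor_zero[OF dirichlet_L_quadratic(1)[OF c2] \<beta>(2) nz2(2)]) (rule that, assumption+)
    define k where "k s = Z s * g1 s * g2 s * dirichlet_L \<chi> s" for s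
    have near: "norm (s - 1) < 1 / 2 + 1 / 256" if "s \<in> ball s0 (1/2)" for s
    proof -
      have "norm (s - 1) \<le> norm (s - s0) + norm (s0 - 1)" by norm
      also have "norm (s0 - 1) = \<eta>" using \<eta> by (simp add: s0_def)
      finally show ?thesis using that \<eta> by (simp add: dist_norm norm_minus_commute)
    qed
    have Rep: "Re s > 0" if "s \<in> ball s0 (1/2)" for s
      using near[OF that] abs_Re_le_cmod[of "s - 1"] by auto
    have b1: "\<beta>1 \<le> 1" "\<beta>2 \<le> 1"
      using dirichlet_L_zero_le_1[OF c1 \<beta>(1)] dirichlet_L_zero_le_1[OF c2 \<beta>(2)] by auto
    have \<delta>0: "\<delta> \<ge> 0" using b1 \<delta> by linarith
    have "64 * 1 * \<delta> \<le> 64 * real j * \<delta>" using j \<delta>0 by (intro mult_right_mono) auto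
    then have \<delta>r: "64 * \<delta> \<le> r" using j by linarith
    define M where "M = K * real q2 ^ 4 / r"
    have "1 / (1 + \<eta> - \<beta>1) ^ j + 1 / (1 + \<eta> - \<beta>2) ^ j \<le> 1 / \<eta> ^ j + 2 * real j * (ln M + 1) * (2 / r) ^ j"
    proof (rule real_zeros_even_power_bound[where K = k and G = G and P = P and R = "1/4" and R' = "1/2"], fold s0_def)
      show "k holomorphic_on ball s0 (1/2)"
        unfolding k_def using Rep
        by (intro holomorphic_intros holomorphic_on_subset[OF Z(1)] holomorphic_on_subset[OF g1(1)]
            holomorphic_on_subset[OF g2(1)] holomorphic_on_subset[OF dirichlet_L_quadratic(1)[OF c]]) auto
      show "G s = (s - of_real \<beta>1) * (s - of_real \<beta>2) * k s" for s
        unfolding G_def k_def g1(2) g2(2) by (simp add: mult_ac)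
      show "\<bar>1 + \<eta> - \<beta>1\<bar> \<le> r" "\<bar>1 + \<eta> - \<beta>2\<bar> \<le> r" using b1 \<delta> \<delta>r \<eta> by auto
      show "0 < \<eta>" "\<eta> \<le> r" "2 * r \<le> 1 / 4" "1 / 4 < (1 / 2 :: real)" using \<eta> r \<rho> by auto
      show "s \<in> \<real>" if s: "s \<in> cball s0 r" "k s = 0" for s
      proof -
        have "norm (s - 1) \<le> norm (s - s0) + norm (s0 - 1)" by norm
        also have "norm (s0 - 1) = \<eta>" using \<eta> by (simp add: s0_def)
        finally have s1: "norm (s - 1) < 2 * r" using s \<eta> by (simp add: dist_norm norm_minus_commute)
        have "2 * r \<le> 1 / 8" using r \<rho> by linarith
        then have Re: "Re s > 0" using s1 abs_Re_le_cmod[of "s - 1"] by auto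
        have "dist 1 s < e" using s1 r \<rho> by (simp add: dist_norm norm_minus_commute)
        then have "Z s \<noteq> 0" by (rule e(2))
        then have "dirichlet_L \<chi>1 s = 0 \<or> dirichlet_L \<chi>2 s = 0 \<or> dirichlet_L \<chi> s = 0"
          using s(2) g1(2) g2(2) by (auto simp: k_def)
        then show ?thesis
        proof (elim disjE)
          assume "dirichlet_L \<chi>1 s = 0"
          moreover have "q1 \<le> q1 * q2" using q2 by simp
          ultimately show ?thesis using H p(1) quadratic_dirichlet_real(4)[OF c1] q1 s1 by blast
        next
          assume "dirichlet_L \<chi>2 s = 0"
          moreover have "q2 \<le> q1 * q2" using q1 by simp
          ultimately show ?thesis using H p(2) quadratic_dirichlet_real(4)[OF c2] q2 s1 by blast
        next
          assume "dirichlet_L \<chi> s = 0"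
          then show ?thesis using induced_zeros_real[OF c _ Re] H s1 by blast
        qed
      qed
      \<comment> \<open>The even derivative of order 0 gives \<open>Re (P s0) \<ge> 0\<close>.\<close>
      have G0: "norm (G s0) \<ge> \<eta>"
      proof -
        have "Re s0 > 1" using \<eta> by (simp add: s0_def)
        then have "norm (G s0) = \<eta> * exp (Re (P s0))"
          using GP[of s0] \<eta> by (simp add: norm_mult norm_exp_eq_Re s0_def)
        moreover have "Re (P s0) \<ge> 0" using P(2)[of 0] by (simp add: complex_nonneg_Reals_iff)
        ultimately show ?thesis using \<eta> by (simp add: mult_le_cancel_left1)
      qed
      show "norm (G s) \<le> M * norm (G s0)" if s: "s \<in> cball s0 (1/4)" for s
      proof -
        have "norm (s - 1) \<le> norm (s - s0) + norm (s0 - 1)" by norm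
        also have "norm (s0 - 1) = \<eta>" using \<eta> by (simp add: s0_def)
        finally have s1: "norm (s - 1) \<le> 1 / 2" using s \<eta> by (simp add: dist_norm norm_minus_commute)
        then have Re: "Re s \<ge> 1 / 2" using abs_Re_le_cmod[of "s - 1"] by auto
        have s2: "norm s \<le> 2" using s1 norm_triangle_sub[of s 1] by simp
        have L: "norm (dirichlet_L \<phi> s) \<le> q * \<kappa>" if "quadratic_dirichlet q \<phi>" for q \<phi>
        proof -
          have "norm (dirichlet_L \<phi> s) \<le> q * norm s * (\<Sum>n. real (Suc n) powr (-3/2))"
            by (rule dirichlet_L_quadratic(3)[OF that Re])
          also have "\<dots> \<le> real q * 2 * (\<Sum>n. real (Suc n) powr (-3/2))"
            using \<kappa> by (intro mult_right_mono[OF mult_left_mono[OF s2]]) (simp_all add: \<kappa>_def)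
          finally show ?thesis by (simp add: \<kappa>_def)
        qed
        have Zs: "norm (Z s) \<le> B" by (rule B) (use s1 in \<open>simp add: dist_norm norm_minus_commute\<close>)
        have "norm (G s) \<le> B * (q1 * \<kappa>) * (q2 * \<kappa>) * (real (q1 * q2) * \<kappa>)"
          unfolding G_def norm_mult
          by (intro mult_mono Zs L c1 c2 c mult_nonneg_nonneg) (use B0 \<kappa> in auto)
        also have "\<dots> = (B * \<kappa> ^ 3) * (real q1 ^ 2 * real q2 ^ 2)"
          by (simp add: power2_eq_square power3_eq_cube)
        also have "\<dots> \<le> (B * \<kappa> ^ 3) * (real q2 ^ 2 * real q2 ^ 2)"
          using B0 \<kappa> q by (intro mult_left_mono mult_right_mono power_mono) auto
        also have "\<dots> = 16 * B * \<kappa> ^ 3 * real q2 ^ 4 / r * \<eta>"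
          using \<eta> by (simp add: power2_eq_square power4_eq_xxxx)
        also have "\<dots> \<le> M * \<eta>"
          unfolding M_def using K \<eta> r by (intro mult_right_mono divide_right_mono) auto
        also have "\<dots> \<le> M * norm (G s0)"
          using K r G0 by (intro mult_left_mono) (auto simp: M_def)
        finally show ?thesis .
      qed
      show "M \<ge> 1"
      proof -
        have "1 \<le> real q2 ^ 4" using q2 by simp
        then have "1 * 1 \<le> K * real q2 ^ 4" using K by (intro mult_mono) auto
        then show ?thesis unfolding M_def using r \<rho> by (simp add: le_divide_eq)
      qed
    qed (use P GP j in auto)
    then have "(1 / (1 + \<eta> - \<beta>1) ^ j + 1 / (1 + \<eta> - \<beta>2) ^ j) * \<eta> ^ j \<le>
        (1 / \<eta> ^ j + 2 * real j * (ln M + 1) * (2 / r) ^ j) * \<eta> ^ j"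
      using \<eta> by (intro mult_right_mono) auto
    moreover have "(1 / \<eta> ^ j + 2 * real j * (ln M + 1) * (2 / r) ^ j) * \<eta> ^ j = 1 + 2 * real j * (ln M + 1) / 8 ^ j"
    proof -
      have "(2 / r) ^ j * \<eta> ^ j = (1 / 8) ^ j" using \<eta> by (simp flip: power_mult_distrib)
      then have "2 * real j * (ln M + 1) * (2 / r) ^ j * \<eta> ^ j = 2 * real j * (ln M + 1) * (1 / 8) ^ j" by (simp only: mult.assoc)
      then show ?thesis using \<eta> by (simp add: distrib_right power_divide)
    qed
    moreover have "3 / 4 \<le> 1 / (1 + \<eta> - b) ^ j * \<eta> ^ j" if b: "1 - \<delta> \<le> b" "b \<le> 1" for b
    proof -
      have j\<delta>: "j * (\<delta> / \<eta>) \<le> 1 / 4" using j(3) \<eta> by (simp add: field_simps)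
      have \<delta>\<eta>: "\<delta> \<le> \<eta>" using \<delta>r \<eta> by simp
      have "3 / 4 \<le> 1 + j * (- (\<delta> / \<eta>))" using j\<delta> by simp
      also have "\<dots> \<le> (1 + - (\<delta> / \<eta>)) ^ j"
        by (rule Bernoulli_inequality) (use \<delta>\<eta> \<eta> in \<open>simp add: divide_simps\<close>)
      also have "\<dots> \<le> (\<eta> / (1 + \<eta> - b)) ^ j"
      proof (rule power_mono)
        have "(1 - \<delta> / \<eta>) * (1 + \<eta> - b) \<le> (1 - \<delta> / \<eta>) * (\<eta> + \<delta>)"
          using b \<delta>\<eta> \<eta> by (intro mult_left_mono) (auto simp: divide_simps)
        also have "\<dots> = \<eta> - \<delta> * \<delta> / \<eta>" using \<eta> by (simp add: field_simps)
        also have "\<dots> \<le> \<eta>" using \<eta> by simp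
        finally show "1 + - (\<delta> / \<eta>) \<le> \<eta> / (1 + \<eta> - b)" using b \<eta> by (simp add: le_divide_eq)
        show "0 \<le> 1 + - (\<delta> / \<eta>)" using \<delta>\<eta> \<eta> by (simp add: divide_simps)
      qed
      finally show ?thesis by (simp add: power_divide)
    qed
    from this[OF \<delta>(1) b1(1)] this[OF \<delta>(2) b1(2)]
    have "3 / 2 \<le> (1 / (1 + \<eta> - \<beta>1) ^ j + 1 / (1 + \<eta> - \<beta>2) ^ j) * \<eta> ^ j" unfolding distrib_right by linarith
    ultimately have "1 / 2 \<le> 2 * real j * (ln M + 1) / 8 ^ j" by linarith
    then show ?thesis by (simp add: le_divide_eq M_def)
  qed
  show ?thesis by (rule that[OF \<rho>(1) K(1) main])
qed

section \<open>Asymptotics and counting\<close>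

lemma finite_quadratic_dirichlet: "finite {(q, \<chi>). quadratic_dirichlet q \<chi> \<and> real q \<le> Q}"
proof (rule finite_subset)
  let ?F = "\<lambda>q. (\<lambda>g. (q, \<lambda>n. g (n mod q))) ` ({..<q} \<rightarrow>\<^sub>E {-1, 0, 1 :: complex})"
  show "{(q, \<chi>). quadratic_dirichlet q \<chi> \<and> real q \<le> Q} \<subseteq> (\<Union>q\<le>nat \<lfloor>Q\<rfloor>. ?F q)"
  proof (clarify, rule UN_I)
    fix q \<chi> assume \<chi>: "quadratic_dirichlet q \<chi>" and q: "real q \<le> Q"
    show "q \<in> {..nat \<lfloor>Q\<rfloor>}" using q by (simp add: le_nat_floor)
    have q0: "q > 0" using quadratic_dirichlet_gt_1[OF \<chi>] by simp
    have D: "dirichlet_character q \<chi>" using \<chi> by (simp add: quadratic_dirichlet_def)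
    have "\<chi> = (\<lambda>n. restrict \<chi> {..<q} (n mod q))"
      using periodic_mod[where a = \<chi> and q = q, OF dirichlet_characterD(3)[OF D]] q0 by (auto simp: fun_eq_iff)
    moreover have "restrict \<chi> {..<q} \<in> {..<q} \<rightarrow>\<^sub>E {-1, 0, 1}"
      using quadratic_dirichlet_values[OF \<chi>] by (intro restrict_PiE_iff[THEN iffD2]) blast
    ultimately show "(q, \<chi>) \<in> ?F q" by (intro image_eqI[of _ _ "restrict \<chi> {..<q}"]) simp_all
  qed
  show "finite (\<Union>q\<le>nat \<lfloor>Q\<rfloor>. ?F q)"
    by (intro finite_UN_I finite_imageI finite_PiE) auto
qed

lemma card_doubling_bound:
  fixes g :: "'a \<Rightarrow> real"
  assumes fin: "finite S" and g: "\<And>a. a \<in> S \<Longrightarrow> 1 \<le> g a \<and> g a \<le> X" and X: "X \<ge> 1"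
    and double: "\<And>a b. a \<in> S \<Longrightarrow> b \<in> S \<Longrightarrow> a \<noteq> b \<Longrightarrow> 2 * g a \<le> g b \<or> 2 * g b \<le> g a"
  shows "real (card S) \<le> 1 + log 2 X"
proof -
  define h where "h a = \<lfloor>log 2 (g a)\<rfloor>" for a
  have step: "h a + 1 \<le> h b" if "a \<in> S" "b \<in> S" "2 * g a \<le> g b" for a b
  proof -
    have "log 2 (g a) + 1 = log 2 (2 * g a)" using g[OF that(1)] by (simp add: log_mult)
    also have "\<dots> \<le> log 2 (g b)" using g[OF that(1)] g[OF that(2)] that(3) by simp
    finally show ?thesis unfolding h_def by linarith
  qed
  have "inj_on h S"
  proof (rule inj_onI, rule ccontr)
    fix a b assume "a \<in> S" "b \<in> S" "h a = h b" "a \<noteq> b"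
    then show False using double[of a b] step[of a b] step[of b a] by auto
  qed
  moreover have "h ` S \<subseteq> {0..\<lfloor>log 2 X\<rfloor>}"
  proof clarify
    fix a assume "a \<in> S"
    then have "0 \<le> log 2 (g a)" "log 2 (g a) \<le> log 2 X" using g[of a] by auto
    then show "h a \<in> {0..\<lfloor>log 2 X\<rfloor>}" unfolding h_def by (auto intro: floor_mono)
  qed
  ultimately have "card S \<le> card {0..\<lfloor>log 2 X\<rfloor>}" by (intro card_inj_on_le) auto
  also have "\<dots> = nat (\<lfloor>log 2 X\<rfloor> + 1)" by simp
  finally have "real (card S) \<le> real (nat (\<lfloor>log 2 X\<rfloor> + 1))" by simp
  moreover have "0 \<le> log 2 X" using X by simp
  ultimately show ?thesis by linarith
qed

text \<open>
  The left-hand side is linear in \<open>A\<close> up to a logarithm, while \<open>8 ^ j\<close> is at least \<open>A ^ 4\<close>.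
\<close>
lemma power_8_beats:
  assumes A: "A \<ge> 1"
  shows "4 * real (2 * nat \<lceil>ln A\<rceil> + 4) * A < 8 ^ (2 * nat \<lceil>ln A\<rceil> + 4)"
proof -
  define j where "j = 2 * nat \<lceil>ln A\<rceil> + 4"
  have lnA: "ln A \<ge> 0" using A by simp
  then have j: "real j \<ge> ln A + 4" unfolding j_def by linarith
  have "(1 :: real) + 3 \<le> exp 3" by (rule exp_ge_add_one_self)
  then have "4 * A \<le> exp 3 * exp (ln A)" using A by (intro mult_mono) auto
  also have "\<dots> = exp (ln A + 3)" by (simp add: exp_add)
  also have "\<dots> < exp (real j)" using j by simp
  also have "\<dots> = exp 1 ^ j" by (simp flip: exp_of_nat_mult)
  also have "\<dots> \<le> 4 ^ j" by (rule power_mono) (use exp_le in auto)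
  finally have "4 * A < 4 ^ j" .
  moreover have "real j < 2 ^ j" by (rule of_nat_less_two_power)
  ultimately have "real j * (4 * A) < 2 ^ j * 4 ^ j"
    using A by (intro mult_strict_mono) auto
  then show ?thesis unfolding j_def[symmetric] by (simp add: mult_ac flip: power_mult_distrib)
qed

text \<open>
  With \<open>x = ln y\<close> and \<open>\<nu> (y\<^sup>2) < 1/8\<close> one has \<open>f (y\<^sup>2) \<le> (2 x) powr (1/8)\<close>, and \<open>j\<close> is logarithmic in \<open>x\<close>; so the
  product \<open>j * f (y\<^sup>2)\<close> stays below \<open>sqrt x\<close>.
\<close>
lemma eventually_exponent_choice:
  fixes \<nu> f :: "real \<Rightarrow> real" and c \<rho> K :: real
  assumes \<nu>: "(\<nu> \<longlongrightarrow> 0) at_top" and f_def: "f = (\<lambda>x. ln x powr \<nu> x)" and f: "filterlim f at_top at_top"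
    and c: "c > 0" and \<rho>: "0 < \<rho>" and K: "K \<ge> 1"
  shows "\<forall>\<^sub>F y in at_top. ln (ln y) \<ge> 1 \<and> f (y\<^sup>2) > 0 \<and> 1 / (2 * f (y\<^sup>2)) \<le> \<rho> \<and>
     (\<exists>j::nat. even j \<and> j > 0 \<and> 128 * real j * c * f (y\<^sup>2) \<le> sqrt (ln y) \<and>
       4 * real j * (ln (K * y ^ 4 / (1 / (2 * f (y\<^sup>2)))) + 1) < 8 ^ j)"
proof -
  define k where "k = ln K"
  have k: "k \<ge> 0" using K by (simp add: k_def)
  have sq: "filterlim (\<lambda>y::real. y\<^sup>2) at_top at_top" by real_asymp
  have ln: "filterlim (\<lambda>y::real. ln y) at_top at_top" by real_asymp
  have asym: "\<forall>\<^sub>F x in at_top. 128 * (2 * ln (k + 4 * x + ln (2 * (2 * x) powr (1/8)) + 1) + 6) * c * (2 * x) powr (1/8) \<le> sqrt x"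
    using k c by real_asymp
  have e1: "\<forall>\<^sub>F y in at_top. f (y\<^sup>2) \<ge> max 1 (1 / (2 * \<rho>))"
    using filterlim_compose[OF f sq] unfolding filterlim_at_top by blast
  have e2: "\<forall>\<^sub>F y in at_top. \<nu> (y\<^sup>2) < 1 / 8"
    using order_tendstoD(2)[OF filterlim_compose[OF \<nu> sq], of "1/8"] by simp
  have e3: "\<forall>\<^sub>F y :: real in at_top. ln (ln y) \<ge> 1 \<and> ln y \<ge> 1 \<and> y \<ge> 3"
    by (intro eventually_conj eventually_ge_at_top; real_asymp)
  show ?thesis
    using e1 e2 e3 eventually_compose_filterlim[OF asym ln]
  proof eventually_elim
    case (elim y)
    define x where "x = ln y"
    define F where "F = f (y\<^sup>2)"
    have x: "x \<ge> 1" and y: "y \<ge> 3" using elim by (auto simp: x_def)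
    have F1: "F \<ge> 1" and F\<rho>: "1 / (2 * \<rho>) \<le> F" using elim by (auto simp: F_def)
    have "F = (2 * x) powr \<nu> (y\<^sup>2)" unfolding F_def f_def x_def using y by (simp add: ln_realpow)
    also have "\<dots> \<le> (2 * x) powr (1/8)" by (rule powr_mono) (use x elim in auto)
    finally have F: "F \<le> (2 * x) powr (1/8)" .
    define A where "A = ln (K * y ^ 4 / (1 / (2 * F))) + 1"
    have A_eq: "A = k + 4 * x + ln (2 * F) + 1"
    proof -
      have "ln (K * y ^ 4 * (2 * F)) = ln K + ln (y ^ 4) + ln (2 * F)"
        using K y F1 by (subst ln_mult; simp)+
      then show ?thesis unfolding A_def k_def x_def using y by (simp add: ln_realpow)
    qed
    have A1: "A \<ge> 1" unfolding A_eq using k x F1 by simp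
    have AB: "A \<le> k + 4 * x + ln (2 * (2 * x) powr (1/8)) + 1"
    proof -
      have "ln (2 * F) \<le> ln (2 * (2 * x) powr (1/8))" using F F1 x by (subst ln_le_cancel_iff) auto
      then show ?thesis unfolding A_eq by simp
    qed
    define j where "j = 2 * nat \<lceil>ln A\<rceil> + 4"
    have "ln A \<ge> 0" using A1 by simp
    then have "real j \<le> 2 * ln A + 6" unfolding j_def by linarith
    also have "ln A \<le> ln (k + 4 * x + ln (2 * (2 * x) powr (1/8)) + 1)"
      using AB A1 by (subst ln_le_cancel_iff) linarith+
    finally have jle: "real j \<le> 2 * ln (k + 4 * x + ln (2 * (2 * x) powr (1/8)) + 1) + 6" by simp
    have "128 * real j * c * F \<le> 128 * (2 * ln (k + 4 * x + ln (2 * (2 * x) powr (1/8)) + 1) + 6) * c * (2 * x) powr (1/8)"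
      by (intro mult_mono mult_left_mono mult_right_mono jle F) (use c F1 jle in auto)
    also have "\<dots> \<le> sqrt x" using elim by (simp add: x_def)
    finally have "128 * real j * c * F \<le> sqrt (ln y)" by (simp add: x_def)
    moreover have "4 * real j * A < 8 ^ j" unfolding j_def by (rule power_8_beats[OF A1])
    moreover have "even j" "j > 0" by (auto simp: j_def)
    moreover have "1 / (2 * F) \<le> \<rho>" using F\<rho> F1 \<rho> by (simp add: field_simps)
    ultimately show ?case using elim F1 unfolding A_def F_def by auto
  qed
qed

theorem mainTheorem2:
  fixes c\<^sub>0 :: real and \<nu> f :: "real \<Rightarrow> real"
  assumes "admissible_constant c\<^sub>0"
    and "\<And>x. \<nu> x > 0"
    and "(\<nu> \<longlongrightarrow> 0) at_top"
    and "f = (\<lambda>x. ln x powr \<nu> x)"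
    and "mono_on {1<..} f"
    and "filterlim f at_top at_top"
  shows "\<exists>C Q\<^sub>1 :: real. C > 0 \<and> Q\<^sub>1 \<ge> 16 \<and>
    (\<forall>Q\<ge>Q\<^sub>1.
       (\<forall>(q, \<chi>) \<in> real_primitive_characters (Q ^ 2). hypothesis_H f q \<chi>) \<longrightarrow>
       finite {(q, \<chi>). exceptional_character c\<^sub>0 q \<chi> \<and> real q \<le> Q} \<and>
       real (card {(q, \<chi>). exceptional_character c\<^sub>0 q \<chi> \<and> real q \<le> Q}) \<le> C * ln (ln (ln Q)))"
proof -
  have c0: "c\<^sub>0 > 0" using assms(1) by (simp add: admissible_constant_def)
  obtain \<rho> K where \<rho>: "0 < \<rho>" and K: "K \<ge> 1" and rep:
    "\<And>q1 \<chi>1 q2 \<chi>2 (r :: real) (\<delta> :: real) (\<beta>1 :: real) (\<beta>2 :: real) (j :: nat).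
      primitive_character q1 \<chi>1 \<Longrightarrow> primitive_character q2 \<chi>2 \<Longrightarrow>
      quadratic_dirichlet q1 \<chi>1 \<Longrightarrow> quadratic_dirichlet q2 \<chi>2 \<Longrightarrow>
      (q1, \<chi>1) \<noteq> (q2, \<chi>2) \<Longrightarrow> q1 \<le> q2 \<Longrightarrow> 0 < r \<Longrightarrow> r \<le> \<rho> \<Longrightarrow>
      \<forall>d \<psi> s. primitive_character d \<psi> \<and> real_character \<psi> \<and> 1 < d \<and> d \<le> q1 * q2 \<and>
          norm (s - 1) < 2 * r \<and> dirichlet_L \<psi> s = 0 \<longrightarrow> s \<in> \<real> \<Longrightarrow>
      dirichlet_L \<chi>1 (of_real \<beta>1) = 0 \<Longrightarrow> dirichlet_L \<chi>2 (of_real \<beta>2) = 0 \<Longrightarrow>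
      \<beta>1 \<ge> 1 - \<delta> \<Longrightarrow> \<beta>2 \<ge> 1 - \<delta> \<Longrightarrow> even j \<Longrightarrow> j > 0 \<Longrightarrow> 64 * real j * \<delta> \<le> r \<Longrightarrow>
      8 ^ j \<le> 4 * real j * (ln (K * real q2 ^ 4 / r) + 1)"
    by (rule exceptional_repulsion) (rule that, assumption+)
  from eventually_exponent_choice[OF assms(3,4,6) c0 \<rho> K]
  obtain N where N: "\<And>y. y \<ge> N \<Longrightarrow> ln (ln y) \<ge> 1 \<and> f (y\<^sup>2) > 0 \<and> 1 / (2 * f (y\<^sup>2)) \<le> \<rho> \<and>
     (\<exists>j::nat. even j \<and> j > 0 \<and> 128 * real j * c\<^sub>0 * f (y\<^sup>2) \<le> sqrt (ln y) \<and>
       4 * real j * (ln (K * y ^ 4 / (1 / (2 * f (y\<^sup>2)))) + 1) < 8 ^ j)"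
    unfolding eventually_at_top_linorder by blast
  define E where "E Q = {(q, \<chi>). exceptional_character c\<^sub>0 q \<chi> \<and> real q \<le> Q}" for Q
  have qd: "primitive_character q \<chi>" "quadratic_dirichlet q \<chi>" if "exceptional_character c\<^sub>0 q \<chi>" for q \<chi>
    using that by (auto simp: exceptional_character_def quadratic_dirichlet_def primitive_character_def)
  have finE: "finite (E Q)" for Q
    by (rule finite_subset[OF _ finite_quadratic_dirichlet[of Q]]) (auto simp: E_def qd)
  have key: "2 * ln (ln (real q1)) \<le> ln (ln (real q2))"
    if H: "\<forall>(q, \<chi>) \<in> real_primitive_characters (Q ^ 2). hypothesis_H f q \<chi>"
      and e: "exceptional_character c\<^sub>0 q1 \<chi>1" "exceptional_character c\<^sub>0 q2 \<chi>2"
      and ne: "(q1, \<chi>1) \<noteq> (q2, \<chi>2)" and q: "q1 \<le> q2" "real q2 \<le> Q" "real q2 \<ge> N" "ln (ln (real q1)) \<ge> 1"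
    for q1 \<chi>1 q2 \<chi>2 Q
  proof -
    define y where "y = real q2"
    define F where "F = f (y\<^sup>2)"
    have q12: "q1 > 1" "q2 > 1" using quadratic_dirichlet_gt_1 qd(2)[OF e(1)] qd(2)[OF e(2)] by blast+
    have lnq1: "ln (real q1) > 1"
    proof -
      have "ln (real q1) > 0" using q12 by simp
      then show ?thesis using q(4) ln_ge_zero_iff[of "ln (real q1)"] ln_gt_zero_iff[of "ln (real q1)"] by linarith
    qed
    have lnq2: "ln (real q1) \<le> ln y" using q12 q(1) by (simp add: y_def)
    obtain j where F0: "F > 0" and F\<rho>: "1 / (2 * F) \<le> \<rho>" and j: "even j" "j > 0"
      and jF: "128 * real j * c\<^sub>0 * F \<le> sqrt (ln y)"
      and j8: "4 * real j * (ln (K * y ^ 4 / (1 / (2 * F))) + 1) < 8 ^ j"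
      using N[of y] q(3) unfolding y_def[symmetric] F_def by blast
    have "ln (real q1) \<le> sqrt (ln y)"
    proof (rule ccontr)
      assume big: "\<not> ?thesis"
      \<comment> \<open>The weaker of the two bounds for \<open>1 - \<beta>\<close>, valid for both zeros.\<close>
      define \<delta> where "\<delta> = c\<^sub>0 / ln (2 * real q1)"
      obtain \<beta>1 \<beta>2 where \<beta>: "dirichlet_L \<chi>1 (of_real \<beta>1) = 0" "\<beta>1 \<ge> 1 - c\<^sub>0 / ln (2 * real q1)"
         "dirichlet_L \<chi>2 (of_real \<beta>2) = 0" "\<beta>2 \<ge> 1 - c\<^sub>0 / ln (2 * real q2)"
        using e by (auto simp: exceptional_character_def)
      have "c\<^sub>0 / ln (2 * real q2) \<le> c\<^sub>0 / ln (2 * real q1)"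
        using c0 q12 q(1) by (intro divide_left_mono mult_pos_pos) auto
      then have \<beta>\<delta>: "\<beta>1 \<ge> 1 - \<delta>" "\<beta>2 \<ge> 1 - \<delta>" using \<beta> by (auto simp: \<delta>_def)
      have L: "ln (2 * real q1) \<ge> sqrt (ln y)" "ln (2 * real q1) > 0"
      proof -
        have "ln (real q1) \<le> ln (2 * real q1)" using q12 by simp
        then show "ln (2 * real q1) \<ge> sqrt (ln y)" "ln (2 * real q1) > 0" using big lnq1 by linarith+
      qed
      have "128 * real j * c\<^sub>0 * F \<le> ln (2 * real q1)" using jF L by linarith
      then have "64 * real j * \<delta> \<le> 1 / (2 * F)"
        unfolding \<delta>_def using F0 L(2) by (simp add: field_simps)
      moreover have "\<forall>d \<psi> s. primitive_character d \<psi> \<and> real_character \<psi> \<and> 1 < d \<and> d \<le> q1 * q2 \<and>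
          norm (s - 1) < 2 * (1 / (2 * F)) \<and> dirichlet_L \<psi> s = 0 \<longrightarrow> s \<in> \<real>"
      proof (intro allI impI, elim conjE)
        fix d \<psi> and s :: complex
        assume \<psi>: "primitive_character d \<psi>" "real_character \<psi>" and d: "1 < d" "d \<le> q1 * q2"
          and s: "norm (s - 1) < 2 * (1 / (2 * F))" "dirichlet_L \<psi> s = 0"
        have "d \<le> q2 * q2" using d(2) q(1) mult_le_mono1 order_trans by blast
        then have dy: "real d \<le> y\<^sup>2" unfolding y_def power2_eq_square by (metis of_nat_le_iff of_nat_mult)
        also have "y\<^sup>2 \<le> Q\<^sup>2" using q(2) by (intro power_mono) (auto simp: y_def)
        finally have "(d, \<psi>) \<in> real_primitive_characters (Q ^ 2)"
          using \<psi> d by (simp add: real_primitive_characters_def)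
        then have "hypothesis_H f d \<psi>" using H by blast
        moreover have "norm (s - 1) < 1 / f (real d)"
        proof -
          have "f (real d) \<le> F" unfolding F_def using d dy by (intro mono_onD[OF assms(5)]) auto
          moreover have "f (real d) > 0" unfolding assms(4) using d by simp
          ultimately have "1 / F \<le> 1 / f (real d)" by (intro divide_left_mono) auto
          then show ?thesis using s(1) by simp
        qed
        ultimately show "s \<in> \<real>" using s(2) d unfolding hypothesis_H_def by blast
      qed
      ultimately have "8 ^ j \<le> 4 * real j * (ln (K * real q2 ^ 4 / (1 / (2 * F))) + 1)"
        using F0 by (intro rep[OF qd(1)[OF e(1)] qd(1)[OF e(2)] qd(2)[OF e(1)] qd(2)[OF e(2)] ne q(1) _ F\<rho> _ \<beta>(1,3) \<beta>\<delta> j]) auto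
      then show False using j8 unfolding y_def by linarith
    qed
    then have "ln (ln (real q1)) \<le> ln (sqrt (ln y))"
      using lnq1 lnq2 by (subst ln_le_cancel_iff) auto
    also have "\<dots> = ln (ln y) / 2" using lnq1 lnq2 by (simp add: ln_sqrt)
    finally show ?thesis by (simp add: y_def)
  qed
  define C where "C = real (card (E N)) + 1 + 1 / ln 2"
  \<comment> \<open>This makes \<open>ln (ln (ln Q)) \<ge> 1\<close>, so that the constants can be absorbed.\<close>
  define Q1 :: real where "Q1 = max 16 (exp (exp (exp 1)))"
  have "real (card (E Q)) \<le> C * ln (ln (ln Q))"
    if Q: "Q \<ge> Q1" and H: "\<forall>(q, \<chi>) \<in> real_primitive_characters (Q ^ 2). hypothesis_H f q \<chi>" for Q
  proof -
    have Q': "Q \<ge> exp (exp (exp 1))" using Q by (simp add: Q1_def)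
    have "exp (exp 1) \<le> ln Q" using Q' by (subst ln_ge_iff) (auto intro: less_le_trans[OF exp_gt_zero])
    then have lnlnQ: "exp 1 \<le> ln (ln Q)" by (subst ln_ge_iff) (auto intro: less_le_trans[OF exp_gt_zero])
    then have lll: "1 \<le> ln (ln (ln Q))" by (subst ln_ge_iff) (auto intro: less_le_trans[OF exp_gt_zero])
    have lnlnQ1: "ln (ln Q) \<ge> 1" using lnlnQ one_le_exp_iff[of "1::real"] by linarith
    define S where "S = {(q, \<chi>). exceptional_character c\<^sub>0 q \<chi> \<and> real q \<le> Q \<and> real q \<ge> N}"
    have "S \<subseteq> E Q" by (auto simp: S_def E_def)
    then have finS: "finite S" using finE finite_subset by blast
    have "E Q \<subseteq> E N \<union> S" by (auto simp: S_def E_def)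
    then have "card (E Q) \<le> card (E N) + card S"
      using finE finS card_mono[of "E N \<union> S" "E Q"] card_Un_le[of "E N" S] by simp
    moreover have "real (card S) \<le> 1 + log 2 (ln (ln Q))"
    proof (rule card_doubling_bound[where g = "\<lambda>(q, \<chi>). ln (ln (real q))", OF finS])
      show "1 \<le> (case a of (q, \<chi>) \<Rightarrow> ln (ln (real q))) \<and> (case a of (q, \<chi>) \<Rightarrow> ln (ln (real q))) \<le> ln (ln Q)"
        if "a \<in> S" for a
      proof -
        obtain q \<chi> where a: "a = (q, \<chi>)" by (cases a)
        then have q: "exceptional_character c\<^sub>0 q \<chi>" "real q \<le> Q" "real q \<ge> N" using that by (auto simp: S_def)
        have "q > 1" using quadratic_dirichlet_gt_1[OF qd(2)[OF q(1)]] .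
        then have "0 < ln (real q)" "ln (real q) \<le> ln Q" using q(2) by auto
        then have "ln (ln (real q)) \<le> ln (ln Q)" by simp
        then show ?thesis using N[OF q(3)] by (simp add: a)
      qed
      show "2 * (case a of (q, \<chi>) \<Rightarrow> ln (ln (real q))) \<le> (case b of (q, \<chi>) \<Rightarrow> ln (ln (real q))) \<or>
            2 * (case b of (q, \<chi>) \<Rightarrow> ln (ln (real q))) \<le> (case a of (q, \<chi>) \<Rightarrow> ln (ln (real q)))"
        if ab: "a \<in> S" "b \<in> S" "a \<noteq> b" for a b
      proof -
        obtain q \<chi> q' \<chi>' where a: "a = (q, \<chi>)" "b = (q', \<chi>')" by (cases a, cases b)
        then have e: "exceptional_character c\<^sub>0 q \<chi>" "real q \<le> Q" "real q \<ge> N"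
          "exceptional_character c\<^sub>0 q' \<chi>'" "real q' \<le> Q" "real q' \<ge> N" using ab by (auto simp: S_def)
        have ge: "1 \<le> ln (ln (real q))" "1 \<le> ln (ln (real q'))" using N[OF e(3)] N[OF e(6)] by auto
        show ?thesis
        proof (cases "q \<le> q'")
          case True
          have "2 * ln (ln (real q)) \<le> ln (ln (real q'))"
            by (rule key[OF H e(1,4) _ True e(5,6) ge(1)]) (use ab a in simp)
          then show ?thesis by (simp add: a)
        next
          case False
          then have "q' \<le> q" by simp
          have "2 * ln (ln (real q')) \<le> ln (ln (real q))"
            by (rule key[OF H e(4,1) _ \<open>q' \<le> q\<close> e(2,3) ge(2)]) (use ab a in auto)
          then show ?thesis by (simp add: a)
        qed
      qed
    qed (rule lnlnQ1)
    ultimately have "real (card (E Q)) \<le> real (card (E N)) + 1 + ln (ln (ln Q)) / ln 2"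
      by (simp add: log_def)
    also have "\<dots> \<le> (real (card (E N)) + 1) * ln (ln (ln Q)) + ln (ln (ln Q)) / ln 2"
    proof -
      have "(real (card (E N)) + 1) * 1 \<le> (real (card (E N)) + 1) * ln (ln (ln Q))"
        by (rule mult_left_mono[OF lll]) simp
      then show ?thesis by simp
    qed
    also have "\<dots> = C * ln (ln (ln Q))" by (simp add: C_def algebra_simps)
    finally show ?thesis .
  qed
  moreover have "C > 0" unfolding C_def by (intro add_nonneg_pos) auto
  moreover have "Q1 \<ge> 16" by (simp add: Q1_def)
  ultimately show ?thesis using finE unfolding E_def by blast
qed

end
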